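(* Let $\Omega\subset\mathbb{R}^2$ be an open bounded domain with Lipschitz continuous boundary, let $\{\mathcal{T}_h\}$ be a shape-regular, quasi-uniform family of meshes of $\Omega$ consisting of rectangles, with characteristic mesh size $h$, and let $j\ge 0$ be an integer. For each mesh let the weak discrete space $S_h$ and the local gradient spaces $V(K)$, $K\in\mathcal{T}_h$, be given by either one of the following two types of rectangular elements: (1) $(Q_j(K_0),\,Q_j(F),\,RT_j(K))$: $v_0|_{K_0}\in Q_j(K_0)$, $v_b|_F\in Q_j(F)$, and $V(K)=RT_j(K)$; (2) $(P_j(K_0),\,P_{j+1}(F),\,BDM_{j+1}(K))$: $v_0|_{K_0}\in P_j(K_0)$, $v_b|_F\in P_{j+1}(F)$, and $V(K)=BDM_{j+1}(K)$. Let $\nabla_d$ be the discrete gradient on $S_h$ defined with these local spaces $V(K)$, and let $Q_h$ be the $L^2$ projection from $H^1(\Omega)$ onto $S_h$. Then for every $m$ with $0\le m\le j+1$ there is a constant $C$, independent of the mesh size $h$ and of $w$, such that for every $w\in H^{m+1}(\Omega)$ $$\|\nabla_d(Q_h w)-\nabla w\|\le C\,h^{m}\,\|w\|_{m+1}.$$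
   Context: Rectangles have sides parallel to the coordinate axes. For a rectangle $K\in\mathcal{T}_h$, $K_0$ denotes its interior and $\partial K$ its boundary, which consists of four edges; $\mathcal{F}_h$ is the set of all edges of $\mathcal{T}_h$. The unit outward normal on $\partial K$ is $\mathbf{n}$. $\|\cdot\|$ is the $L^2(\Omega)$ norm and $\|\cdot\|_{m+1}$ is the norm of the Sobolev space $H^{m+1}(\Omega)$. Polynomial spaces: $P_k(K)$ is the space of polynomials in $(x,y)$ of total degree $\le k$; $Q_{i,k}(K)$ is the space of polynomials of degree $\le i$ in $x$ and $\le k$ in $y$; $Q_k(K)=Q_{k,k}(K)$. On an edge $F$, $P_k(F)=Q_k(F)$ is the space of univariate polynomials of degree $\le k$ on $F$. With $\mathbf{curl}=(-\partial/\partial y,\ \partial/\partial x)^t$, $$RT_j(K)=Q_{j+1,j}(K)\times Q_{j,j+1}(K),$$ $$BDM_{j+1}(K)=[P_{j+1}(K)]^2+\mathrm{span}\{\mathbf{curl}(x^{j+2}y),\ \mathbf{curl}(xy^{j+2})\}.$$ Weak discrete space: $S_h$ is the set of pairs $v_h=\{v_0,v_b\}$, where $v_0$ assigns to each $K\in\mathcal{T}_h$ a function on $K_0$ and $v_b$ assigns to each $F\in\mathcal{F}_h$ a (single-valued) function on $F$, each lying in the prescribed polynomial space. No continuity is required between elements, between edges, or between $v_0$ and $v_b$. Discrete gradient: for $v_h=\{v_0,v_b\}\in S_h$, $\nabla_d v_h$ is the vector field whose restriction to each $K\in\mathcal{T}_h$ is the unique element of $V(K)$ satisfying $$\int_K \nabla_d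 v_h\cdot \mathbf{q}\,dx=-\int_K v_0\,\nabla\cdot\mathbf{q}\,dx+\int_{\partial K} v_b\,\mathbf{q}\cdot\mathbf{n}\,ds\qquad\text{for all }\mathbf{q}\in V(K).$$ $L^2$ projection: for $w\in H^1(\Omega)$, $Q_h w=\{Q_0 w,\,Q_b w\}\in S_h$, where on each $K\in\mathcal{T}_h$, $Q_0 w|_{K_0}$ is the $L^2(K)$-orthogonal projection of $w$ onto the interior polynomial space ($Q_j(K_0)$ in type (1), $P_j(K_0)$ in type (2)), and on each $F\in\mathcal{F}_h$, $Q_b w|_F$ is the $L^2(F)$-orthogonal projection of the trace of $w$ onto the edge polynomial space ($Q_j(F)$ in type (1), $P_{j+1}(F)$ in type (2)). *)

theory Defs
  imports "HOL-Analysis.Analysis"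
begin

section \<open>Square-integrable functions, smooth functions and Sobolev spaces\<close>

type_synonym plane = "real \<times> real"

definition L2_space :: "'a::euclidean_space set \<Rightarrow> ('a \<Rightarrow> 'b::euclidean_space) set" where
  "L2_space S = {f. f \<in> borel_measurable (lebesgue_on S) \<and>
                    integrable (lebesgue_on S) (\<lambda>x. (norm (f x))\<^sup>2)}"

definition L2_norm :: "'a::euclidean_space set \<Rightarrow> ('a \<Rightarrow> 'b::euclidean_space) \<Rightarrow> real" where
  "L2_norm S f = sqrt (integral\<^sup>L (lebesgue_on S) (\<lambda>x. (norm (f x))\<^sup>2))"

definition pdx :: "(plane \<Rightarrow> real) \<Rightarrow> plane \<Rightarrow> real" where
  "pdx f z = deriv (\<lambda>x. f (x, snd z)) (fst z)"

definition pdy :: "(plane \<Rightarrow> real) \<Rightarrow> plane \<Rightarrow> real" where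
  "pdy f z = deriv (\<lambda>y. f (fst z, y)) (snd z)"

definition pd :: "nat \<Rightarrow> nat \<Rightarrow> (plane \<Rightarrow> real) \<Rightarrow> plane \<Rightarrow> real" where
  "pd a b f = (pdx ^^ a) ((pdy ^^ b) f)"

definition div2 :: "(plane \<Rightarrow> plane) \<Rightarrow> plane \<Rightarrow> real" where
  "div2 q z = pdx (\<lambda>x. fst (q x)) z + pdy (\<lambda>x. snd (q x)) z"

definition curl2 :: "(plane \<Rightarrow> real) \<Rightarrow> plane \<Rightarrow> plane" where
  "curl2 f z = (- pdy f z, pdx f z)"

text \<open>Total differentiability of all the iterated partial derivatives makes each of them
  continuous (and makes their order irrelevant), so this is infinite differentiability.\<close>

definition smooth :: "(plane \<Rightarrow> real) \<Rightarrow> bool" where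
  "smooth f \<longleftrightarrow> (\<forall>a b z. pd a b f differentiable (at z))"

definition test_functions :: "plane set \<Rightarrow> (plane \<Rightarrow> real) set" where
  "test_functions \<Omega> = {\<phi>. smooth \<phi> \<and> compact (closure {z. \<phi> z \<noteq> 0}) \<and>
                           closure {z. \<phi> z \<noteq> 0} \<subseteq> \<Omega>}"

definition is_weak_pd ::
    "plane set \<Rightarrow> nat \<Rightarrow> nat \<Rightarrow> (plane \<Rightarrow> real) \<Rightarrow> (plane \<Rightarrow> real) \<Rightarrow> bool" where
  "is_weak_pd \<Omega> a b w v \<longleftrightarrow>
     (\<forall>\<phi>\<in>test_functions \<Omega>.
        integral\<^sup>L (lebesgue_on \<Omega>) (\<lambda>z. w z * pd a b \<phi> z) =
        (- 1) ^ (a + b) * integral\<^sup>L (lebesgue_on \<Omega>) (\<lambda>z. v z * \<phi> z))"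

text \<open>A weak derivative is only determined up to a null set; \<open>weak_pd\<close> picks a representative.\<close>

definition weak_pd :: "plane set \<Rightarrow> nat \<Rightarrow> nat \<Rightarrow> (plane \<Rightarrow> real) \<Rightarrow> plane \<Rightarrow> real" where
  "weak_pd \<Omega> a b w = (SOME v. v \<in> L2_space \<Omega> \<and> is_weak_pd \<Omega> a b w v)"

definition weak_grad :: "plane set \<Rightarrow> (plane \<Rightarrow> real) \<Rightarrow> plane \<Rightarrow> plane" where
  "weak_grad \<Omega> w z = (weak_pd \<Omega> 1 0 w z, weak_pd \<Omega> 0 1 w z)"

definition sobolev :: "plane set \<Rightarrow> nat \<Rightarrow> (plane \<Rightarrow> real) set" where
  "sobolev \<Omega> k = {w \<in> L2_space \<Omega>.
     \<forall>a b. a + b \<le> k \<longrightarrow> (\<exists>v\<in>L2_space \<Omega>. is_weak_pd \<Omega> a b w v)}"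

definition sobolev_norm :: "plane set \<Rightarrow> nat \<Rightarrow> (plane \<Rightarrow> real) \<Rightarrow> real" where
  "sobolev_norm \<Omega> k w = sqrt (\<Sum>a\<le>k. \<Sum>b\<le>k - a. (L2_norm \<Omega> (weak_pd \<Omega> a b w))\<^sup>2)"

section \<open>Lipschitz domains and rectangular meshes\<close>

text \<open>Near each boundary point, in suitable orthonormal coordinates, the set lies strictly on
  one side of the graph of a Lipschitz function.\<close>

definition lipschitz_boundary :: "plane set \<Rightarrow> bool" where
  "lipschitz_boundary \<Omega> \<longleftrightarrow>
     (\<forall>p\<in>frontier \<Omega>. \<exists>e1 e2 \<delta> L g.
        norm e1 = 1 \<and> norm e2 = 1 \<and> e1 \<bullet> e2 = 0 \<and> 0 < \<delta> \<and>
        L-lipschitz_on (UNIV :: real set) (g :: real \<Rightarrow> real) \<and>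
        (\<forall>z\<in>ball p \<delta>. z \<in> \<Omega> \<longleftrightarrow> g ((z - p) \<bullet> e1) < (z - p) \<bullet> e2))"

definition lipschitz_domain :: "plane set \<Rightarrow> bool" where
  "lipschitz_domain \<Omega> \<longleftrightarrow>
     open \<Omega> \<and> connected \<Omega> \<and> \<Omega> \<noteq> {} \<and> bounded \<Omega> \<and> lipschitz_boundary \<Omega>"

text \<open>The elements are closed rectangles; \<open>division_of\<close> says that there are finitely many, that
  their interiors are disjoint and that their union is the closure of the domain.\<close>

definition rect_mesh :: "plane set \<Rightarrow> plane set set \<Rightarrow> bool" where
  "rect_mesh \<Omega> T \<longleftrightarrow> T division_of (closure \<Omega>) \<and> (\<forall>K\<in>T. interior K \<noteq> {})"

definition mesh_size :: "plane set set \<Rightarrow> real" where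
  "mesh_size T = Max (diameter ` T)"

definition inscribed_diameter :: "plane set \<Rightarrow> real" where
  "inscribed_diameter K = Sup {2 * r | r. 0 < r \<and> (\<exists>z. cball z r \<subseteq> K)}"

definition shape_regular :: "plane set set set \<Rightarrow> bool" where
  "shape_regular \<M> \<longleftrightarrow>
     (\<exists>\<sigma>>0. \<forall>T\<in>\<M>. \<forall>K\<in>T. diameter K \<le> \<sigma> * inscribed_diameter K)"

definition quasi_uniform :: "plane set set set \<Rightarrow> bool" where
  "quasi_uniform \<M> \<longleftrightarrow> (\<exists>\<tau>>0. \<forall>T\<in>\<M>. \<forall>K\<in>T. \<tau> * mesh_size T \<le> diameter K)"

text \<open>The four edges of a rectangle, each paired with the unit outward normal on it.\<close>

definition sides :: "plane set \<Rightarrow> (plane set \<times> plane) set" where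
  "sides K =
     (let (a, c) = interval_lowerbound K; (b, d) = interval_upperbound K in
       {(cbox (a, c) (a, d), (- 1, 0)), (cbox (b, c) (b, d), (1, 0)),
        (cbox (a, c) (b, c), (0, - 1)), (cbox (a, d) (b, d), (0, 1))})"

definition mesh_edges :: "plane set set \<Rightarrow> plane set set" where
  "mesh_edges T = (\<Union>K\<in>T. fst ` sides K)"

text \<open>An edge is a degenerate box, that is, the segment between its lower and its upper corner.\<close>

definition edge_path :: "plane set \<Rightarrow> real \<Rightarrow> plane" where
  "edge_path F = linepath (interval_lowerbound F) (interval_upperbound F)"

definition edge_integral :: "plane set \<Rightarrow> (plane \<Rightarrow> real) \<Rightarrow> real" where
  "edge_integral F f =
     diameter F * integral\<^sup>L (lebesgue_on {0..1}) (\<lambda>t. f (edge_path F t))"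

definition edge_L2_space :: "plane set \<Rightarrow> (plane \<Rightarrow> real) set" where
  "edge_L2_space F = {f. (\<lambda>t. f (edge_path F t)) \<in> L2_space {0..1}}"

definition edge_L2_norm :: "plane set \<Rightarrow> (plane \<Rightarrow> real) \<Rightarrow> real" where
  "edge_L2_norm F f = sqrt (edge_integral F (\<lambda>z. (f z)\<^sup>2))"

text \<open>\<open>\<gamma>\<close> is (a representative of) the trace of \<open>w \<in> H\<^sup>1(\<Omega>)\<close> on the edges in \<open>E\<close>, where the
  trace map is the continuous extension of the restriction map from smooth functions
  on the closure of \<open>\<Omega>\<close>: restrictions of functions approximating \<open>w\<close> in \<open>H\<^sup>1(\<Omega>)\<close> converge
  to \<open>\<gamma>\<close> in the \<open>L\<^sup>2\<close> space of each edge.\<close>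

definition is_trace ::
    "plane set \<Rightarrow> plane set set \<Rightarrow> (plane \<Rightarrow> real) \<Rightarrow> (plane \<Rightarrow> real) \<Rightarrow> bool" where
  "is_trace \<Omega> E w \<gamma> \<longleftrightarrow>
     (\<forall>F\<in>E. \<gamma> \<in> edge_L2_space F) \<and>
     (\<exists>\<phi> :: nat \<Rightarrow> plane \<Rightarrow> real.
        (\<forall>n. smooth (\<phi> n)) \<and>
        (\<lambda>n. sobolev_norm \<Omega> 1 (\<lambda>z. \<phi> n z - w z)) \<longlonglongrightarrow> 0 \<and>
        (\<forall>F\<in>E. (\<lambda>n. edge_L2_norm F (\<lambda>z. \<phi> n z - \<gamma> z)) \<longlonglongrightarrow> 0))"

section \<open>Polynomial spaces\<close>

text \<open>A polynomial on a rectangle with nonempty interior is identified with the polynomial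
  function on the plane that extends it, so these spaces do not depend on the rectangle.\<close>

definition poly_P :: "nat \<Rightarrow> (plane \<Rightarrow> real) set" where
  "poly_P k = {p. \<exists>c :: nat \<Rightarrow> nat \<Rightarrow> real. p = (\<lambda>(x, y). \<Sum>a\<le>k. \<Sum>b\<le>k - a. c a b * x ^ a * y ^ b)}"

definition poly_Q :: "nat \<Rightarrow> nat \<Rightarrow> (plane \<Rightarrow> real) set" where
  "poly_Q i k = {p. \<exists>c :: nat \<Rightarrow> nat \<Rightarrow> real. p = (\<lambda>(x, y). \<Sum>a\<le>i. \<Sum>b\<le>k. c a b * x ^ a * y ^ b)}"

definition RT :: "nat \<Rightarrow> (plane \<Rightarrow> plane) set" where
  "RT j = {(\<lambda>z. (p z, q z)) | p q. p \<in> poly_Q (j + 1) j \<and> q \<in> poly_Q j (j + 1)}"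

text \<open>The argument is the degree of the full polynomial part.\<close>

definition BDM :: "nat \<Rightarrow> (plane \<Rightarrow> plane) set" where
  "BDM k = {(\<lambda>z. (p z, q z) + s *\<^sub>R curl2 (\<lambda>(x, y). x ^ (k + 1) * y) z
                            + t *\<^sub>R curl2 (\<lambda>(x, y). x * y ^ (k + 1)) z)
            | p q s t. p \<in> poly_P k \<and> q \<in> poly_P k}"

text \<open>Polynomials in the arc length along the edge, as functions on the edge only.\<close>

definition edge_poly :: "nat \<Rightarrow> plane set \<Rightarrow> (plane \<Rightarrow> real) set" where
  "edge_poly k F = {restrict (\<lambda>z. poly r (dist (interval_lowerbound F) z)) F
                    | r :: real poly. degree r \<le> k}"

section \<open>Weak discrete spaces, discrete gradient and projection\<close>

text \<open>\<open>QRT\<close> is the element $(Q_j, Q_j, RT_j)$, \<open>PBDM\<close> the element $(P_j, P_{j+1}, BDM_{j+1})$.\<close>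

datatype element_type = QRT | PBDM

fun interior_space :: "element_type \<Rightarrow> nat \<Rightarrow> (plane \<Rightarrow> real) set" where
  "interior_space QRT j = poly_Q j j"
| "interior_space PBDM j = poly_P j"

fun edge_space :: "element_type \<Rightarrow> nat \<Rightarrow> plane set \<Rightarrow> (plane \<Rightarrow> real) set" where
  "edge_space QRT j F = edge_poly j F"
| "edge_space PBDM j F = edge_poly (j + 1) F"

fun grad_space :: "element_type \<Rightarrow> nat \<Rightarrow> (plane \<Rightarrow> plane) set" where
  "grad_space QRT j = RT j"
| "grad_space PBDM j = BDM (j + 1)"

type_synonym weak_function = "(plane set \<Rightarrow> plane \<Rightarrow> real) \<times> (plane set \<Rightarrow> plane \<Rightarrow> real)"

definition weak_space :: "element_type \<Rightarrow> nat \<Rightarrow> plane set set \<Rightarrow> weak_function set" where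
  "weak_space el j T =
     (\<Pi>\<^sub>E K\<in>T. interior_space el j) \<times> (\<Pi>\<^sub>E F\<in>mesh_edges T. edge_space el j F)"

definition local_grad ::
    "element_type \<Rightarrow> nat \<Rightarrow> weak_function \<Rightarrow> plane set \<Rightarrow> plane \<Rightarrow> plane" where
  "local_grad el j v K =
     (THE G. G \<in> grad_space el j \<and>
        (\<forall>q\<in>grad_space el j.
           integral\<^sup>L (lebesgue_on K) (\<lambda>z. G z \<bullet> q z) =
           - integral\<^sup>L (lebesgue_on K) (\<lambda>z. fst v K z * div2 q z)
           + (\<Sum>(F, n)\<in>sides K. edge_integral F (\<lambda>z. snd v F z * (q z \<bullet> n)))))"

text \<open>On the null set formed by the edges the value is 0.\<close>

definition disc_grad ::
    "element_type \<Rightarrow> nat \<Rightarrow> plane set set \<Rightarrow> weak_function \<Rightarrow> plane \<Rightarrow> plane" where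
  "disc_grad el j T v z = (\<Sum>K\<in>T. indicator (interior K) z *\<^sub>R local_grad el j v K z)"

text \<open>The edge components are the projections of the trace \<open>\<gamma>\<close> of \<open>w\<close> on the edges.\<close>

definition L2_proj ::
    "element_type \<Rightarrow> nat \<Rightarrow> plane set set \<Rightarrow> (plane \<Rightarrow> real) \<Rightarrow> (plane \<Rightarrow> real) \<Rightarrow> weak_function"
  where
  "L2_proj el j T w \<gamma> =
     (THE v. v \<in> weak_space el j T \<and>
        (\<forall>K\<in>T. \<forall>q\<in>interior_space el j.
           integral\<^sup>L (lebesgue_on K) (\<lambda>z. (w z - fst v K z) * q z) = 0) \<and>
        (\<forall>F\<in>mesh_edges T. \<forall>q\<in>edge_space el j F.
           edge_integral F (\<lambda>z. (\<gamma> z - snd v F z) * q z) = 0))"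

end

(*
  On each rectangle K the discrete gradient of the projection of w is the L2(K)-projection of
  grad w onto V(K): the divergence of a field in V(K) lies in the interior space and its normal
  components lie in the edge spaces, so the projections in the definition of the discrete gradient
  may be replaced by w and its trace, and Green's formula, obtained in the limit from the smooth
  functions that define the trace, does the rest. Hence the error on K is at most the distance of
  grad w from the pairs of polynomials of degree m - 1, which V(K) contains, and the
  Bramble-Hilbert argument (m applications of the Poincare inequality, after subtracting the
  polynomial whose top-order derivatives have the right means) bounds this distance.

  Weak derivatives are only ever tested with polynomials that vanish on two opposite sides of K.
  Such a polynomial times a smooth cutoff function is an admissible test function, and the cutoff
  disappears in the limit by dominated convergence. This avoids mollification, and it also makes
  the choice of a representative of a weak derivative irrelevant.
*)
theory Submission
  imports Defs
begin

section \<open>Square-integrable functions\<close>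

text \<open>A weak derivative is a representative picked by \<open>SOME\<close>, and the
  approximation that defines the trace converges in a norm of the derivative picked for
  \<open>\<phi> n - w\<close>, which need not be the difference of the picked derivatives. So weak
  derivatives are compared only through their pairings with polynomials. These pairings lose
  nothing, because polynomials are dense in L2 of a rectangle: the Poincare inequality is proved as
  a bound on the pairing of \<open>u\<close> with a polynomial and reaches the norm of
  \<open>u\<close> by duality. The inequality holds on each rectangle with its own side lengths as
  constants, so there is no scaling from a reference element and the power of h is explicit. Each
  application costs a factor 2 h; the remaining factor sqrt (2 (m + 1)) counts the two components of
  the gradient and the m + 1 derivatives of order m of each. The Lipschitz boundary guarantees that
  the interior of an element lies in the open set \<Omega> (a slit would break this), so that
  functions supported in the open element are admissible as test functions.\<close>

abbreviation lint :: "'a::euclidean_space set \<Rightarrow> ('a \<Rightarrow> 'b::{banach, second_countable_topology}) \<Rightarrow> 'b" where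
  "lint S \<equiv> integral\<^sup>L (lebesgue_on S)"

lemma L2_space_real:
  fixes f :: "'a::euclidean_space \<Rightarrow> real"
  shows "f \<in> L2_space S \<longleftrightarrow> f \<in> borel_measurable (lebesgue_on S) \<and> integrable (lebesgue_on S) (\<lambda>x. (f x)\<^sup>2)"
  by (simp add: L2_space_def)

lemma L2_norm_nonneg [simp]: "0 \<le> L2_norm S f"
  by (simp add: L2_norm_def)

lemma L2_norm_power2_real:
  fixes f :: "'a::euclidean_space \<Rightarrow> real"
  shows "(L2_norm S f)\<^sup>2 = lint S (\<lambda>x. (f x)\<^sup>2)"
  by (simp add: L2_norm_def)

lemma integrable_mult_L2:
  fixes f g :: "'a::euclidean_space \<Rightarrow> real"
  assumes "f \<in> L2_space S" "g \<in> L2_space S"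
  shows "integrable (lebesgue_on S) (\<lambda>x. f x * g x)"
proof (rule Bochner_Integration.integrable_bound)
  show "integrable (lebesgue_on S) (\<lambda>x. (f x)\<^sup>2 + (g x)\<^sup>2)"
    using assms by (simp add: L2_space_real)
  show "(\<lambda>x. f x * g x) \<in> borel_measurable (lebesgue_on S)"
    using assms by (auto simp: L2_space_real)
  have "\<bar>f x * g x\<bar> \<le> (f x)\<^sup>2 + (g x)\<^sup>2" for x
  proof -
    have "2 * \<bar>f x * g x\<bar> \<le> (f x)\<^sup>2 + (g x)\<^sup>2"
      using sum_squares_bound[of "\<bar>f x\<bar>" "\<bar>g x\<bar>"] by (simp add: abs_mult)
    then show ?thesis using abs_ge_zero[of "f x * g x"] by linarith
  qed
  then show "AE x in lebesgue_on S. norm (f x * g x) \<le> norm ((f x)\<^sup>2 + (g x)\<^sup>2)"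
    by simp
qed

lemma L2_space_add:
  fixes f g :: "'a::euclidean_space \<Rightarrow> real"
  assumes "f \<in> L2_space S" "g \<in> L2_space S"
  shows "(\<lambda>x. f x + g x) \<in> L2_space S"
  using assms integrable_mult_L2[OF assms]
  by (auto simp: L2_space_real power2_sum mult.assoc)

lemma L2_space_cmult:
  fixes f :: "'a::euclidean_space \<Rightarrow> real"
  assumes "f \<in> L2_space S"
  shows "(\<lambda>x. k * f x) \<in> L2_space S"
  using assms by (auto simp: L2_space_real power_mult_distrib)

lemma L2_space_diff:
  fixes f g :: "'a::euclidean_space \<Rightarrow> real"
  assumes "f \<in> L2_space S" "g \<in> L2_space S"
  shows "(\<lambda>x. f x - g x) \<in> L2_space S"
  using L2_space_add[OF assms(1) L2_space_cmult[OF assms(2), of "-1"]] by simp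

lemma L2_space_sum:
  fixes f :: "'i \<Rightarrow> 'a::euclidean_space \<Rightarrow> real"
  assumes "\<And>i. i \<in> I \<Longrightarrow> f i \<in> L2_space S"
  shows "(\<lambda>x. \<Sum>i\<in>I. f i x) \<in> L2_space S"
  using assms
proof (induction I rule: infinite_finite_induct)
  case (insert i I)
  then show ?case using L2_space_add[of "f i" S "\<lambda>x. \<Sum>i\<in>I. f i x"] by simp
qed (simp_all add: L2_space_real)

text \<open>The form \<open>t\<^sup>2 * A + 2 * t * s * C + s\<^sup>2 * B\<close> is the integral of
  a square, hence nonnegative for all \<open>t\<close> and \<open>s\<close>; the claim is the
  resulting discriminant inequality.\<close>

lemma L2_Cauchy_Schwarz:
  fixes f g :: "'a::euclidean_space \<Rightarrow> real"
  assumes "f \<in> L2_space S" "g \<in> L2_space S"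
  shows "\<bar>lint S (\<lambda>x. f x * g x)\<bar> \<le> L2_norm S f * L2_norm S g"
proof -
  define A where "A = lint S (\<lambda>x. (f x)\<^sup>2)"
  define B where "B = lint S (\<lambda>x. (g x)\<^sup>2)"
  define C where "C = lint S (\<lambda>x. f x * g x)"
  have fg: "integrable (lebesgue_on S) (\<lambda>x. f x * g x)"
    using assms by (rule integrable_mult_L2)
  have quad: "0 \<le> t\<^sup>2 * A + 2 * t * s * C + s\<^sup>2 * B" for t s
  proof -
    have "0 \<le> lint S (\<lambda>x. (t * f x + s * g x)\<^sup>2)"
      by simp
    also have "(\<lambda>x. (t * f x + s * g x)\<^sup>2) = (\<lambda>x. t\<^sup>2 * (f x)\<^sup>2 + 2 * t * s * (f x * g x) + s\<^sup>2 * (g x)\<^sup>2)"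
      by (auto simp: power2_eq_square algebra_simps)
    also have "lint S \<dots> = t\<^sup>2 * A + 2 * t * s * C + s\<^sup>2 * B"
      using assms fg by (simp add: L2_space_real A_def B_def C_def)
    finally show ?thesis .
  qed
  have "A \<ge> 0" "B \<ge> 0" by (simp_all add: A_def B_def)
  have "C\<^sup>2 \<le> A * B"
  proof (cases "B = 0")
    case True
    have "C = 0"
    proof (rule ccontr)
      assume "C \<noteq> 0"
      \<comment> \<open>With this value of \<open>s\<close> the form equals -1, since
        \<open>B\<close> vanishes.\<close>
      have "0 \<le> A + 2 * ((- (A + 1)) / (2 * C)) * C"
        using quad[of 1 "(- (A + 1)) / (2 * C)"] True by simp
      then show False using \<open>C \<noteq> 0\<close> by (simp add: field_simps)
    qed
    then show ?thesis using True by simp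
  next
    case False
    then have "B > 0" using \<open>B \<ge> 0\<close> by simp
    \<comment> \<open>Choosing \<open>t = B\<close> and \<open>s = -C\<close> avoids dividing by
      \<open>B\<close>: the form becomes \<open>B * (A * B - C\<^sup>2)\<close>.\<close>
    have "0 \<le> B\<^sup>2 * A - 2 * B * C * C + C\<^sup>2 * B"
      using quad[of B "-C"] by (simp add: algebra_simps)
    then have "0 \<le> B * (A * B - C\<^sup>2)" by (simp add: power2_eq_square algebra_simps)
    then show ?thesis using \<open>B > 0\<close> by (simp add: zero_le_mult_iff)
  qed
  then have "\<bar>C\<bar> \<le> sqrt (A * B)"
    by (simp add: real_le_rsqrt)
  then show ?thesis
    by (simp add: L2_norm_def A_def B_def C_def real_sqrt_mult)
qed

lemma L2_norm_triangle:
  fixes f g :: "'a::euclidean_space \<Rightarrow> real"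
  assumes "f \<in> L2_space S" "g \<in> L2_space S"
  shows "L2_norm S (\<lambda>x. f x + g x) \<le> L2_norm S f + L2_norm S g"
proof (rule power2_le_imp_le)
  have fg: "integrable (lebesgue_on S) (\<lambda>x. f x * g x)"
    using assms by (rule integrable_mult_L2)
  have "(\<lambda>x. (f x + g x)\<^sup>2) = (\<lambda>x. (f x)\<^sup>2 + 2 * (f x * g x) + (g x)\<^sup>2)"
    by (auto simp: power2_eq_square algebra_simps)
  then have "(L2_norm S (\<lambda>x. f x + g x))\<^sup>2
      = (L2_norm S f)\<^sup>2 + 2 * lint S (\<lambda>x. f x * g x) + (L2_norm S g)\<^sup>2"
    using assms fg by (simp add: L2_norm_power2_real L2_space_real)
  also have "\<dots> \<le> (L2_norm S f)\<^sup>2 + 2 * (L2_norm S f * L2_norm S g) + (L2_norm S g)\<^sup>2"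
    using L2_Cauchy_Schwarz[OF assms] by simp
  finally show "(L2_norm S (\<lambda>x. f x + g x))\<^sup>2 \<le> (L2_norm S f + L2_norm S g)\<^sup>2"
    by (simp add: power2_eq_square algebra_simps)
qed simp

lemma L2_norm_triangle_diff:
  fixes f g :: "'a::euclidean_space \<Rightarrow> real"
  assumes "f \<in> L2_space S" "g \<in> L2_space S"
  shows "L2_norm S f \<le> L2_norm S g + L2_norm S (\<lambda>x. f x - g x)"
  using L2_norm_triangle[OF assms(2) L2_space_diff[OF assms]] by simp

lemma L2_norm_minus_commute:
  fixes f g :: "'a::euclidean_space \<Rightarrow> real"
  shows "L2_norm S (\<lambda>x. f x - g x) = L2_norm S (\<lambda>x. g x - f x)"
  by (simp add: L2_norm_def power2_commute)

lemma L2_space_continuous: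
  fixes f :: "'a::euclidean_space \<Rightarrow> real"
  assumes "continuous_on (cbox a b) f"
  shows "f \<in> L2_space (cbox a b)"
proof -
  have "integrable (lebesgue_on (cbox a b)) f" "integrable (lebesgue_on (cbox a b)) (\<lambda>x. (f x)\<^sup>2)"
    using assms by (auto intro!: continuous_imp_integrable continuous_intros)
  then show ?thesis
    by (auto simp: L2_space_real)
qed

section \<open>Changing the domain of integration by a null set\<close>

lemma borel_measurable_lebesgue_on_null_eq:
  fixes f :: "'a::euclidean_space \<Rightarrow> 'b::euclidean_space"
  assumes "S \<in> sets lebesgue" "T \<in> sets lebesgue" "negligible (S - T)" "negligible (T - S)"
    and "f \<in> borel_measurable (lebesgue_on S)"
  shows "f \<in> borel_measurable (lebesgue_on T)"
proof -
  have N: "(S - T) \<union> (T - S) \<in> null_sets lebesgue"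
    using assms(3,4) negligible_iff_null_sets by auto
  have "(\<lambda>x. if x \<in> T then f x else 0) \<in> borel_measurable lebesgue"
  proof (rule borel_measurable_AE)
    show "(\<lambda>x. if x \<in> S then f x else 0) \<in> borel_measurable lebesgue"
      using assms by (simp add: borel_measurable_if)
    show "AE x in lebesgue. (if x \<in> S then f x else 0) = (if x \<in> T then f x else 0)"
      by (rule AE_I'[OF N]) auto
  qed
  then show ?thesis using assms by (simp add: borel_measurable_if)
qed

text \<open>Extended by zero, the two restrictions differ only on a null set, and Lebesgue measure
  is complete. The statement covers nonmeasurable functions as well: these are integrable on neither
  set, and both integrals take the value 0. Hence open and closed rectangles can be exchanged
  freely.\<close>

lemma lebesgue_on_null_eq:
  fixes f :: "'a::euclidean_space \<Rightarrow> 'b::euclidean_space"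
  assumes "S \<in> sets lebesgue" "T \<in> sets lebesgue" "negligible (S - T)" "negligible (T - S)"
  shows "integrable (lebesgue_on S) f \<longleftrightarrow> integrable (lebesgue_on T) f"
    and "lint S f = lint T f"
proof -
  let ?fS = "\<lambda>x. if x \<in> S then f x else 0" and ?fT = "\<lambda>x. if x \<in> T then f x else 0"
  have N: "(S - T) \<union> (T - S) \<in> null_sets lebesgue"
    using assms(3,4) negligible_iff_null_sets by auto
  have ae: "AE x in lebesgue. ?fS x = ?fT x"
    by (rule AE_I'[OF N]) auto
  have meas: "f \<in> borel_measurable (lebesgue_on S) \<longleftrightarrow> f \<in> borel_measurable (lebesgue_on T)"
    using borel_measurable_lebesgue_on_null_eq[OF assms, of f]
      borel_measurable_lebesgue_on_null_eq[OF assms(2,1,4,3), of f] by blast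
  have "integrable (lebesgue_on S) f = integrable (lebesgue_on T) f \<and>
     lint S f = lint T f"
  proof (cases "f \<in> borel_measurable (lebesgue_on S)")
    case True
    then have m: "?fS \<in> borel_measurable lebesgue" "?fT \<in> borel_measurable lebesgue"
      using meas assms borel_measurable_if by auto
    show ?thesis
      using integrable_cong_AE[OF m ae] integral_cong_AE[OF m ae] assms
      by (simp add: Lebesgue_Measure.integrable_restrict_UNIV Lebesgue_Measure.integral_restrict_UNIV)
  next
    case False
    then have "\<not> integrable (lebesgue_on S) f" "\<not> integrable (lebesgue_on T) f"
      using meas by (auto dest: borel_measurable_integrable)
    then show ?thesis by (simp add: not_integrable_integral_eq)
  qed
  then show "integrable (lebesgue_on S) f \<longleftrightarrow> integrable (lebesgue_on T) f"
    "lint S f = lint T f" by auto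
qed

lemma integrable_lebesgue_on_subset:
  fixes f :: "'a::euclidean_space \<Rightarrow> 'b::euclidean_space"
  assumes "integrable (lebesgue_on T) f" "S \<subseteq> T" "S \<in> sets lebesgue" "T \<in> sets lebesgue"
  shows "integrable (lebesgue_on S) f"
proof -
  have "integrable (lebesgue_on T) (\<lambda>x. indicator S x *\<^sub>R f x)"
    using assms by (intro integrable_mult_indicator) (auto simp: sets_restrict_space)
  then have "integrable lebesgue (\<lambda>x. indicator T x *\<^sub>R (indicator S x *\<^sub>R f x))"
    using assms by (simp add: integrable_restrict_space)
  also have "(\<lambda>x. indicator T x *\<^sub>R (indicator S x *\<^sub>R f x)) = (\<lambda>x. indicator S x *\<^sub>R f x)"
    using assms(2) by (auto simp: indicator_def fun_eq_iff)
  finally show ?thesis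
    using assms by (simp add: integrable_restrict_space)
qed

text \<open>Inclusion is required only up to a null set because a closed element may touch the
  boundary of the open set \<Omega>; this form allows restriction from \<Omega> to such an
  element.\<close>

lemma L2_space_subset:
  fixes f :: "'a::euclidean_space \<Rightarrow> real"
  assumes "f \<in> L2_space T" "S \<in> sets lebesgue" "T \<in> sets lebesgue" "negligible (S - T)"
  shows "f \<in> L2_space S"
proof -
  have ST: "S \<inter> T \<in> sets lebesgue" using assms by auto
  have null: "negligible (S \<inter> T - S)" "negligible (S - S \<inter> T)"
    using assms(4) by (simp_all add: Diff_Int Int_Diff)
  have m: "f \<in> borel_measurable (lebesgue_on (S \<inter> T))"
    by (rule measurable_restrict_mono[of _ _ T]) (use assms(1) in \<open>simp_all add: L2_space_real\<close>)
  have i: "integrable (lebesgue_on (S \<inter> T)) (\<lambda>x. (f x)\<^sup>2)"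
  proof (rule integrable_lebesgue_on_subset)
    show "integrable (lebesgue_on T) (\<lambda>x. (f x)\<^sup>2)"
      using assms(1) unfolding L2_space_real by blast
  qed (use ST assms(3) in blast)+
  show ?thesis
    unfolding L2_space_real
    using borel_measurable_lebesgue_on_null_eq[OF ST assms(2) null m]
      lebesgue_on_null_eq(1)[OF ST assms(2) null, of "\<lambda>x. (f x)\<^sup>2"] i by simp
qed

section \<open>Smooth cutoff functions\<close>

text \<open>\<open>deriv\<close> has an arbitrary value where no derivative exists, so every order
  asserts differentiability explicitly.\<close>

primrec n_times_differentiable :: "nat \<Rightarrow> (real \<Rightarrow> real) \<Rightarrow> bool" where
  "n_times_differentiable 0 f \<longleftrightarrow> True"
| "n_times_differentiable (Suc n) f \<longleftrightarrow>
     (\<forall>x. (f has_real_derivative deriv f x) (at x)) \<and> n_times_differentiable n (deriv f)"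

definition smooth_real :: "(real \<Rightarrow> real) \<Rightarrow> bool" where
  "smooth_real f \<longleftrightarrow> (\<forall>n. n_times_differentiable n f)"

lemma smooth_real_DERIV: "smooth_real f \<Longrightarrow> (f has_real_derivative deriv f x) (at x)"
  unfolding smooth_real_def by (metis n_times_differentiable.simps(2))

lemma smooth_real_deriv: "smooth_real f \<Longrightarrow> smooth_real (deriv f)"
  unfolding smooth_real_def by (metis n_times_differentiable.simps(2))

lemma smooth_real_deriv_iterate: "smooth_real f \<Longrightarrow> smooth_real ((deriv ^^ n) f)"
  by (induction n) (auto intro: smooth_real_deriv)

text \<open>Members of a family closed under differentiation can be differentiated any number of
  times. This avoids formulas for n-th derivatives; it is applied to the polynomials and to the
  functions \<open>exp_inv p\<close>.\<close>

lemma smooth_real_coinduct: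
  assumes "f \<in> S" and "\<And>f. f \<in> S \<Longrightarrow> \<exists>g\<in>S. \<forall>x. (f has_real_derivative g x) (at x)"
  shows "smooth_real f"
proof -
  have "n_times_differentiable n f" if "f \<in> S" for n f
    using that
  proof (induction n arbitrary: f)
    case (Suc n)
    obtain g where g: "g \<in> S" "\<And>x. (f has_real_derivative g x) (at x)"
      using assms(2)[OF Suc.prems] by blast
    then have "deriv f = g" by (intro ext DERIV_imp_deriv)
    then show ?case using Suc.IH g by simp
  qed simp
  then show ?thesis using assms(1) by (simp add: smooth_real_def)
qed

lemma n_times_differentiable_add:
  "n_times_differentiable n f \<Longrightarrow> n_times_differentiable n g \<Longrightarrow>
   n_times_differentiable n (\<lambda>x. f x + g x)"
proof (induction n arbitrary: f g)
  case (Suc n)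
  have d: "((\<lambda>x. f x + g x) has_real_derivative (deriv f x + deriv g x)) (at x)" for x
    using Suc.prems by (intro DERIV_add) auto
  then have "deriv (\<lambda>x. f x + g x) = (\<lambda>x. deriv f x + deriv g x)"
    by (intro ext DERIV_imp_deriv)
  then show ?case using d Suc by simp
qed simp

lemma n_times_differentiable_Suc:
  "n_times_differentiable (Suc n) f \<Longrightarrow> n_times_differentiable n f"
  by (induction n arbitrary: f) auto

lemma n_times_differentiable_mult:
  "n_times_differentiable n f \<Longrightarrow> n_times_differentiable n g \<Longrightarrow>
   n_times_differentiable n (\<lambda>x. f x * g x)"
proof (induction n arbitrary: f g)
  case (Suc n)
  have d: "((\<lambda>x. f x * g x) has_real_derivative (deriv f x * g x + f x * deriv g x)) (at x)" for x
    using Suc.prems by (auto intro!: derivative_eq_intros)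
  then have e: "deriv (\<lambda>x. f x * g x) = (\<lambda>x. deriv f x * g x + f x * deriv g x)"
    by (intro ext DERIV_imp_deriv)
  have "n_times_differentiable n (\<lambda>x. deriv f x * g x + f x * deriv g x)"
    using Suc.prems n_times_differentiable_Suc
    by (intro n_times_differentiable_add Suc.IH) auto
  then show ?case using d e by simp
qed simp

lemma smooth_real_mult: "smooth_real f \<Longrightarrow> smooth_real g \<Longrightarrow> smooth_real (\<lambda>x. f x * g x)"
  by (simp add: smooth_real_def n_times_differentiable_mult)

lemma smooth_real_poly: "smooth_real (poly p)"
  by (rule smooth_real_coinduct[of _ "range poly"]) (auto intro: poly_DERIV)

lemma n_times_differentiable_affine:
  "n_times_differentiable n f \<Longrightarrow> n_times_differentiable n (\<lambda>x. k * f (\<alpha> * x + \<beta>))"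
proof (induction n arbitrary: f k)
  case (Suc n)
  have d: "((\<lambda>x. k * f (\<alpha> * x + \<beta>)) has_real_derivative (k * \<alpha>) * deriv f (\<alpha> * x + \<beta>)) (at x)" for x
  proof -
    have "((\<lambda>x. f (\<alpha> * x + \<beta>)) has_real_derivative (deriv f (\<alpha> * x + \<beta>) * \<alpha>)) (at x)"
      by (rule DERIV_chain2[where f=f and g="\<lambda>x. \<alpha> * x + \<beta>"])
        (use Suc.prems in \<open>auto intro!: derivative_eq_intros\<close>)
    then show ?thesis by (auto intro!: derivative_eq_intros)
  qed
  then have "deriv (\<lambda>x. k * f (\<alpha> * x + \<beta>)) = (\<lambda>x. (k * \<alpha>) * deriv f (\<alpha> * x + \<beta>))"
    by (intro ext DERIV_imp_deriv)
  then show ?case using d Suc by simp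
qed simp

lemma smooth_real_affine: "smooth_real f \<Longrightarrow> smooth_real (\<lambda>x. f (\<alpha> * x + \<beta>))"
  unfolding smooth_real_def using n_times_differentiable_affine[of _ f 1 \<alpha> \<beta>] by simp

text \<open>This family is closed under differentiation, so all its members are smooth.\<close>

definition exp_inv :: "real poly \<Rightarrow> real \<Rightarrow> real" where
  "exp_inv p x = (if x \<le> 0 then 0 else poly p (1 / x) * exp (- (1 / x)))"

lemma tendsto_poly_exp_0: "((\<lambda>y. poly p y * exp (- y)) \<longlongrightarrow> (0::real)) at_top"
proof -
  have "((\<lambda>y. \<Sum>i\<le>degree p. coeff p i * (y ^ i / exp y)) \<longlongrightarrow> (\<Sum>i\<le>degree p. coeff p i * 0)) at_top"
    by (intro tendsto_intros tendsto_power_div_exp_0)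
  moreover have "(\<Sum>i\<le>degree p. coeff p i * (y ^ i / exp y)) = poly p y * exp (- y)" for y
    by (simp add: poly_altdef exp_minus sum_distrib_right field_simps sum_divide_distrib)
  ultimately show ?thesis by simp
qed

lemma exp_inv_tendsto_0: "(exp_inv p \<longlongrightarrow> 0) (at 0)"
proof (rule filterlim_split_at)
  have "eventually (\<lambda>x. exp_inv p x = 0) (at_left 0)"
    by (auto simp: exp_inv_def eventually_at intro!: exI[of _ 1])
  then show "(exp_inv p \<longlongrightarrow> 0) (at_left 0)"
    by (rule tendsto_eventually)
  have "((\<lambda>x. poly p (inverse x) * exp (- inverse x)) \<longlongrightarrow> 0) (at_right 0)"
    using filterlim_compose[OF tendsto_poly_exp_0 filterlim_inverse_at_top_right] .
  moreover have "eventually (\<lambda>x. poly p (inverse x) * exp (- inverse x) = exp_inv p x) (at_right 0)"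
    by (auto simp: exp_inv_def eventually_at inverse_eq_divide intro!: exI[of _ 1])
  ultimately show "(exp_inv p \<longlongrightarrow> 0) (at_right 0)"
    by (rule Lim_transform_eventually)
qed

text \<open>For positive x the derivative of p(1/x) exp(-1/x) is (p - p')(1/x) exp(-1/x) times the
  square of 1/x, and this last factor is absorbed into the polynomial as multiplication by
  \<open>[:0, 0, 1:]\<close>.\<close>

lemma exp_inv_DERIV:
  "(exp_inv p has_real_derivative exp_inv ([:0, 0, 1:] * (p - pderiv p)) x) (at x)"
proof -
  consider "x < 0" | "x = 0" | "x > 0" by linarith
  then show ?thesis
  proof cases
    case 1
    have "((\<lambda>x. 0) has_real_derivative 0) (at x)" by simp
    then have "(exp_inv p has_real_derivative 0) (at x)"
    proof (rule has_field_derivative_transform_within_open[where S="{..<0}"])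
    qed (use 1 in \<open>auto simp: exp_inv_def\<close>)
    then show ?thesis using 1 by (simp add: exp_inv_def)
  next
    case 2
    \<comment> \<open>The difference quotient at 0 is again a member of the family, with
      \<open>p\<close> multiplied by its variable, so its limit is already known.\<close>
    have "(\<lambda>t. exp_inv p t / t) = exp_inv ([:0, 1:] * p)"
      by (auto simp: exp_inv_def fun_eq_iff)
    then have "((\<lambda>t. exp_inv p t / t) \<longlongrightarrow> 0) (at 0)"
      using exp_inv_tendsto_0[of "[:0, 1:] * p"] by simp
    then show ?thesis using 2 by (simp add: has_field_derivative_iff exp_inv_def)
  next
    case 3
    have "((\<lambda>x. poly p (1 / x) * exp (- (1 / x))) has_real_derivative
        poly ([:0, 0, 1:] * (p - pderiv p)) (1 / x) * exp (- (1 / x))) (at x)"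
      using 3
      by (auto intro!: derivative_eq_intros DERIV_chain2[OF poly_DERIV] simp: field_simps power2_eq_square)
    then have "(exp_inv p has_real_derivative
        poly ([:0, 0, 1:] * (p - pderiv p)) (1 / x) * exp (- (1 / x))) (at x)"
    proof (rule has_field_derivative_transform_within_open[where S="{0<..}"])
    qed (use 3 in \<open>auto simp: exp_inv_def\<close>)
    then show ?thesis using 3 by (simp add: exp_inv_def)
  qed
qed

lemma smooth_real_exp_inv: "smooth_real (exp_inv p)"
  by (rule smooth_real_coinduct[of _ "range exp_inv"]) (use exp_inv_DERIV in blast)+

text \<open>A smooth step, not a compactly supported bump: it vanishes for nonpositive arguments and
  increases to 1 without reaching it. Cutoffs built from it tend to 1 only in the limit, which is
  all that dominated convergence needs.\<close>

definition bump :: "real \<Rightarrow> real" where "bump = exp_inv 1"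

lemma bump_eq: "bump x = (if x \<le> 0 then 0 else exp (- (1 / x)))"
  by (simp add: bump_def exp_inv_def)

lemma deriv_bump: "deriv bump x = (if x \<le> 0 then 0 else exp (- (1 / x)) / x\<^sup>2)"
  unfolding bump_def
  by (subst DERIV_imp_deriv[OF exp_inv_DERIV])
    (simp add: exp_inv_def pderiv_1 power2_eq_square)

lemma bump_bounds: "0 \<le> bump x" "bump x \<le> 1"
  by (auto simp: bump_eq)

text \<open>The weight \<open>x + 1\<close> anticipates the shift by 1 inside \<open>cutoff\<close>.
  With \<open>y = 1 / x\<close> the quantity becomes \<open>(y + y\<^sup>2) * exp (- y)\<close>, and
  the bound 2 comes from the quadratic Taylor bound of the exponential.\<close>

lemma deriv_bump_bounds: "0 \<le> (x + 1) * deriv bump x" "(x + 1) * deriv bump x \<le> 2"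
proof -
  show "0 \<le> (x + 1) * deriv bump x" by (simp add: deriv_bump)
  show "(x + 1) * deriv bump x \<le> 2"
  proof (cases "x \<le> 0")
    case False
    define y where "y = 1 / x"
    have y: "y > 0" using False by (simp add: y_def)
    have "(x + 1) * deriv bump x = (y + y\<^sup>2) * exp (- y)"
      using False by (simp add: deriv_bump y_def field_simps power2_eq_square)
    also have "\<dots> = (y + y\<^sup>2) / exp y" by (simp add: exp_minus divide_inverse)
    also have "\<dots> \<le> 2"
    proof -
      have "y + y\<^sup>2 \<le> 2 * (1 + y + y\<^sup>2 / 2)" using y by simp
      also have "\<dots> \<le> 2 * exp y" using exp_lower_Taylor_quadratic[of y] y by simp
      finally show ?thesis by (simp add: field_simps)
    qed
    finally show ?thesis .
  qed (simp add: deriv_bump)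
qed

lemma bump_tendsto_1: "(bump \<longlongrightarrow> 1) at_top"
proof -
  have "((\<lambda>x::real. exp (- (1 / x))) \<longlongrightarrow> exp (- 0)) at_top"
    by (intro tendsto_intros tendsto_divide_0[OF tendsto_const] filterlim_at_top_imp_at_infinity filterlim_ident)
  moreover have "eventually (\<lambda>x. exp (- (1 / x)) = bump x) at_top"
    using eventually_gt_at_top[of 0] by eventually_elim (simp add: bump_eq)
  ultimately show ?thesis by (auto intro: Lim_transform_eventually)
qed

lemma deriv_bump_tendsto_0: "((\<lambda>x. (x + 1) * deriv bump x) \<longlongrightarrow> 0) at_top"
proof (rule tendsto_sandwich)
  show "((\<lambda>x::real. 0::real) \<longlongrightarrow> 0) at_top" by simp
  show "eventually (\<lambda>x. 0 \<le> (x + 1) * deriv bump x) at_top"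
    by (simp add: deriv_bump_bounds)
  show "eventually (\<lambda>x. (x + 1) * deriv bump x \<le> 2 / x) at_top"
    using eventually_ge_at_top[of 1]
  proof eventually_elim
    case (elim x)
    have "(x + 1) * deriv bump x \<le> (x + 1) * (1 / x\<^sup>2)"
      using elim by (intro mult_left_mono) (auto simp: deriv_bump intro!: divide_right_mono)
    also have "\<dots> \<le> (2 * x) * (1 / x\<^sup>2)"
      using elim by (intro mult_right_mono) auto
    also have "\<dots> = 2 / x" using elim by (simp add: power2_eq_square)
    finally show ?case .
  qed
  show "((\<lambda>x::real. 2 / x) \<longlongrightarrow> 0) at_top"
    by (intro tendsto_divide_0[OF tendsto_const] filterlim_at_top_imp_at_infinity filterlim_ident)
qed

text \<open>Scaling by \<open>Suc n\<close> sharpens the transition at both ends, and the shift by 1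
  makes the function vanish within distance \<open>1 / real (Suc n)\<close> of either endpoint and
  beyond it, so that its support is a compact part of the open interval.\<close>

definition cutoff :: "real \<Rightarrow> real \<Rightarrow> nat \<Rightarrow> real \<Rightarrow> real" where
  "cutoff a b n x = bump ((x - a) * real (Suc n) - 1) * bump ((b - x) * real (Suc n) - 1)"

lemma cutoff_bounds: "0 \<le> cutoff a b n x" "cutoff a b n x \<le> 1"
  using bump_bounds by (auto simp: cutoff_def intro!: mult_le_one)

lemma smooth_real_cutoff: "smooth_real (cutoff a b n)"
proof -
  let ?N = "real (Suc n)"
  have "smooth_real (\<lambda>x. bump (?N * x + (- a * ?N - 1)) * bump ((- ?N) * x + (b * ?N - 1)))"
    unfolding bump_def by (intro smooth_real_mult smooth_real_affine smooth_real_exp_inv)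
  moreover have "(\<lambda>x. bump (?N * x + (- a * ?N - 1)) * bump ((- ?N) * x + (b * ?N - 1))) = cutoff a b n"
    unfolding cutoff_def by (intro ext arg_cong2[where f="(*)"] arg_cong[where f=bump]) (simp_all add: algebra_simps)
  ultimately show ?thesis by simp
qed

lemma cutoff_support:
  assumes "x \<notin> {a + 1 / real (Suc n) .. b - 1 / real (Suc n)}"
  shows "cutoff a b n x = 0"
proof -
  let ?N = "real (Suc n)"
  have "x < a + 1 / ?N \<or> x > b - 1 / ?N" using assms by auto
  then have "(x - a) * ?N - 1 \<le> 0 \<or> (b - x) * ?N - 1 \<le> 0"
    by (auto simp: field_simps)
  then show ?thesis by (auto simp: cutoff_def bump_eq)
qed

lemma filterlim_linear_Suc:
  assumes "(k::real) > 0"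
  shows "filterlim (\<lambda>n. k * real (Suc n) - 1) at_top sequentially"
proof -
  have "filterlim (\<lambda>n. -1 + k * real (Suc n)) at_top sequentially"
    using assms
    by (intro filterlim_tendsto_add_at_top[OF tendsto_const] filterlim_tendsto_pos_mult_at_top[OF tendsto_const]
        filterlim_compose[OF filterlim_real_sequentially] filterlim_Suc) auto
  then show ?thesis by (simp add: algebra_simps)
qed

lemma cutoff_tendsto:
  assumes "a < x" "x < b"
  shows "(\<lambda>n. cutoff a b n x) \<longlonglongrightarrow> 1"
proof -
  have "(\<lambda>n. cutoff a b n x) \<longlonglongrightarrow> 1 * 1"
    unfolding cutoff_def using assms
    by (intro tendsto_mult filterlim_compose[OF bump_tendsto_1] filterlim_linear_Suc) auto
  then show ?thesis by simp
qed

lemma cutoff_DERIV: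
  "(cutoff a b n has_real_derivative
     real (Suc n) * deriv bump ((x - a) * real (Suc n) - 1) * bump ((b - x) * real (Suc n) - 1)
     - bump ((x - a) * real (Suc n) - 1) * (real (Suc n) * deriv bump ((b - x) * real (Suc n) - 1))) (at x)"
proof -
  have b: "(bump has_real_derivative deriv bump t) (at t)" for t
    unfolding bump_def by (intro smooth_real_DERIV smooth_real_exp_inv)
  show ?thesis
    unfolding cutoff_def
    by (auto intro!: derivative_eq_intros DERIV_chain2[OF b] simp: algebra_simps)
qed

text \<open>The factor \<open>n + 1\<close> in the derivative is compensated by the weight, since
  \<open>(t + 1) * deriv bump t\<close> is bounded and \<open>t + 1 = (x - a) * (n + 1)\<close> in the argument of \<open>bump\<close>.\<close>

lemma deriv_cutoff_weighted:
  "\<bar>deriv (cutoff a b n) x\<bar> * ((x - a) * (b - x)) \<le> 2 * \<bar>x - a\<bar> + 2 * \<bar>b - x\<bar>" if "a \<le> x" "x \<le> b"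
proof -
  let ?N = "real (Suc n)"
  let ?T = "(x - a) * ?N - 1" and ?S = "(b - x) * ?N - 1"
  have nn: "0 \<le> deriv bump t" for t by (simp add: deriv_bump)
  have "\<bar>deriv (cutoff a b n) x\<bar> = \<bar>?N * deriv bump ?T * bump ?S - bump ?T * (?N * deriv bump ?S)\<bar>"
    by (simp only: DERIV_imp_deriv[OF cutoff_DERIV])
  also have "\<dots> \<le> \<bar>?N * deriv bump ?T * bump ?S\<bar> + \<bar>bump ?T * (?N * deriv bump ?S)\<bar>"
    by (rule abs_triangle_ineq4)
  also have "\<dots> \<le> ?N * deriv bump ?T * 1 + 1 * (?N * deriv bump ?S)"
    unfolding abs_mult using nn bump_bounds by (intro add_mono mult_mono) auto
  finally have "\<bar>deriv (cutoff a b n) x\<bar> * ((x - a) * (b - x))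
      \<le> (?N * deriv bump ?T + ?N * deriv bump ?S) * ((x - a) * (b - x))"
    using that by (intro mult_right_mono) auto
  also have "\<dots> = ((?T + 1) * deriv bump ?T) * (b - x) + ((?S + 1) * deriv bump ?S) * (x - a)"
    by (simp add: algebra_simps)
  also have "\<dots> \<le> 2 * (b - x) + 2 * (x - a)"
    using that by (intro add_mono mult_right_mono deriv_bump_bounds) auto
  finally show ?thesis using that by simp
qed

lemma deriv_cutoff_tendsto:
  assumes "a < x" "x < b"
  shows "(\<lambda>n. deriv (cutoff a b n) x) \<longlonglongrightarrow> 0"
proof -
  have *: "(\<lambda>n. real (Suc n) * deriv bump (k * real (Suc n) - 1)) \<longlonglongrightarrow> 0" if "k > 0" for k
  proof -
    have "(\<lambda>n. ((k * real (Suc n) - 1) + 1) * deriv bump (k * real (Suc n) - 1)) \<longlonglongrightarrow> 0"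
      by (rule filterlim_compose[OF deriv_bump_tendsto_0 filterlim_linear_Suc[OF that]])
    \<comment> \<open>Dividing the weighted limit by the fixed distance \<open>k\<close> removes the
      weight.\<close>
    then have "(\<lambda>n. (1 / k) * (((k * real (Suc n) - 1) + 1) * deriv bump (k * real (Suc n) - 1))) \<longlonglongrightarrow> (1 / k) * 0"
      by (intro tendsto_intros)
    then show ?thesis using that by simp
  qed
  have "(\<lambda>n. real (Suc n) * deriv bump ((x - a) * real (Suc n) - 1) * bump ((b - x) * real (Suc n) - 1)
     - bump ((x - a) * real (Suc n) - 1) * (real (Suc n) * deriv bump ((b - x) * real (Suc n) - 1))) \<longlonglongrightarrow> 0 * 1 - 1 * 0"
    using assms
    by (intro tendsto_diff tendsto_mult[OF *] tendsto_mult[OF _ *] filterlim_compose[OF bump_tendsto_1] filterlim_linear_Suc) auto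
  then show ?thesis
    by (simp only: DERIV_imp_deriv[OF cutoff_DERIV]) simp
qed

section \<open>Polynomials with zeros at both ends, multiplied by cutoffs\<close>

lemma poly_vanishing_ends_bound:
  fixes r :: "real poly"
  assumes "poly r a = 0" "poly r b = 0" "a < b"
  obtains M where "M \<ge> 0" "\<And>x. x \<in> {a..b} \<Longrightarrow> \<bar>poly r x\<bar> \<le> M * ((x - a) * (b - x))"
proof -
  obtain q where q: "r = [:-a, 1:] * q"
    using assms(1) by (auto simp: poly_eq_0_iff_dvd dvd_def)
  then have "poly q b = 0" using assms by simp
  then obtain s where s: "q = [:-b, 1:] * s"
    by (auto simp: poly_eq_0_iff_dvd dvd_def)
  have "compact (poly s ` {a..b})"
    by (intro compact_continuous_image continuous_intros) auto
  then obtain M where M: "\<And>x. x \<in> {a..b} \<Longrightarrow> \<bar>poly s x\<bar> \<le> M"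
    by (meson bounded_real compact_imp_bounded imageI)
  then have "M \<ge> 0" using assms(3) by (meson abs_ge_zero atLeastAtMost_iff less_imp_le order_refl order_trans)
  moreover have "\<bar>poly r x\<bar> \<le> M * ((x - a) * (b - x))" if "x \<in> {a..b}" for x
  proof -
    have "poly r x = - poly s x * ((x - a) * (b - x))"
      by (simp add: q s algebra_simps)
    then have "\<bar>poly r x\<bar> = \<bar>poly s x\<bar> * ((x - a) * (b - x))"
      using that by (simp add: abs_mult)
    also have "\<dots> \<le> M * ((x - a) * (b - x))"
      using M[OF that] that by (intro mult_right_mono) auto
    finally show ?thesis .
  qed
  ultimately show ?thesis using that by blast
qed

lemma deriv_poly_cutoff:
  "deriv (\<lambda>x. poly r x * cutoff a b n x) x
     = poly (pderiv r) x * cutoff a b n x + poly r x * deriv (cutoff a b n) x"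
proof (rule DERIV_imp_deriv)
  show "((\<lambda>x. poly r x * cutoff a b n x) has_real_derivative
    poly (pderiv r) x * cutoff a b n x + poly r x * deriv (cutoff a b n) x) (at x)"
    using DERIV_mult[OF poly_DERIV smooth_real_DERIV[OF smooth_real_cutoff]]
    by (simp add: mult.commute add.commute)
qed

lemma deriv_poly_cutoff_tendsto:
  assumes "a < x" "x < b"
  shows "(\<lambda>n. deriv (\<lambda>x. poly r x * cutoff a b n x) x) \<longlonglongrightarrow> poly (pderiv r) x"
proof -
  have "(\<lambda>n. poly (pderiv r) x * cutoff a b n x + poly r x * deriv (cutoff a b n) x)
      \<longlonglongrightarrow> poly (pderiv r) x * 1 + poly r x * 0"
    using assms by (intro tendsto_intros cutoff_tendsto deriv_cutoff_tendsto)
  then show ?thesis by (simp add: deriv_poly_cutoff)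
qed

lemma poly_bounded_interval:
  fixes r :: "real poly"
  obtains B where "\<And>x. x \<in> {a..b} \<Longrightarrow> \<bar>poly r x\<bar> \<le> B"
proof -
  have "compact (poly r ` {a..b})"
    by (intro compact_continuous_image continuous_intros) auto
  then show ?thesis
    by (meson bounded_real compact_imp_bounded imageI that)
qed

text \<open>Near the endpoints the derivative of the cutoff grows with \<open>n\<close>; the zeros
  of \<open>r\<close> there supply the factor \<open>(x - a) * (b - x)\<close> that
  \<open>deriv_cutoff_weighted\<close> turns into a bound uniform in \<open>n\<close>. This is the
  reason why weak derivatives are tested with polynomials that vanish on two opposite sides.\<close>

lemma deriv_poly_cutoff_bounded:
  assumes "poly r a = 0" "poly r b = 0" "a < b"
  obtains C where "\<And>n x. x \<in> {a..b} \<Longrightarrow> \<bar>deriv (\<lambda>x. poly r x * cutoff a b n x) x\<bar> \<le> C"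
proof -
  obtain M where M: "M \<ge> 0" "\<And>x. x \<in> {a..b} \<Longrightarrow> \<bar>poly r x\<bar> \<le> M * ((x - a) * (b - x))"
    using poly_vanishing_ends_bound[OF assms] by blast
  obtain B where B: "\<And>x. x \<in> {a..b} \<Longrightarrow> \<bar>poly (pderiv r) x\<bar> \<le> B"
    using poly_bounded_interval[of a b "pderiv r"] by blast
  have "\<bar>deriv (\<lambda>x. poly r x * cutoff a b n x) x\<bar> \<le> B + M * (2 * (b - a))" if x: "x \<in> {a..b}" for n x
  proof -
    have "\<bar>poly r x * deriv (cutoff a b n) x\<bar> \<le> (M * ((x - a) * (b - x))) * \<bar>deriv (cutoff a b n) x\<bar>"
      unfolding abs_mult using M(2)[OF x] by (intro mult_right_mono) auto
    also have "\<dots> = M * (\<bar>deriv (cutoff a b n) x\<bar> * ((x - a) * (b - x)))" by simp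
    also have "\<dots> \<le> M * (2 * \<bar>x - a\<bar> + 2 * \<bar>b - x\<bar>)"
      using M(1) x by (intro mult_left_mono deriv_cutoff_weighted) auto
    also have "2 * \<bar>x - a\<bar> + 2 * \<bar>b - x\<bar> = 2 * (b - a)" using x by simp
    finally have 1: "\<bar>poly r x * deriv (cutoff a b n) x\<bar> \<le> M * (2 * (b - a))" .
    have "\<bar>poly (pderiv r) x * cutoff a b n x\<bar> \<le> \<bar>poly (pderiv r) x\<bar> * 1"
      unfolding abs_mult using cutoff_bounds[of a b n x] by (intro mult_left_mono) auto
    then have 2: "\<bar>poly (pderiv r) x * cutoff a b n x\<bar> \<le> B" using B[OF x] by simp
    show ?thesis unfolding deriv_poly_cutoff using 1 2 by linarith
  qed
  then show ?thesis using that by blast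
qed

section \<open>Integration over rectangles\<close>

lemma integral_continuous_lebesgue_on:
  fixes f :: "'a::euclidean_space \<Rightarrow> real"
  assumes "continuous_on (cbox a b) f"
  shows "lint (cbox a b) f = integral (cbox a b) f"
  using assms by (intro lebesgue_integral_eq_integral continuous_imp_integrable) auto

lemma continuous_on_Pair_sections:
  assumes "continuous_on (cbox (a, c) (b, d)) (f :: plane \<Rightarrow> real)"
  shows "y \<in> {c..d} \<Longrightarrow> continuous_on {a..b} (\<lambda>x. f (x, y))"
    and "x \<in> {a..b} \<Longrightarrow> continuous_on {c..d} (\<lambda>y. f (x, y))"
  by (auto intro!: continuous_on_compose2[OF assms] continuous_intros)

lemma integral_rectangle_iterated_snd:
  assumes "continuous_on (cbox (a, c) (b, d)) (f :: plane \<Rightarrow> real)"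
  shows "lint (cbox (a, c) (b, d)) f = integral {a..b} (\<lambda>x. integral {c..d} (\<lambda>y. f (x, y)))"
  using integral_prod_continuous[OF assms] integral_continuous_lebesgue_on[OF assms] by simp

lemma integral_rectangle_iterated_fst:
  assumes "continuous_on (cbox (a, c) (b, d)) (f :: plane \<Rightarrow> real)"
  shows "lint (cbox (a, c) (b, d)) f = integral {c..d} (\<lambda>y. integral {a..b} (\<lambda>x. f (x, y)))"
  using integral_rectangle_iterated_snd[OF assms] integral_swap_continuous[of a c b d "\<lambda>x y. f (x, y)"] assms
  by simp

text \<open>The fundamental theorem on every horizontal line, followed by integration over the
  lines. With a product for \<open>F\<close> it becomes integration by parts with explicit boundary
  terms.\<close>

lemma integral_dx_rectangle:
  fixes F G :: "plane \<Rightarrow> real"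
  assumes "a \<le> b" "continuous_on (cbox (a, c) (b, d)) F" "continuous_on (cbox (a, c) (b, d)) G"
    and "\<And>x y. x \<in> {a..b} \<Longrightarrow> y \<in> {c..d} \<Longrightarrow> ((\<lambda>x. F (x, y)) has_real_derivative G (x, y)) (at x)"
  shows "lint (cbox (a, c) (b, d)) G
    = lint {c..d} (\<lambda>y. F (b, y) - F (a, y))"
proof -
  have "integral {a..b} (\<lambda>x. G (x, y)) = F (b, y) - F (a, y)" if "y \<in> {c..d}" for y
    using assms that
    by (intro integral_unique fundamental_theorem_of_calculus)
      (auto simp: has_real_derivative_iff_has_vector_derivative intro: has_vector_derivative_at_within)
  then have "lint (cbox (a, c) (b, d)) G = integral {c..d} (\<lambda>y. F (b, y) - F (a, y))"
    unfolding integral_rectangle_iterated_fst[OF assms(3)] by (intro integral_cong) auto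
  moreover have "continuous_on (cbox c d) (\<lambda>y. F (b, y) - F (a, y))"
    using continuous_on_Pair_sections(2)[OF assms(2)] assms(1) by (auto intro!: continuous_intros)
  ultimately show ?thesis using integral_continuous_lebesgue_on[of c d "\<lambda>y. F (b, y) - F (a, y)"] by simp
qed

lemma integral_dy_rectangle:
  fixes F G :: "plane \<Rightarrow> real"
  assumes "c \<le> d" "continuous_on (cbox (a, c) (b, d)) F" "continuous_on (cbox (a, c) (b, d)) G"
    and "\<And>x y. x \<in> {a..b} \<Longrightarrow> y \<in> {c..d} \<Longrightarrow> ((\<lambda>y. F (x, y)) has_real_derivative G (x, y)) (at y)"
  shows "lint (cbox (a, c) (b, d)) G
    = lint {a..b} (\<lambda>x. F (x, d) - F (x, c))"
proof -
  have "integral {c..d} (\<lambda>y. G (x, y)) = F (x, d) - F (x, c)" if "x \<in> {a..b}" for x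
    using assms that
    by (intro integral_unique fundamental_theorem_of_calculus)
      (auto simp: has_real_derivative_iff_has_vector_derivative intro: has_vector_derivative_at_within)
  then have "lint (cbox (a, c) (b, d)) G = integral {a..b} (\<lambda>x. F (x, d) - F (x, c))"
    unfolding integral_rectangle_iterated_snd[OF assms(3)] by (intro integral_cong) auto
  moreover have "continuous_on (cbox a b) (\<lambda>x. F (x, d) - F (x, c))"
    using continuous_on_Pair_sections(1)[OF assms(2)] assms(1) by (auto intro!: continuous_intros)
  ultimately show ?thesis using integral_continuous_lebesgue_on[of a b "\<lambda>x. F (x, d) - F (x, c)"] by simp
qed

section \<open>Weak derivatives tested with polynomials on a rectangle\<close>

lemma smooth_real_continuous: "smooth_real f \<Longrightarrow> continuous_on S f"
  using smooth_real_DERIV by (blast intro: DERIV_isCont continuous_at_imp_continuous_on)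

text \<open>For a product of two one-variable functions every iterated partial derivative is again
  such a product, so smoothness in the plane reduces to smoothness in one variable.\<close>

lemma pd_tensor:
  assumes "smooth_real f" "smooth_real g"
  shows "pd k l (\<lambda>z. f (fst z) * g (snd z)) = (\<lambda>z. (deriv ^^ k) f (fst z) * (deriv ^^ l) g (snd z))"
proof -
  have y: "(pdy ^^ l) (\<lambda>z. f (fst z) * g (snd z)) = (\<lambda>z. f (fst z) * (deriv ^^ l) g (snd z))"
  proof (induction l)
    case (Suc l)
    have "pdy (\<lambda>z. f (fst z) * (deriv ^^ l) g (snd z)) = (\<lambda>z. f (fst z) * deriv ((deriv ^^ l) g) (snd z))"
      unfolding pdy_def
      by (rule ext, rule DERIV_imp_deriv)
        (auto intro!: DERIV_cmult smooth_real_DERIV smooth_real_deriv_iterate assms(2))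
    then show ?case using Suc by simp
  qed simp
  have "(pdx ^^ k) (\<lambda>z. f (fst z) * h (snd z)) = (\<lambda>z. (deriv ^^ k) f (fst z) * h (snd z))" for h
  proof (induction k)
    case (Suc k)
    have "pdx (\<lambda>z. (deriv ^^ k) f (fst z) * h (snd z)) = (\<lambda>z. deriv ((deriv ^^ k) f) (fst z) * h (snd z))"
      unfolding pdx_def
      by (rule ext, rule DERIV_imp_deriv)
        (auto intro!: DERIV_cmult_right smooth_real_DERIV smooth_real_deriv_iterate assms(1))
    then show ?case using Suc by simp
  qed simp
  then show ?thesis by (simp add: pd_def y)
qed

lemma smooth_real_differentiable_compose:
  assumes "smooth_real f" "bounded_linear L"
  shows "(\<lambda>z. f (L z)) differentiable (at z)"
proof -
  have "f differentiable (at (L z))"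
    using smooth_real_DERIV[OF assms(1)] by (auto simp: real_differentiable_def)
  then show ?thesis
    using differentiable_chain_at[of L z f] bounded_linear_imp_differentiable[OF assms(2)]
    by (simp add: o_def)
qed

lemma smooth_tensor:
  assumes "smooth_real f" "smooth_real g"
  shows "smooth (\<lambda>z. f (fst z) * g (snd z))"
  unfolding smooth_def pd_tensor[OF assms]
  by (intro allI differentiable_mult smooth_real_differentiable_compose smooth_real_deriv_iterate assms
      bounded_linear_fst bounded_linear_snd)

lemma deriv_zero_off_interval:
  assumes "\<And>x. x \<notin> {\<alpha>..\<beta>} \<Longrightarrow> f x = 0" "x \<notin> {\<alpha>..\<beta>}"
  shows "deriv f x = (0::real)"
proof (rule DERIV_imp_deriv)
  have "((\<lambda>x. 0) has_real_derivative 0) (at x)" by simp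
  then show "(f has_real_derivative 0) (at x)"
  proof (rule has_field_derivative_transform_within_open[where S="- {\<alpha>..\<beta>}"])
    show "open (- {\<alpha>..\<beta>})" by (simp add: open_Compl)
  qed (use assms in auto)
qed

text \<open>The support keeps a positive distance from both endpoints, so that a product of such
  functions has compact support in an open box. The interval may be empty, which covers cutoffs with
  small \<open>n\<close> that vanish identically.\<close>

definition supported_in :: "real \<Rightarrow> real \<Rightarrow> (real \<Rightarrow> real) \<Rightarrow> bool" where
  "supported_in a b f \<longleftrightarrow> (\<exists>\<alpha> \<beta>. a < \<alpha> \<and> \<beta> < b \<and> (\<forall>x. x \<notin> {\<alpha>..\<beta>} \<longrightarrow> f x = 0))"

lemma supported_in_deriv: "supported_in a b f \<Longrightarrow> supported_in a b (deriv f)"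
  unfolding supported_in_def using deriv_zero_off_interval by blast

lemma box_Pair_real: "box (a, c) (b, d :: real) = {a<..<b :: real} \<times> {c<..<d}"
  by (auto simp: mem_box Basis_prod_def)

lemma tensor_test_function:
  assumes "smooth_real f" "smooth_real g" "supported_in a b f" "supported_in c d g"
    and "box (a, c) (b, d) \<subseteq> \<Omega>"
  shows "(\<lambda>z. f (fst z) * g (snd z)) \<in> test_functions \<Omega>"
proof -
  obtain \<alpha> \<beta> where f: "a < \<alpha>" "\<beta> < b" "\<And>x. x \<notin> {\<alpha>..\<beta>} \<Longrightarrow> f x = 0"
    using assms(3) unfolding supported_in_def by blast
  obtain \<gamma> \<delta> where g: "c < \<gamma>" "\<delta> < d" "\<And>x. x \<notin> {\<gamma>..\<delta>} \<Longrightarrow> g x = 0"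
    using assms(4) unfolding supported_in_def by blast
  let ?S = "{z. f (fst z) * g (snd z) \<noteq> 0}"
  have "?S \<subseteq> cbox (\<alpha>, \<gamma>) (\<beta>, \<delta>)"
    using f(3) g(3) by (fastforce simp: cbox_Pair_eq)
  then have sub: "closure ?S \<subseteq> cbox (\<alpha>, \<gamma>) (\<beta>, \<delta>)"
    by (intro closure_minimal) auto
  have "compact (closure ?S)"
    using bounded_subset[OF bounded_cbox sub] by (simp add: compact_eq_bounded_closed)
  moreover have "cbox (\<alpha>, \<gamma>) (\<beta>, \<delta>) \<subseteq> box (a, c) (b, d)"
    using f g by (auto simp: cbox_Pair_eq box_Pair_real mem_box)
  ultimately show ?thesis
    using sub assms(5) smooth_tensor[OF assms(1,2)] unfolding test_functions_def by blast
qed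

lemma interior_cbox_Pair_null:
  "box (a, c) (b, d :: real) \<in> sets lebesgue"
  "negligible (cbox (a, c) (b, d :: real) - box (a, c) (b, d))"
  "negligible (box (a, c) (b, d :: real) - cbox (a, c) (b, d))"
proof -
  show "negligible (box (a, c) (b, d :: real) - cbox (a, c) (b, d))"
    using box_subset_cbox[of "(a, c)" "(b, d)"] by (metis Diff_eq_empty_iff negligible_empty)
qed (auto simp: negligible_frontier_interval)

lemma integral_supported_rectangle:
  fixes F :: "plane \<Rightarrow> real"
  assumes "box (a, c) (b, d) \<subseteq> \<Omega>" "\<Omega> \<in> sets lebesgue" "\<And>z. z \<notin> box (a, c) (b, d) \<Longrightarrow> F z = 0"
  shows "lint \<Omega> F = lint (cbox (a, c) (b, d)) F"
proof -
  have "lint \<Omega> F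
      = lint \<Omega> (\<lambda>z. if z \<in> box (a, c) (b, d) then F z else 0)"
    by (rule arg_cong[where f="integral\<^sup>L _"]) (use assms(3) in auto)
  also have "\<dots> = lint (box (a, c) (b, d)) F"
    using assms by (intro Lebesgue_Measure.integral_restrict) auto
  also have "\<dots> = lint (cbox (a, c) (b, d)) F"
    by (intro lebesgue_on_null_eq) (use interior_cbox_Pair_null in auto)
  finally show ?thesis .
qed

text \<open>Dominated convergence with majorant \<open>C * \<bar>v z\<bar>\<close>, which is
  integrable because the rectangle has finite measure. Pointwise convergence is asked only on the
  open box, since cutoffs vanish on the boundary for every \<open>n\<close>.\<close>

lemma tendsto_integral_L2_bounded:
  fixes v :: "plane \<Rightarrow> real"
  assumes v: "v \<in> L2_space (cbox (a, c) (b, d))"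
    and cont: "\<And>n. continuous_on (cbox (a, c) (b, d)) (\<psi> n)" "continuous_on (cbox (a, c) (b, d)) \<psi>'"
    and bd: "\<And>n z. z \<in> cbox (a, c) (b, d) \<Longrightarrow> \<bar>\<psi> n z\<bar> \<le> C"
    and lim: "\<And>z. z \<in> box (a, c) (b, d) \<Longrightarrow> (\<lambda>n. \<psi> n z) \<longlonglongrightarrow> \<psi>' z"
  shows "(\<lambda>n. lint (cbox (a, c) (b, d)) (\<lambda>z. v z * \<psi> n z))
    \<longlonglongrightarrow> lint (cbox (a, c) (b, d)) (\<lambda>z. v z * \<psi>' z)"
proof (rule integral_dominated_convergence)
  let ?K = "cbox (a, c) (b, d)"
  have vm: "v \<in> borel_measurable (lebesgue_on ?K)" using v by (auto simp: L2_space_real)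
  show "(\<lambda>z. v z * \<psi>' z) \<in> borel_measurable (lebesgue_on ?K)"
    "\<And>n. (\<lambda>z. v z * \<psi> n z) \<in> borel_measurable (lebesgue_on ?K)"
    using cont by (auto intro!: borel_measurable_times[OF vm] continuous_imp_measurable_on_sets_lebesgue)
  have "integrable (lebesgue_on ?K) (\<lambda>z. v z * 1)"
    by (intro integrable_mult_L2 v L2_space_continuous continuous_intros)
  then show "integrable (lebesgue_on ?K) (\<lambda>z. C * \<bar>v z\<bar>)" by auto
  show "AE z in lebesgue_on ?K. norm (v z * \<psi> n z) \<le> C * \<bar>v z\<bar>" for n
  proof (rule AE_I2)
    fix z assume "z \<in> space (lebesgue_on ?K)"
    then have "\<bar>\<psi> n z\<bar> * \<bar>v z\<bar> \<le> C * \<bar>v z\<bar>"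
      by (intro mult_right_mono bd) auto
    then show "norm (v z * \<psi> n z) \<le> C * \<bar>v z\<bar>" by (simp add: abs_mult mult.commute)
  qed
  have "?K - box (a, c) (b, d) \<in> null_sets lebesgue"
    using interior_cbox_Pair_null(2) negligible_iff_null_sets by blast
  then have "?K - box (a, c) (b, d) \<in> null_sets (lebesgue_on ?K)"
    by (simp add: null_sets_restrict_space)
  then show "AE z in lebesgue_on ?K. (\<lambda>n. v z * \<psi> n z) \<longlonglongrightarrow> v z * \<psi>' z"
    by (rule AE_I') (use lim in \<open>auto intro!: tendsto_intros\<close>)
qed

section \<open>Product test functions and the removal of the cutoff\<close>

definition tensor :: "(real \<Rightarrow> real) \<Rightarrow> (real \<Rightarrow> real) \<Rightarrow> plane \<Rightarrow> real" where
  "tensor f g z = f (fst z) * g (snd z)"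

lemma continuous_on_tensor:
  "continuous_on UNIV f \<Longrightarrow> continuous_on UNIV g \<Longrightarrow> continuous_on S (tensor f g)"
  unfolding tensor_def
  by (intro continuous_intros; rule continuous_on_compose2[where t=UNIV]) (auto intro!: continuous_intros)

lemma supported_in_poly_cutoff: "supported_in a b (\<lambda>x. poly r x * cutoff a b n x)"
  unfolding supported_in_def
  by (rule exI[of _ "a + 1 / real (Suc n)"], rule exI[of _ "b - 1 / real (Suc n)"])
    (use cutoff_support in \<open>auto simp del: of_nat_Suc\<close>)

lemma smooth_real_poly_cutoff: "smooth_real (\<lambda>x. poly r x * cutoff a b n x)"
  by (intro smooth_real_mult smooth_real_poly smooth_real_cutoff)

lemma poly_cutoff_tendsto:
  "a < x \<Longrightarrow> x < b \<Longrightarrow> (\<lambda>n. poly r x * cutoff a b n x) \<longlonglongrightarrow> poly r x"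
  using tendsto_mult[OF tendsto_const cutoff_tendsto, of a x b "poly r x"] by simp

lemma poly_cutoff_bound: "\<bar>poly r x * cutoff a b n x\<bar> \<le> \<bar>poly r x\<bar>"
  using mult_left_mono[of "\<bar>cutoff a b n x\<bar>" 1 "\<bar>poly r x\<bar>"] cutoff_bounds[of a b n x]
  by (simp add: abs_mult)

lemma supported_in_off: "supported_in a b f \<Longrightarrow> x \<notin> {a<..<b} \<Longrightarrow> f x = 0"
  unfolding supported_in_def by (metis atLeastAtMost_iff greaterThanLessThan_iff less_le_trans le_less_trans)

lemma sign_power_cancel: "(- 1) ^ n * A = (- 1) ^ Suc n * B \<Longrightarrow> A = - (B :: real)"
  by (cases "even n") auto

text \<open>Only the open box lies in \<Omega>; the closed rectangle \<open>K\<close> may touch the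
  boundary of \<Omega>. Closedness makes uniform approximation by polynomials available on
  \<open>K\<close>, and its boundary is a null set, so functions in L2 of \<Omega> can be used on
  it.\<close>

locale subrectangle =
  fixes \<Omega> :: "plane set" and a b c d :: real
  assumes box_subset: "box (a, c) (b, d) \<subseteq> \<Omega>" and domain_measurable: "\<Omega> \<in> sets lebesgue"
    and ab: "a < b" and cd: "c < d"
begin

abbreviation K where "K \<equiv> cbox (a, c) (b, d)"

lemma L2_space_K: "f \<in> L2_space \<Omega> \<Longrightarrow> f \<in> L2_space K" for f :: "plane \<Rightarrow> real"
proof (rule L2_space_subset)
  show "negligible (K - \<Omega>)"
    using interior_cbox_Pair_null(2) by (rule negligible_subset) (use box_subset in auto)
qed (use domain_measurable in auto)

lemma integral_tensor_supported:
  assumes "supported_in a b f" "supported_in c d g"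
  shows "lint \<Omega> (\<lambda>z. v z * tensor f g z) = lint K (\<lambda>z. v z * tensor f g z)"
  using box_subset domain_measurable
proof (rule integral_supported_rectangle)
  fix z assume "z \<notin> box (a, c) (b, d)"
  then have "fst z \<notin> {a<..<b} \<or> snd z \<notin> {c<..<d}"
    by (cases z) (auto simp: box_Pair_real)
  then show "v z * tensor f g z = 0"
    using supported_in_off[OF assms(1)] supported_in_off[OF assms(2)] by (auto simp: tensor_def)
qed

lemma tendsto_integral_tensor:
  assumes v: "v \<in> L2_space K"
    and cont: "\<And>n. continuous_on UNIV (f n)" "\<And>n. continuous_on UNIV (g n)"
      "continuous_on UNIV f'" "continuous_on UNIV g'"
    and bd: "\<And>n x. x \<in> {a..b} \<Longrightarrow> \<bar>f n x\<bar> \<le> Bf" "\<And>n x. x \<in> {c..d} \<Longrightarrow> \<bar>g n x\<bar> \<le> Bg"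
    and lim: "\<And>x. a < x \<Longrightarrow> x < b \<Longrightarrow> (\<lambda>n. f n x) \<longlonglongrightarrow> f' x"
      "\<And>x. c < x \<Longrightarrow> x < d \<Longrightarrow> (\<lambda>n. g n x) \<longlonglongrightarrow> g' x"
  shows "(\<lambda>n. lint K (\<lambda>z. v z * tensor (f n) (g n) z))
    \<longlonglongrightarrow> lint K (\<lambda>z. v z * tensor f' g' z)"
  using v
proof (rule tendsto_integral_L2_bounded)
  show "\<bar>tensor (f n) (g n) z\<bar> \<le> Bf * Bg" if "z \<in> K" for n z
  proof -
    have "\<bar>f n (fst z)\<bar> \<le> Bf" "\<bar>g n (snd z)\<bar> \<le> Bg"
      using that by (cases z, auto simp: cbox_Pair_eq intro!: bd)+
    then show ?thesis unfolding tensor_def abs_mult by (intro mult_mono) auto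
  qed
  show "(\<lambda>n. tensor (f n) (g n) z) \<longlonglongrightarrow> tensor f' g' z" if "z \<in> box (a, c) (b, d)" for z
    unfolding tensor_def using that by (cases z) (auto simp: box_Pair_real intro!: tendsto_mult lim)
qed (intro continuous_on_tensor cont)+

lemma tendsto_integral_poly_cutoff:
  assumes "v \<in> L2_space K"
  shows "(\<lambda>n. lint K (\<lambda>z. v z * tensor (\<lambda>x. poly r x * cutoff a b n x) (\<lambda>y. poly s y * cutoff c d n y) z))
    \<longlonglongrightarrow> lint K (\<lambda>z. v z * tensor (poly r) (poly s) z)"
proof -
  obtain B1 where B1: "\<And>x. x \<in> {a..b} \<Longrightarrow> \<bar>poly r x\<bar> \<le> B1" using poly_bounded_interval by blast
  obtain B2 where B2: "\<And>x. x \<in> {c..d} \<Longrightarrow> \<bar>poly s x\<bar> \<le> B2" using poly_bounded_interval by blast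
  show ?thesis
    using assms
    by (rule tendsto_integral_tensor[where Bf=B1 and Bg=B2])
      (auto intro!: order_trans[OF poly_cutoff_bound] B1 B2 poly_cutoff_tendsto
        smooth_real_continuous smooth_real_poly_cutoff smooth_real_poly)
qed

text \<open>Both candidates are paired with the test function itself, so no derivative falls on the
  cutoff and the limit can be taken for arbitrary polynomials. This takes the place of
  almost-everywhere uniqueness of weak derivatives.\<close>

lemma weak_pd_unique_poly:
  assumes v: "v1 \<in> L2_space \<Omega>" "v2 \<in> L2_space \<Omega>"
    and w: "is_weak_pd \<Omega> k l w v1" "is_weak_pd \<Omega> k l w v2"
  shows "lint K (\<lambda>z. v1 z * tensor (poly r) (poly s) z)
    = lint K (\<lambda>z. v2 z * tensor (poly r) (poly s) z)"
proof -
  define f where "f n x = poly r x * cutoff a b n x" for n x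
  define g where "g n x = poly s x * cutoff c d n x" for n x
  have sup: "supported_in a b (f n)" "supported_in c d (g n)" for n
    unfolding f_def g_def by (rule supported_in_poly_cutoff)+
  have "(\<lambda>z. f n (fst z) * g n (snd z)) \<in> test_functions \<Omega>" for n
    using sup[of n] by (intro tensor_test_function[OF _ _ _ _ box_subset])
      (simp_all add: f_def[abs_def] g_def[abs_def] smooth_real_poly_cutoff)
  then have "tensor (f n) (g n) \<in> test_functions \<Omega>" for n
    by (simp add: tensor_def[abs_def])
  then have "lint \<Omega> (\<lambda>z. v1 z * tensor (f n) (g n) z)
      = lint \<Omega> (\<lambda>z. v2 z * tensor (f n) (g n) z)" for n
    using w unfolding is_weak_pd_def by simp
  then have eq: "lint K (\<lambda>z. v1 z * tensor (f n) (g n) z)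
      = lint K (\<lambda>z. v2 z * tensor (f n) (g n) z)" for n
    using sup by (simp add: integral_tensor_supported)
  have lim: "(\<lambda>n. lint K (\<lambda>z. v z * tensor (f n) (g n) z)) \<longlonglongrightarrow> lint K (\<lambda>z. v z * tensor (poly r) (poly s) z)"
    if "v \<in> L2_space K" for v
    using tendsto_integral_poly_cutoff[OF that] by (simp add: f_def[abs_def] g_def[abs_def])
  show ?thesis
    using lim[OF L2_space_K[OF v(1)]] lim[OF L2_space_K[OF v(2)]] unfolding eq by (rule LIMSEQ_unique)
qed

text \<open>Integration by parts in x produces boundary terms only on the two vertical sides, so
  \<open>r\<close> has to vanish at its endpoints while \<open>s\<close> is free. This freedom is
  used in \<open>poincare_test\<close>, where \<open>s\<close> is an arbitrary factor of the
  polynomial.\<close>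

definition weak_dx :: "(plane \<Rightarrow> real) \<Rightarrow> (plane \<Rightarrow> real) \<Rightarrow> bool" where
  "weak_dx u v \<longleftrightarrow> (\<forall>r s. poly r a = 0 \<longrightarrow> poly r b = 0 \<longrightarrow>
     lint K (\<lambda>z. u z * tensor (poly (pderiv r)) (poly s) z)
     = - lint K (\<lambda>z. v z * tensor (poly r) (poly s) z))"

definition weak_dy :: "(plane \<Rightarrow> real) \<Rightarrow> (plane \<Rightarrow> real) \<Rightarrow> bool" where
  "weak_dy u v \<longleftrightarrow> (\<forall>r s. poly s c = 0 \<longrightarrow> poly s d = 0 \<longrightarrow>
     lint K (\<lambda>z. u z * tensor (poly r) (poly (pderiv s)) z)
     = - lint K (\<lambda>z. v z * tensor (poly r) (poly s) z))"

text \<open>The derivative of order \<open>(k, l)\<close> of the product of f' and g is the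
  derivative of order \<open>(Suc k, l)\<close> of the product of f and g. The defining identity of
  \<open>v1\<close> tested with the former and that of \<open>v2\<close> tested with the latter
  therefore share their pairing with \<open>w\<close>; the cutoff is removed afterwards.\<close>

lemma weak_dx_weak_pd:
  assumes v: "v1 \<in> L2_space \<Omega>" "v2 \<in> L2_space \<Omega>"
    and w: "is_weak_pd \<Omega> k l w v1" "is_weak_pd \<Omega> (Suc k) l w v2"
  shows "weak_dx v1 v2"
  unfolding weak_dx_def
proof (intro allI impI)
  fix r s :: "real poly" assume r: "poly r a = 0" "poly r b = 0"
  define f where "f n x = poly r x * cutoff a b n x" for n x
  define g where "g n x = poly s x * cutoff c d n x" for n x
  have f_abs: "f n = (\<lambda>x. poly r x * cutoff a b n x)" for n by (simp add: f_def[abs_def])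
  have sm: "smooth_real (f n)" "smooth_real (g n)" for n
    by (simp_all add: f_def[abs_def] g_def[abs_def] smooth_real_poly_cutoff)
  have sup: "supported_in a b (f n)" "supported_in c d (g n)" for n
    unfolding f_def g_def by (rule supported_in_poly_cutoff)+
  have test: "tensor (f n) (g n) \<in> test_functions \<Omega>" "tensor (deriv (f n)) (g n) \<in> test_functions \<Omega>" for n
    using tensor_test_function[OF sm sup box_subset]
      tensor_test_function[OF smooth_real_deriv[OF sm(1)] sm(2) supported_in_deriv[OF sup(1)] sup(2) box_subset]
    by (simp_all add: tensor_def[abs_def])
  have "pd k l (tensor (deriv (f n)) (g n)) = pd (Suc k) l (tensor (f n) (g n))" for n
    unfolding tensor_def[abs_def] pd_tensor[OF sm] pd_tensor[OF smooth_real_deriv[OF sm(1)] sm(2)]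
    by (simp add: funpow_swap1)
  then have "(- 1) ^ (k + l) * lint \<Omega> (\<lambda>z. v1 z * tensor (deriv (f n)) (g n) z)
    = (- 1) ^ (Suc k + l) * lint \<Omega> (\<lambda>z. v2 z * tensor (f n) (g n) z)" for n
    using w(1)[unfolded is_weak_pd_def, THEN bspec, OF test(2)[of n]]
      w(2)[unfolded is_weak_pd_def, THEN bspec, OF test(1)[of n]] by (simp only:)
  then have "lint \<Omega> (\<lambda>z. v1 z * tensor (deriv (f n)) (g n) z)
    = - lint \<Omega> (\<lambda>z. v2 z * tensor (f n) (g n) z)" for n
    by (intro sign_power_cancel[of "k + l"]) (simp only: add_Suc add_Suc_right)
  then have eq: "lint K (\<lambda>z. v1 z * tensor (deriv (f n)) (g n) z)
    = - lint K (\<lambda>z. v2 z * tensor (f n) (g n) z)" for n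
    using sup supported_in_deriv[OF sup(1)] by (simp add: integral_tensor_supported)
  obtain B2 where B2: "\<And>x. x \<in> {c..d} \<Longrightarrow> \<bar>poly s x\<bar> \<le> B2" using poly_bounded_interval by blast
  \<comment> \<open>Here the zeros of \<open>r\<close> enter: they keep the differentiated product
    bounded uniformly in \<open>n\<close>.\<close>
  obtain B3 where B3: "\<And>n x. x \<in> {a..b} \<Longrightarrow> \<bar>deriv (f n) x\<bar> \<le> B3"
    using deriv_poly_cutoff_bounded[OF r ab] unfolding f_abs by blast
  have lim2: "(\<lambda>n. lint K (\<lambda>z. v2 z * tensor (f n) (g n) z)) \<longlonglongrightarrow> lint K (\<lambda>z. v2 z * tensor (poly r) (poly s) z)"
    using tendsto_integral_poly_cutoff[OF L2_space_K[OF v(2)]] by (simp add: f_def[abs_def] g_def[abs_def])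
  have lim1: "(\<lambda>n. lint K (\<lambda>z. v1 z * tensor (deriv (f n)) (g n) z))
    \<longlonglongrightarrow> lint K (\<lambda>z. v1 z * tensor (poly (pderiv r)) (poly s) z)"
    using L2_space_K[OF v(1)]
  proof (rule tendsto_integral_tensor[where Bf=B3 and Bg=B2])
    show "(\<lambda>n. deriv (f n) x) \<longlonglongrightarrow> poly (pderiv r) x" if "a < x" "x < b" for x
      unfolding f_abs using that by (rule deriv_poly_cutoff_tendsto)
  qed (auto simp: g_def intro!: order_trans[OF poly_cutoff_bound] B3 B2 poly_cutoff_tendsto
        smooth_real_continuous smooth_real_poly_cutoff smooth_real_poly smooth_real_deriv sm)
  show "lint K (\<lambda>z. v1 z * tensor (poly (pderiv r)) (poly s) z)
     = - lint K (\<lambda>z. v2 z * tensor (poly r) (poly s) z)"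
    using lim1 tendsto_minus[OF lim2] unfolding eq by (rule LIMSEQ_unique)
qed

lemma weak_dy_weak_pd:
  assumes v: "v1 \<in> L2_space \<Omega>" "v2 \<in> L2_space \<Omega>"
    and w: "is_weak_pd \<Omega> k l w v1" "is_weak_pd \<Omega> k (Suc l) w v2"
  shows "weak_dy v1 v2"
  unfolding weak_dy_def
proof (intro allI impI)
  fix r s :: "real poly" assume s: "poly s c = 0" "poly s d = 0"
  define f where "f n x = poly r x * cutoff a b n x" for n x
  define g where "g n x = poly s x * cutoff c d n x" for n x
  have g_abs: "g n = (\<lambda>x. poly s x * cutoff c d n x)" for n by (simp add: g_def[abs_def])
  have sm: "smooth_real (f n)" "smooth_real (g n)" for n
    by (simp_all add: f_def[abs_def] g_def[abs_def] smooth_real_poly_cutoff)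
  have sup: "supported_in a b (f n)" "supported_in c d (g n)" for n
    unfolding f_def g_def by (rule supported_in_poly_cutoff)+
  have test: "tensor (f n) (g n) \<in> test_functions \<Omega>" "tensor (f n) (deriv (g n)) \<in> test_functions \<Omega>" for n
    using tensor_test_function[OF sm sup box_subset]
      tensor_test_function[OF sm(1) smooth_real_deriv[OF sm(2)] sup(1) supported_in_deriv[OF sup(2)] box_subset]
    by (simp_all add: tensor_def[abs_def])
  have "pd k l (tensor (f n) (deriv (g n))) = pd k (Suc l) (tensor (f n) (g n))" for n
    unfolding tensor_def[abs_def] pd_tensor[OF sm] pd_tensor[OF sm(1) smooth_real_deriv[OF sm(2)]]
    by (simp add: funpow_swap1)
  then have "(- 1) ^ (k + l) * lint \<Omega> (\<lambda>z. v1 z * tensor (f n) (deriv (g n)) z)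
    = (- 1) ^ (k + Suc l) * lint \<Omega> (\<lambda>z. v2 z * tensor (f n) (g n) z)" for n
    using w(1)[unfolded is_weak_pd_def, THEN bspec, OF test(2)[of n]]
      w(2)[unfolded is_weak_pd_def, THEN bspec, OF test(1)[of n]] by (simp only:)
  then have "lint \<Omega> (\<lambda>z. v1 z * tensor (f n) (deriv (g n)) z)
    = - lint \<Omega> (\<lambda>z. v2 z * tensor (f n) (g n) z)" for n
    by (intro sign_power_cancel[of "k + l"]) (simp only: add_Suc add_Suc_right)
  then have eq: "lint K (\<lambda>z. v1 z * tensor (f n) (deriv (g n)) z)
    = - lint K (\<lambda>z. v2 z * tensor (f n) (g n) z)" for n
    using sup supported_in_deriv[OF sup(2)] by (simp add: integral_tensor_supported)
  obtain B1 where B1: "\<And>x. x \<in> {a..b} \<Longrightarrow> \<bar>poly r x\<bar> \<le> B1" using poly_bounded_interval by blast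
  obtain B3 where B3: "\<And>n x. x \<in> {c..d} \<Longrightarrow> \<bar>deriv (g n) x\<bar> \<le> B3"
    using deriv_poly_cutoff_bounded[OF s cd] unfolding g_abs by blast
  have lim2: "(\<lambda>n. lint K (\<lambda>z. v2 z * tensor (f n) (g n) z)) \<longlonglongrightarrow> lint K (\<lambda>z. v2 z * tensor (poly r) (poly s) z)"
    using tendsto_integral_poly_cutoff[OF L2_space_K[OF v(2)]] by (simp add: f_def[abs_def] g_def[abs_def])
  have lim1: "(\<lambda>n. lint K (\<lambda>z. v1 z * tensor (f n) (deriv (g n)) z))
    \<longlonglongrightarrow> lint K (\<lambda>z. v1 z * tensor (poly r) (poly (pderiv s)) z)"
    using L2_space_K[OF v(1)]
  proof (rule tendsto_integral_tensor[where Bf=B1 and Bg=B3])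
    show "(\<lambda>n. deriv (g n) x) \<longlonglongrightarrow> poly (pderiv s) x" if "c < x" "x < d" for x
      unfolding g_abs using that by (rule deriv_poly_cutoff_tendsto)
  qed (auto simp: f_def intro!: order_trans[OF poly_cutoff_bound] B3 B1 poly_cutoff_tendsto
        smooth_real_continuous smooth_real_poly_cutoff smooth_real_poly smooth_real_deriv sm)
  show "lint K (\<lambda>z. v1 z * tensor (poly r) (poly (pderiv s)) z)
     = - lint K (\<lambda>z. v2 z * tensor (poly r) (poly s) z)"
    using lim1 tendsto_minus[OF lim2] unfolding eq by (rule LIMSEQ_unique)
qed

end

section \<open>Density of polynomials\<close>

lemma L2_norm_le_bound:
  fixes f :: "'a::euclidean_space \<Rightarrow> real"
  assumes "f \<in> L2_space (cbox a b)" "\<And>x. x \<in> cbox a b \<Longrightarrow> \<bar>f x\<bar> \<le> B" "B \<ge> 0"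
  shows "L2_norm (cbox a b) f \<le> B * sqrt (measure lebesgue (cbox a b))"
proof -
  have "lint (cbox a b) (\<lambda>x. (f x)\<^sup>2) \<le> lint (cbox a b) (\<lambda>x. B\<^sup>2)"
  proof (rule integral_mono)
    show "integrable (lebesgue_on (cbox a b)) (\<lambda>x. (f x)\<^sup>2)" using assms(1) by (simp add: L2_space_real)
    show "integrable (lebesgue_on (cbox a b)) (\<lambda>x. B\<^sup>2)"
      by (intro continuous_imp_integrable continuous_intros)
    show "(f x)\<^sup>2 \<le> B\<^sup>2" if "x \<in> space (lebesgue_on (cbox a b))" for x
      using assms(2)[of x] that by (simp add: abs_le_square_iff[symmetric] assms(3))
  qed
  also have "\<dots> = B\<^sup>2 * measure lebesgue (cbox a b)"
    by (simp add: measure_restrict_space)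
  finally have "L2_norm (cbox a b) f \<le> sqrt (B\<^sup>2 * measure lebesgue (cbox a b))"
    by (simp add: L2_norm_def)
  then show ?thesis using assms(3) by (simp add: real_sqrt_mult)
qed

lemma L2_norm_tendsto_0:
  fixes f :: "nat \<Rightarrow> 'a::euclidean_space \<Rightarrow> real"
  assumes m: "\<And>n. f n \<in> borel_measurable (lebesgue_on S)"
    and g: "integrable (lebesgue_on S) g" "\<And>n x. (f n x)\<^sup>2 \<le> g x"
    and lim: "AE x in lebesgue_on S. (\<lambda>n. f n x) \<longlonglongrightarrow> 0"
  shows "(\<lambda>n. L2_norm S (f n)) \<longlonglongrightarrow> 0"
proof -
  have "(\<lambda>n. lint S (\<lambda>x. (f n x)\<^sup>2)) \<longlonglongrightarrow> lint S (\<lambda>x. 0)"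
  proof (rule integral_dominated_convergence[OF _ _ g(1)])
    show "AE x in lebesgue_on S. (\<lambda>n. (f n x)\<^sup>2) \<longlonglongrightarrow> 0"
      using lim by eventually_elim (auto intro: tendsto_eq_intros)
    show "AE x in lebesgue_on S. norm ((f n x)\<^sup>2) \<le> g x" for n
      using g(2) by simp
  qed (use m in \<open>auto intro: borel_measurable_power\<close>)
  then have "(\<lambda>n. sqrt (lint S (\<lambda>x. (f n x)\<^sup>2))) \<longlonglongrightarrow> sqrt 0"
    by (intro tendsto_real_sqrt) simp
  then show ?thesis by (simp add: L2_norm_def)
qed

definition clamp_real :: "real \<Rightarrow> real \<Rightarrow> real" where
  "clamp_real k x = max (- k) (min k x)"

lemma clamp_real_bound: "0 \<le> k \<Longrightarrow> \<bar>clamp_real k x\<bar> \<le> k"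
  by (auto simp: clamp_real_def)

text \<open>Measurability yields continuous functions that converge almost everywhere, but without a
  majorant. Truncating \<open>u\<close> at a level \<open>k\<close> repairs this: clamping the
  approximants at the same level keeps them continuous and gives the majorant
  \<open>(2 * k)\<^sup>2\<close> for the squared differences.\<close>

lemma L2_approx_continuous:
  fixes u :: "'a::euclidean_space \<Rightarrow> real"
  assumes u: "u \<in> L2_space (cbox a b)" and e: "e > 0"
  obtains g where "continuous_on UNIV g" "L2_norm (cbox a b) (\<lambda>x. u x - g x) < e"
proof -
  let ?K = "cbox a b" and ?M = "lebesgue_on (cbox a b)"
  have um: "u \<in> borel_measurable ?M" and ui: "integrable ?M (\<lambda>x. (u x)\<^sup>2)"
    using u by (auto simp: L2_space_real)
  have cm: "(\<lambda>x. clamp_real k (u x)) \<in> borel_measurable ?M" for k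
    unfolding clamp_real_def using um by simp
  have "(\<lambda>n. L2_norm ?K (\<lambda>x. u x - clamp_real (real n) (u x))) \<longlonglongrightarrow> 0"
  proof (rule L2_norm_tendsto_0[OF _ ui])
    show "(\<lambda>x. u x - clamp_real (real n) (u x)) \<in> borel_measurable ?M" for n
      using um cm by simp
    show "(u x - clamp_real (real n) (u x))\<^sup>2 \<le> (u x)\<^sup>2" for n x
      by (subst abs_le_square_iff[symmetric]) (auto simp: clamp_real_def)
    show "AE x in ?M. (\<lambda>n. u x - clamp_real (real n) (u x)) \<longlonglongrightarrow> 0"
    proof (rule AE_I2)
      fix x
      obtain N where "\<bar>u x\<bar> \<le> real N" using real_arch_simple by blast
      then have "eventually (\<lambda>n. u x - clamp_real (real n) (u x) = 0) sequentially"
        unfolding eventually_sequentially by (intro exI[of _ N]) (auto simp: clamp_real_def)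
      then show "(\<lambda>n. u x - clamp_real (real n) (u x)) \<longlonglongrightarrow> 0"
        by (rule tendsto_eventually)
    qed
  qed
  then have "eventually (\<lambda>n. L2_norm ?K (\<lambda>x. u x - clamp_real (real n) (u x)) < e / 2) sequentially"
    using e by (intro order_tendstoD) auto
  then obtain n where n: "L2_norm ?K (\<lambda>x. u x - clamp_real (real n) (u x)) < e / 2"
    by (auto simp: eventually_sequentially)
  define k where "k = real n"
  \<comment> \<open>\<open>measurable_on\<close> unfolds to a sequence of continuous functions on
    the whole space that converges off a negligible set.\<close>
  have "(\<lambda>x. if x \<in> ?K then u x else 0) measurable_on UNIV"
    using um by (intro lebesgue_measurable_imp_measurable_on_real) (auto simp: borel_measurable_if)
  then obtain N g where N: "negligible N" "\<And>n. continuous_on UNIV (g n)"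
    "\<And>x. x \<notin> N \<Longrightarrow> (\<lambda>n. g n x) \<longlonglongrightarrow> (if x \<in> ?K then u x else 0)"
    unfolding measurable_on_def by auto
  have cg: "continuous_on S (\<lambda>x. clamp_real k (g n x))" for n S
    unfolding clamp_real_def by (intro continuous_intros continuous_on_subset[OF N(2)]) auto
  have "(\<lambda>n. L2_norm ?K (\<lambda>x. clamp_real k (u x) - clamp_real k (g n x))) \<longlonglongrightarrow> 0"
  proof (rule L2_norm_tendsto_0)
    show "(\<lambda>x. clamp_real k (u x) - clamp_real k (g n x)) \<in> borel_measurable ?M" for n
      by (intro borel_measurable_diff cm continuous_imp_measurable_on_sets_lebesgue cg) auto
    show "integrable ?M (\<lambda>x. (2 * k)\<^sup>2)"
      by (intro continuous_imp_integrable continuous_intros)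
    show "(clamp_real k (u x) - clamp_real k (g n x))\<^sup>2 \<le> (2 * k)\<^sup>2" for n x
      using clamp_real_bound[of k "u x"] clamp_real_bound[of k "g n x"]
      by (subst abs_le_square_iff[symmetric]) (auto simp: k_def)
    have "N \<inter> ?K \<in> null_sets lebesgue"
      using negligible_subset[OF N(1)] by (auto simp: negligible_iff_null_sets[symmetric])
    then have null: "N \<inter> ?K \<in> null_sets ?M"
      by (simp add: null_sets_restrict_space)
    show "AE x in ?M. (\<lambda>n. clamp_real k (u x) - clamp_real k (g n x)) \<longlonglongrightarrow> 0"
    proof (rule AE_I'[OF null], safe)
      fix x assume x: "x \<in> space ?M" and nl: "\<not> (\<lambda>n. clamp_real k (u x) - clamp_real k (g n x)) \<longlonglongrightarrow> 0"
      show "x \<in> N"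
      proof (rule ccontr)
        assume "x \<notin> N"
        then have "(\<lambda>n. g n x) \<longlonglongrightarrow> u x" using N(3)[of x] x by simp
        then have "(\<lambda>n. clamp_real k (u x) - clamp_real k (g n x)) \<longlonglongrightarrow> clamp_real k (u x) - clamp_real k (u x)"
          unfolding clamp_real_def by (intro tendsto_intros)
        then show False using nl by simp
      qed
      show "x \<in> ?K" using x by simp
    qed
  qed
  then have "eventually (\<lambda>n. L2_norm ?K (\<lambda>x. clamp_real k (u x) - clamp_real k (g n x)) < e / 2) sequentially"
    using e by (intro order_tendstoD) auto
  then obtain m where m: "L2_norm ?K (\<lambda>x. clamp_real k (u x) - clamp_real k (g m x)) < e / 2"
    by (auto simp: eventually_sequentially)
  have cu: "(\<lambda>x. clamp_real k (u x)) \<in> L2_space ?K"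
  proof -
    have "integrable ?M (\<lambda>x. (clamp_real k (u x))\<^sup>2)"
    proof (rule Bochner_Integration.integrable_bound[OF ui])
      show "AE x in ?M. norm ((clamp_real k (u x))\<^sup>2) \<le> norm ((u x)\<^sup>2)"
        by (auto simp: abs_le_square_iff[symmetric] clamp_real_def k_def intro!: AE_I2)
    qed (use cm in auto)
    then show ?thesis using cm by (simp add: L2_space_real)
  qed
  have "L2_norm ?K (\<lambda>x. (u x - clamp_real k (u x)) + (clamp_real k (u x) - clamp_real k (g m x))) < e"
    using L2_norm_triangle[OF L2_space_diff[OF u cu] L2_space_diff[OF cu L2_space_continuous[OF cg]], of m] m n
    by (simp add: k_def)
  then show ?thesis using that[OF cg[of UNIV m]] by simp
qed

lemma L2_approx_polynomial:
  fixes u :: "'a::euclidean_space \<Rightarrow> real"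
  assumes u: "u \<in> L2_space (cbox a b)" and e: "e > 0"
  obtains p where "real_polynomial_function p" "L2_norm (cbox a b) (\<lambda>x. u x - p x) < e"
proof -
  let ?K = "cbox a b"
  let ?s = "sqrt (measure lebesgue ?K)"
  obtain g where g: "continuous_on UNIV g" "L2_norm ?K (\<lambda>x. u x - g x) < e / 2"
    using L2_approx_continuous[OF u, of "e / 2"] e by auto
  \<comment> \<open>A uniform error \<open>\<delta>\<close> costs at most
    \<open>\<delta> * ?s\<close> in L2; the added 1 keeps the denominator positive for a box of
    measure zero.\<close>
  define \<delta> where "\<delta> = e / (2 * (?s + 1))"
  have d: "\<delta> > 0" using e by (auto simp: \<delta>_def intro!: divide_pos_pos add_nonneg_pos)
  have gK: "continuous_on ?K g" using g(1) continuous_on_subset by blast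
  obtain p where p: "real_polynomial_function p" "\<And>x. x \<in> ?K \<Longrightarrow> \<bar>g x - p x\<bar> < \<delta>"
    using Stone_Weierstrass_real_polynomial_function[OF compact_cbox gK d] by blast
  have pc: "continuous_on ?K p"
    using p(1) by (simp add: continuous_on_polymonial_function real_polynomial_function_eq)
  have "L2_norm ?K (\<lambda>x. g x - p x) \<le> \<delta> * ?s"
  proof (rule L2_norm_le_bound)
    show "(\<lambda>x. g x - p x) \<in> L2_space ?K"
      by (intro L2_space_continuous continuous_intros gK pc)
  qed (use p(2) d in \<open>auto intro: less_imp_le\<close>)
  also have "\<dots> \<le> \<delta> * (?s + 1)" using d by simp
  also have "\<dots> = e / 2"
  proof -
    have "?s + 1 > 0" by (intro add_nonneg_pos) auto
    then show ?thesis unfolding \<delta>_def by (metis less_irrefl nonzero_mult_divide_mult_cancel_right times_divide_eq_left)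
  qed
  finally have "L2_norm ?K (\<lambda>x. (u x - g x) + (g x - p x)) < e"
    using L2_norm_triangle[OF L2_space_diff[OF u L2_space_continuous[OF gK]]
        L2_space_diff[OF L2_space_continuous[OF gK] L2_space_continuous[OF pc]]] g(2) by simp
  then show ?thesis using that[OF p(1)] by simp
qed

text \<open>A polynomial in two variables is kept as a list of factor pairs, so that differentiating
  or integrating in one variable is a map over the list. The representation is not unique; only the
  represented function matters.\<close>

definition poly2 :: "(real poly \<times> real poly) list \<Rightarrow> plane \<Rightarrow> real" where
  "poly2 L z = (\<Sum>(r, s)\<leftarrow>L. tensor (poly r) (poly s) z)"

lemma poly2_simps [simp]:
  "poly2 [] z = 0" "poly2 ((r, s) # L) z = tensor (poly r) (poly s) z + poly2 L z"
  "poly2 (L @ L') z = poly2 L z + poly2 L' z"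
  by (simp_all add: poly2_def)

lemma poly2_mult: "\<exists>L''. \<forall>z. poly2 L z * poly2 L' z = poly2 L'' z"
proof (induction L)
  case Nil
  show ?case by (rule exI[of _ "[]"]) simp
next
  case (Cons rs L)
  obtain r s where rs: "rs = (r, s)" by force
  obtain L1 where L1: "\<And>z. poly2 L z * poly2 L' z = poly2 L1 z" using Cons by blast
  have "tensor (poly r) (poly s) z * poly2 L' z = poly2 (map (\<lambda>(r', s'). (r * r', s * s')) L') z" for z
    by (induction L') (auto simp: tensor_def algebra_simps)
  then have "\<forall>z. poly2 (rs # L) z * poly2 L' z = poly2 (map (\<lambda>(r', s'). (r * r', s * s')) L' @ L1) z"
    by (simp add: rs L1 distrib_right)
  then show ?case by blast
qed

lemma real_polynomial_function_poly2:
  "real_polynomial_function g \<Longrightarrow> \<exists>L. \<forall>z. g z = poly2 L (z :: plane)"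
proof (induction g rule: real_polynomial_function.induct)
  case (linear f)
  interpret bounded_linear f by fact
  have "f z = poly2 [([:0, f (1, 0):], 1), (1, [:0, f (0, 1):])] z" for z
  proof -
    have "z = fst z *\<^sub>R (1, 0) + snd z *\<^sub>R (0, 1)" by (cases z) simp
    then have "f z = f (fst z *\<^sub>R (1, 0) + snd z *\<^sub>R (0, 1))" by simp
    also have "\<dots> = fst z * f (1, 0) + snd z * f (0, 1)" by (simp only: add scaleR real_scaleR_def)
    finally show ?thesis by (simp add: tensor_def)
  qed
  then show ?case by blast
next
  case (const c)
  have "\<forall>z. c = poly2 [([:c:], 1)] z" by (simp add: tensor_def)
  then show ?case by blast
next
  case (add f g)
  then obtain L L' where "\<forall>z. f z = poly2 L z" "\<forall>z. g z = poly2 L' z" by blast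
  then have "\<forall>z. f z + g z = poly2 (L @ L') z" by simp
  then show ?case by blast
next
  case (mult f g)
  then show ?case using poly2_mult by metis
qed

lemma continuous_on_poly_tensor [continuous_intros]:
  "continuous_on S (tensor (poly r) (poly s))"
  by (intro continuous_on_tensor continuous_intros)

lemma continuous_on_poly2 [continuous_intros]: "continuous_on S (poly2 L)"
proof -
  have "continuous_on S (\<lambda>z. poly2 L z)"
    by (induction L) (auto intro!: continuous_intros)
  then show ?thesis by simp
qed

section \<open>One-dimensional estimates for antiderivatives\<close>

lemma poly_antiderivative: "\<exists>R. pderiv R = r \<and> poly R a = 0" for r :: "real poly"
proof -
  define Q where "Q = (\<Sum>i\<le>degree r. monom (coeff r i / real (Suc i)) (Suc i))"
  have "pderiv Q = (\<Sum>i\<le>degree r. monom (coeff r i) i)"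
    unfolding Q_def higher_pderiv_sum[of 1, simplified]
    by (intro sum.cong) (auto simp: pderiv_monom simp del: of_nat_Suc)
  then have "pderiv Q = r" by (simp add: poly_as_sum_of_monoms)
  then have "pderiv (Q - [:poly Q a:]) = r" by (simp add: pderiv_diff pderiv_pCons)
  then show ?thesis by (intro exI[of _ "Q - [:poly Q a:]"]) simp
qed

text \<open>The variance identity, with two uses: subtracting the mean does not increase the square
  integral, and the squared mean times the length is at most the square integral. The mean enters
  through an equation, to match means that arise as values of a polynomial.\<close>

lemma integral_minus_mean_square:
  fixes h :: "real \<Rightarrow> real"
  assumes "a \<le> b" "continuous_on {a..b} h" "m * (b - a) = integral {a..b} h"
  shows "integral {a..b} (\<lambda>x. (h x - m)\<^sup>2) = integral {a..b} (\<lambda>x. (h x)\<^sup>2) - m\<^sup>2 * (b - a)"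
proof -
  have i: "h integrable_on {a..b}" "(\<lambda>x. (h x)\<^sup>2) integrable_on {a..b}"
    using assms(2) by (auto intro!: integrable_continuous_interval continuous_intros)
  have "integral {a..b} (\<lambda>x. (h x - m)\<^sup>2) = integral {a..b} (\<lambda>x. ((h x)\<^sup>2 - 2 * m * h x) + m\<^sup>2)"
    by (intro integral_cong) (simp add: power2_eq_square algebra_simps)
  also have "\<dots> = (integral {a..b} (\<lambda>x. (h x)\<^sup>2) - 2 * m * integral {a..b} h) + m\<^sup>2 * (b - a)"
  proof (rule integral_unique)
    have "((\<lambda>x. m\<^sup>2) has_integral m\<^sup>2 * (b - a)) {a..b}"
      using has_integral_const_real[of "m\<^sup>2" a b] assms(1) by (simp add: mult.commute)
    then show "((\<lambda>x. ((h x)\<^sup>2 - 2 * m * h x) + m\<^sup>2) has_integral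
        (integral {a..b} (\<lambda>x. (h x)\<^sup>2) - 2 * m * integral {a..b} h) + m\<^sup>2 * (b - a)) {a..b}"
      by (intro has_integral_add has_integral_diff has_integral_mult_right integrable_integral i)
  qed
  also have "\<dots> = integral {a..b} (\<lambda>x. (h x)\<^sup>2) - m\<^sup>2 * (b - a)"
    unfolding assms(3)[symmetric] by (simp add: power2_eq_square)
  finally show ?thesis .
qed

text \<open>\<open>H x\<close> is the integral of \<open>h - m\<close> from \<open>a\<close> to
  \<open>x\<close>, so Cauchy-Schwarz bounds its square by \<open>b - a\<close> times the square
  integral of \<open>h - m\<close>. Integrating over \<open>x\<close> gives the second factor
  \<open>b - a\<close>, and removing the mean does not increase the square integral.\<close>

lemma integral_antiderivative_square:
  fixes h H :: "real \<Rightarrow> real"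
  assumes ab: "a \<le> b" and h: "continuous_on {a..b} h" and m: "m * (b - a) = integral {a..b} h"
    and H: "\<And>x. x \<in> {a..b} \<Longrightarrow> (H has_real_derivative h x - m) (at x)" "H a = 0"
  shows "integral {a..b} (\<lambda>x. (H x)\<^sup>2) \<le> (b - a)\<^sup>2 * integral {a..b} (\<lambda>x. (h x)\<^sup>2)"
proof -
  define k where "k x = h x - m" for x
  have kc: "continuous_on {a..b} k" unfolding k_def by (intro continuous_intros h)
  define I where "I = integral {a..b} (\<lambda>x. (k x)\<^sup>2)"
  have pt: "(H x)\<^sup>2 \<le> (b - a) * I" if x: "x \<in> {a..b}" for x
  proof -
    have sub: "{a..x} \<subseteq> {a..b}" using x by auto
    have kx: "continuous_on (cbox a x) k" using continuous_on_subset[OF kc sub] by simp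
    have "(k has_integral (H x - H a)) {a..x}"
      using x H(1) by (intro fundamental_theorem_of_calculus)
        (auto simp: k_def has_real_derivative_iff_has_vector_derivative intro: has_vector_derivative_at_within)
    then have "H x = integral {a..x} k" using H(2) by (simp add: integral_unique)
    also have "\<dots> = lint (cbox a x) (\<lambda>t. 1 * k t)"
      using integral_continuous_lebesgue_on[OF kx] by simp
    finally have "\<bar>H x\<bar> \<le> L2_norm (cbox a x) (\<lambda>t. 1::real) * L2_norm (cbox a x) k"
      using L2_Cauchy_Schwarz[OF L2_space_continuous[of a x "\<lambda>t. 1::real"] L2_space_continuous[OF kx]] by simp
    then have "(H x)\<^sup>2 \<le> (L2_norm (cbox a x) (\<lambda>t. 1::real) * L2_norm (cbox a x) k)\<^sup>2"
      by (metis abs_ge_zero power2_abs power_mono)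
    also have "\<dots> = (x - a) * integral {a..x} (\<lambda>t. (k t)\<^sup>2)"
      unfolding power_mult_distrib L2_norm_power2_real
      using x kx by (subst (1 2) integral_continuous_lebesgue_on) (auto intro!: continuous_intros)
    also have "\<dots> \<le> (b - a) * I"
    proof (rule mult_mono)
      show "integral {a..x} (\<lambda>t. (k t)\<^sup>2) \<le> I"
        unfolding I_def using sub
      proof (rule integral_subset_le)
        show "(\<lambda>t. (k t)\<^sup>2) integrable_on {a..x}" "(\<lambda>t. (k t)\<^sup>2) integrable_on {a..b}"
          using kc kx by (auto intro!: integrable_continuous_interval continuous_intros)
      qed auto
    qed (use x in \<open>auto intro!: integral_nonneg integrable_continuous_interval continuous_intros\<close>,
        use kx in \<open>auto intro!: continuous_intros\<close>)
    finally show ?thesis .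
  qed
  have Hc: "continuous_on {a..b} H"
    using H(1) by (meson DERIV_isCont continuous_at_imp_continuous_on)
  have "integral {a..b} (\<lambda>x. (H x)\<^sup>2) \<le> integral {a..b} (\<lambda>x. (b - a) * I)"
    using pt Hc by (intro integral_le integrable_continuous_interval continuous_intros) auto
  also have "\<dots> = (b - a)\<^sup>2 * I" using ab by (simp add: power2_eq_square)
  also have "I \<le> integral {a..b} (\<lambda>x. (h x)\<^sup>2)"
    unfolding I_def k_def integral_minus_mean_square[OF ab h m] using ab by simp
  finally show ?thesis by (simp add: mult_left_mono)
qed

section \<open>The Poincare inequality on a rectangle\<close>

context subrectangle
begin

lemma L2_space_tensor: "tensor (poly r) (poly s) \<in> L2_space K"
  by (intro L2_space_continuous continuous_intros)

lemma L2_space_poly2: "poly2 L \<in> L2_space K"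
  by (intro L2_space_continuous continuous_intros)

lemma integral_mult_poly2:
  assumes "u \<in> L2_space K"
  shows "lint K (\<lambda>z. u z * poly2 L z)
    = (\<Sum>(r, s)\<leftarrow>L. lint K (\<lambda>z. u z * tensor (poly r) (poly s) z))"
proof (induction L)
  case (Cons rs L)
  obtain r s where rs: "rs = (r, s)" by force
  show ?case
    using Cons integrable_mult_L2[OF assms L2_space_tensor[of r s]] integrable_mult_L2[OF assms L2_space_poly2[of L]]
    by (simp add: rs distrib_left)
qed simp

lemma weak_dx_poly2:
  assumes "u \<in> L2_space K" "v \<in> L2_space K" "weak_dx u v"
    and "\<And>r s. (r, s) \<in> set L \<Longrightarrow> poly r a = 0 \<and> poly r b = 0"
  shows "lint K (\<lambda>z. u z * poly2 (map (\<lambda>(r, s). (pderiv r, s)) L) z)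
    = - lint K (\<lambda>z. v z * poly2 L z)"
  unfolding integral_mult_poly2[OF assms(1)] integral_mult_poly2[OF assms(2)]
  using assms(4)
proof (induction L)
  case (Cons rs L)
  obtain r s where rs: "rs = (r, s)" by force
  have "poly r a = 0" "poly r b = 0" using Cons.prems[of r s] by (simp_all add: rs)
  moreover note Cons.IH
  moreover have "\<And>r s. (r, s) \<in> set L \<Longrightarrow> poly r a = 0 \<and> poly r b = 0"
    by (meson Cons.prems list.set_intros(2))
  ultimately show ?case using assms(3) by (simp add: weak_dx_def rs)
qed simp

lemma continuous_on_sections_poly2:
  "continuous_on S (\<lambda>x. poly2 L (x, y))" "continuous_on S (\<lambda>y. poly2 L (x, y))"
  by (intro continuous_on_compose2[OF continuous_on_poly2[of UNIV L]] continuous_intros; simp)+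

lemma continuous_on_integral_section_poly2:
  "continuous_on {c..d} (\<lambda>y. integral {a..b} (\<lambda>x. (poly2 L (x, y))\<^sup>2))"
proof -
  have "continuous_on ({c..d} \<times> cbox a b) (\<lambda>x. (poly2 L (snd x, fst x))\<^sup>2)"
    by (intro continuous_intros continuous_on_compose2[OF continuous_on_poly2[of UNIV L]]) auto
  then show ?thesis
    using integral_continuous_on_param[of "{c..d}" a b "\<lambda>y x. (poly2 L (x, y))\<^sup>2"]
    by (simp add: split_def)
qed

text \<open>A polynomial is split as \<open>f = (f - g) + (g - n) + n\<close>, where \<open>g\<close> is the mean of \<open>f\<close> in the
  first variable and \<open>n\<close> the mean of \<open>g\<close>: the first two parts are derivatives of polynomials that
  vanish on two opposite sides, and the constant does not see \<open>u\<close>.\<close>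

lemma poincare_test:
  assumes u: "u \<in> L2_space K" "v \<in> L2_space K" "v' \<in> L2_space K" "weak_dx u v" "weak_dy u v'"
    and mean: "lint K u = 0"
  shows "\<bar>lint K (\<lambda>z. u z * poly2 L z)\<bar>
    \<le> ((b - a) * L2_norm K v + (d - c) * L2_norm K v') * L2_norm K (poly2 L)"
proof -
  define \<mu> where "\<mu> r = integral {a..b} (poly r) / (b - a)" for r
  \<comment> \<open>Antiderivatives of \<open>r\<close> minus its mean: starting from zero at
    \<open>a\<close>, they return to zero at \<open>b\<close>.\<close>
  have "\<exists>R. \<forall>r. pderiv (R r) = r - [:\<mu> r:] \<and> poly (R r) a = 0"
    by (intro choice allI poly_antiderivative)
  then obtain R where R: "\<And>r. pderiv (R r) = r - [:\<mu> r:]" "\<And>r. poly (R r) a = 0"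
    by blast
  have Rb: "poly (R r) b = 0" for r
  proof -
    have "((\<lambda>x. poly r x - \<mu> r) has_integral (poly (R r) b - poly (R r) a)) {a..b}"
      using ab poly_DERIV[of "R r"] by (intro fundamental_theorem_of_calculus)
        (auto simp: R has_real_derivative_iff_has_vector_derivative intro: has_vector_derivative_at_within)
    moreover have "((\<lambda>x. poly r x - \<mu> r) has_integral (integral {a..b} (poly r) - (b - a) * \<mu> r)) {a..b}"
      using has_integral_const_real[of "\<mu> r" a b] ab
      by (intro has_integral_diff integrable_integral integrable_continuous_interval continuous_intros) simp
    ultimately have "poly (R r) b - poly (R r) a = integral {a..b} (poly r) - (b - a) * \<mu> r"
      by (rule has_integral_unique)
    then show ?thesis using ab R(2)[of r] by (simp add: \<mu>_def)
  qed
  define \<psi> where "\<psi> = map (\<lambda>(r, s). (R r, s)) L"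
  \<comment> \<open>The mean in the first variable, as a polynomial in the second; \<open>Q\<close>
    below plays for \<open>S\<close> the role that \<open>R r\<close> plays for
    \<open>r\<close>.\<close>
  define S where "S = (\<Sum>(r, s)\<leftarrow>L. smult (\<mu> r) s)"
  define n where "n = integral {c..d} (poly S) / (d - c)"
  obtain Q where Q: "pderiv Q = S - [:n:]" "poly Q c = 0" using poly_antiderivative by blast
  have Qd: "poly Q d = 0"
  proof -
    have "((\<lambda>x. poly S x - n) has_integral (poly Q d - poly Q c)) {c..d}"
      using cd poly_DERIV[of Q] by (intro fundamental_theorem_of_calculus)
        (auto simp: Q has_real_derivative_iff_has_vector_derivative intro: has_vector_derivative_at_within)
    moreover have "((\<lambda>x. poly S x - n) has_integral (integral {c..d} (poly S) - (d - c) * n)) {c..d}"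
      using has_integral_const_real[of n c d] cd
      by (intro has_integral_diff integrable_integral integrable_continuous_interval continuous_intros) simp
    ultimately have "poly Q d - poly Q c = integral {c..d} (poly S) - (d - c) * n"
      by (rule has_integral_unique)
    then show ?thesis using cd Q(2) by (simp add: n_def)
  qed
  have mean_x: "poly S y * (b - a) = integral {a..b} (\<lambda>x. poly2 L (x, y))" for y
  proof -
    have "((\<lambda>x. poly2 L (x, y)) has_integral poly S y * (b - a)) {a..b}"
      unfolding S_def
    proof (induction L)
      case (Cons rs L)
      obtain r s where rs: "rs = (r, s)" by force
      have "((\<lambda>x. poly r x * poly s y + poly2 L (x, y)) has_integral
          integral {a..b} (poly r) * poly s y + poly (\<Sum>(r, s)\<leftarrow>L. smult (\<mu> r) s) y * (b - a)) {a..b}"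
        by (intro has_integral_add has_integral_mult_left Cons integrable_integral
            integrable_continuous_interval continuous_intros)
      moreover have "integral {a..b} (poly r) = \<mu> r * (b - a)" using ab by (simp add: \<mu>_def)
      ultimately show ?case by (simp add: rs tensor_def algebra_simps)
    qed simp
    then show ?thesis by (simp add: integral_unique)
  qed
  have f_split: "poly2 L z = poly2 (map (\<lambda>(r, s). (pderiv r, s)) \<psi>) z + tensor (poly 1) (poly (pderiv Q)) z + n" for z
  proof -
    have "poly2 L z = poly2 (map (\<lambda>(r, s). (pderiv r, s)) \<psi>) z + poly S (snd z)"
      unfolding \<psi>_def S_def
      by (induction L) (auto simp: tensor_def R algebra_simps)
    then show ?thesis by (simp add: tensor_def Q)
  qed
  have \<psi>_deriv: "((\<lambda>x. poly2 \<psi> (x, y)) has_real_derivative (poly2 L (x, y) - poly S y)) (at x)" for x y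
    unfolding \<psi>_def S_def
  proof (induction L)
    case (Cons rs L)
    obtain r s where rs: "rs = (r, s)" by force
    have "((\<lambda>x. poly (R r) x * poly s y + poly2 (map (\<lambda>(r, s). (R r, s)) L) (x, y)) has_real_derivative
        (poly (pderiv (R r)) x * poly s y + (poly2 L (x, y) - poly (\<Sum>(r, s)\<leftarrow>L. smult (\<mu> r) s) y))) (at x)"
      by (intro DERIV_add DERIV_cmult_right poly_DERIV Cons)
    then show ?case by (simp add: rs tensor_def R algebra_simps)
  qed simp
  have \<psi>_a: "poly2 \<psi> (a, y) = 0" for y
    unfolding \<psi>_def by (induction L) (auto simp: tensor_def R)
  let ?I = "lint K"
  let ?f = "poly2 L"
  have fsq: "continuous_on K (\<lambda>z. (poly2 L' z)\<^sup>2)" for L'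
    by (intro continuous_intros)
  \<comment> \<open>On each horizontal line \<open>\<psi>\<close> is the antiderivative of the
    polynomial minus its mean on that line, so the one-dimensional estimate applies line by
    line.\<close>
  have \<psi>_norm: "L2_norm K (poly2 \<psi>) \<le> (b - a) * L2_norm K ?f"
  proof (rule power2_le_imp_le)
    have "(L2_norm K (poly2 \<psi>))\<^sup>2 = integral {c..d} (\<lambda>y. integral {a..b} (\<lambda>x. (poly2 \<psi> (x, y))\<^sup>2))"
      unfolding L2_norm_power2_real by (rule integral_rectangle_iterated_fst[OF fsq])
    also have "\<dots> \<le> integral {c..d} (\<lambda>y. (b - a)\<^sup>2 * integral {a..b} (\<lambda>x. (?f (x, y))\<^sup>2))"
    proof (rule integral_le)
      have int: "continuous_on {c..d} (\<lambda>y. integral {a..b} (\<lambda>x. (poly2 L' (x, y))\<^sup>2))" for L'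
        by (rule continuous_on_integral_section_poly2)
      then show "(\<lambda>y. integral {a..b} (\<lambda>x. (poly2 \<psi> (x, y))\<^sup>2)) integrable_on {c..d}"
        "(\<lambda>y. (b - a)\<^sup>2 * integral {a..b} (\<lambda>x. (?f (x, y))\<^sup>2)) integrable_on {c..d}"
        by (auto intro!: integrable_continuous_interval continuous_intros)
      show "integral {a..b} (\<lambda>x. (poly2 \<psi> (x, y))\<^sup>2) \<le> (b - a)\<^sup>2 * integral {a..b} (\<lambda>x. (?f (x, y))\<^sup>2)" for y
        using ab continuous_on_sections_poly2 mean_x \<psi>_deriv \<psi>_a
        by (intro integral_antiderivative_square[where m="poly S y"]) auto
    qed
    also have "\<dots> = (b - a)\<^sup>2 * ?I (\<lambda>z. (?f z)\<^sup>2)"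
      using integral_rectangle_iterated_fst[OF fsq] by simp
    finally show "(L2_norm K (poly2 \<psi>))\<^sup>2 \<le> ((b - a) * L2_norm K ?f)\<^sup>2"
      by (simp add: power_mult_distrib L2_norm_power2_real)
  qed (use ab in auto)
  have Q_norm: "L2_norm K (tensor (poly 1) (poly Q)) \<le> (d - c) * L2_norm K ?f"
  proof (rule power2_le_imp_le)
    have "continuous_on K (\<lambda>z. (tensor (poly 1) (poly Q) z)\<^sup>2)"
      by (intro continuous_intros)
    then have "(L2_norm K (tensor (poly 1) (poly Q)))\<^sup>2
        = integral {a..b} (\<lambda>x. integral {c..d} (\<lambda>y. (tensor (poly 1) (poly Q) (x, y))\<^sup>2))"
      unfolding L2_norm_power2_real by (rule integral_rectangle_iterated_snd)
    also have "\<dots> = (b - a) * integral {c..d} (\<lambda>y. (poly Q y)\<^sup>2)"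
      using ab by (simp add: tensor_def)
    also have "\<dots> \<le> (b - a) * ((d - c)\<^sup>2 * integral {c..d} (\<lambda>y. (poly S y)\<^sup>2))"
    proof (intro mult_left_mono integral_antiderivative_square[where m=n])
      show "(poly Q has_real_derivative poly S y - n) (at y)" for y
        using poly_DERIV[of Q y] by (simp add: Q)
    qed (use ab cd Q in \<open>auto simp: n_def intro!: continuous_intros\<close>)
    also have "\<dots> = (d - c)\<^sup>2 * integral {c..d} (\<lambda>y. (poly S y)\<^sup>2 * (b - a))"
      by simp
    \<comment> \<open>The variance on each horizontal line is nonnegative, which leads from the mean
      \<open>S\<close> back to the full polynomial.\<close>
    also have "\<dots> \<le> (d - c)\<^sup>2 * integral {c..d} (\<lambda>y. integral {a..b} (\<lambda>x. (?f (x, y))\<^sup>2))"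
    proof (intro mult_left_mono integral_le)
      have "continuous_on {c..d} (\<lambda>y. integral {a..b} (\<lambda>x. (poly2 L (x, y))\<^sup>2))"
        by (rule continuous_on_integral_section_poly2)
      then show "(\<lambda>y. integral {a..b} (\<lambda>x. (?f (x, y))\<^sup>2)) integrable_on {c..d}"
        by (auto intro!: integrable_continuous_interval)
      show "(poly S y)\<^sup>2 * (b - a) \<le> integral {a..b} (\<lambda>x. (?f (x, y))\<^sup>2)" for y
      proof -
        have "0 \<le> integral {a..b} (\<lambda>x. (?f (x, y) - poly S y)\<^sup>2)"
          by (intro integral_nonneg integrable_continuous_interval continuous_intros continuous_on_sections_poly2) auto
        then show ?thesis
          using integral_minus_mean_square[OF _ continuous_on_sections_poly2(1) mean_x] ab by simp
      qed
    qed (auto intro!: integrable_continuous_interval continuous_intros)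
    also have "\<dots> = (d - c)\<^sup>2 * ?I (\<lambda>z. (?f z)\<^sup>2)"
      using integral_rectangle_iterated_fst[OF fsq] by simp
    finally show "(L2_norm K (tensor (poly 1) (poly Q)))\<^sup>2 \<le> ((d - c) * L2_norm K ?f)\<^sup>2"
      by (simp add: power_mult_distrib L2_norm_power2_real)
  qed (use cd in auto)
  have "?I (\<lambda>z. u z * ?f z) = ?I (\<lambda>z. u z * poly2 (map (\<lambda>(r, s). (pderiv r, s)) \<psi>) z)
      + ?I (\<lambda>z. u z * tensor (poly 1) (poly (pderiv Q)) z) + n * ?I u"
  proof -
    have "integrable (lebesgue_on K) (\<lambda>z. u z * 1)"
      by (intro integrable_mult_L2 u L2_space_continuous continuous_intros)
    then show ?thesis
      using integrable_mult_L2[OF u(1) L2_space_poly2] integrable_mult_L2[OF u(1) L2_space_tensor]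
      by (simp add: f_split distrib_left)
  qed
  also have "\<dots> = - ?I (\<lambda>z. v z * poly2 \<psi> z) - ?I (\<lambda>z. v' z * tensor (poly 1) (poly Q) z)"
  proof -
    have "?I (\<lambda>z. u z * poly2 (map (\<lambda>(r, s). (pderiv r, s)) \<psi>) z) = - ?I (\<lambda>z. v z * poly2 \<psi> z)"
      using R(2) Rb by (intro weak_dx_poly2 u) (auto simp: \<psi>_def)
    then show ?thesis using u(5) Q(2) Qd mean by (simp add: weak_dy_def)
  qed
  finally have "\<bar>?I (\<lambda>z. u z * ?f z)\<bar> \<le> \<bar>?I (\<lambda>z. v z * poly2 \<psi> z)\<bar> + \<bar>?I (\<lambda>z. v' z * tensor (poly 1) (poly Q) z)\<bar>"
    by linarith
  also have "\<dots> \<le> L2_norm K v * L2_norm K (poly2 \<psi>) + L2_norm K v' * L2_norm K (tensor (poly 1) (poly Q))"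
    by (intro add_mono L2_Cauchy_Schwarz u L2_space_poly2 L2_space_tensor)
  also have "\<dots> \<le> L2_norm K v * ((b - a) * L2_norm K ?f) + L2_norm K v' * ((d - c) * L2_norm K ?f)"
    by (intro add_mono mult_left_mono \<psi>_norm Q_norm) auto
  finally show ?thesis by (simp add: algebra_simps)
qed

text \<open>By duality: the square of the norm of \<open>u\<close> is the pairing of
  \<open>u\<close> with a polynomial close to \<open>u\<close>, which \<open>poincare_test\<close>
  bounds, plus an error that density makes arbitrarily small. One factor of the norm is cancelled at
  the end.\<close>

lemma poincare:
  assumes u: "u \<in> L2_space K" "v \<in> L2_space K" "v' \<in> L2_space K" "weak_dx u v" "weak_dy u v'"
    and mean: "lint K u = 0"
  shows "L2_norm K u \<le> (b - a) * L2_norm K v + (d - c) * L2_norm K v'"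
proof -
  let ?I = "lint K"
  let ?A = "(b - a) * L2_norm K v + (d - c) * L2_norm K v'"
  let ?U = "L2_norm K u"
  have A: "?A \<ge> 0" using ab cd by simp
  have *: "?U\<^sup>2 \<le> ?A * ?U + e" if e: "e > 0" for e
  proof -
    \<comment> \<open>The two approximation errors add up to \<open>\<delta> * (?A + ?U)\<close>;
      the added 1 makes the denominator positive.\<close>
    define \<delta> where "\<delta> = e / (?A + ?U + 1)"
    have pos: "?A + ?U + 1 > 0" using A by (simp add: add_nonneg_pos)
    then have d: "\<delta> > 0" using e by (simp add: \<delta>_def)
    obtain p where p: "real_polynomial_function p" "L2_norm K (\<lambda>x. u x - p x) < \<delta>"
      using L2_approx_polynomial[OF u(1) d] by blast
    obtain L where "\<And>z. p z = poly2 L z" using real_polynomial_function_poly2[OF p(1)] by blast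
    then have L: "p = poly2 L" by auto
    have "?U\<^sup>2 = ?I (\<lambda>z. u z * poly2 L z) + ?I (\<lambda>z. u z * (u z - poly2 L z))"
      using integrable_mult_L2[OF u(1) L2_space_poly2] integrable_mult_L2[OF u(1) L2_space_diff[OF u(1) L2_space_poly2]]
      by (simp add: L2_norm_power2_real flip: Bochner_Integration.integral_add) (simp add: algebra_simps power2_eq_square)
    also have "\<dots> \<le> ?A * L2_norm K (poly2 L) + ?U * L2_norm K (\<lambda>z. u z - poly2 L z)"
      using poincare_test[OF assms, of L] L2_Cauchy_Schwarz[OF u(1) L2_space_diff[OF u(1) L2_space_poly2], of L]
      by linarith
    also have "\<dots> \<le> ?A * (?U + \<delta>) + ?U * \<delta>"
    proof (intro add_mono mult_left_mono A)
      show "L2_norm K (\<lambda>z. u z - poly2 L z) \<le> \<delta>" using p(2) L by simp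
      then show "L2_norm K (poly2 L) \<le> ?U + \<delta>"
        using L2_norm_triangle_diff[OF L2_space_poly2 u(1), of L] L2_norm_minus_commute[of K u "poly2 L"] by simp
    qed simp
    also have "\<dots> = ?A * ?U + \<delta> * (?A + ?U)" by (simp add: algebra_simps)
    also have "\<dots> \<le> ?A * ?U + \<delta> * (?A + ?U + 1)" using d by simp
    also have "\<dots> = ?A * ?U + e" unfolding \<delta>_def using pos by simp
    finally show ?thesis .
  qed
  then have "?U\<^sup>2 \<le> ?A * ?U" by (rule field_le_epsilon)
  then have le: "?U * ?U \<le> ?A * ?U" by (simp add: power2_eq_square)
  show ?thesis
  proof (cases "?U = 0")
    case False
    then have "?U > 0" using L2_norm_nonneg[of K u] by linarith
    then show ?thesis using le by (rule mult_right_le_imp_le[rotated])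
  qed (use A in simp)
qed

end

section \<open>Finite-dimensional function spaces and projections\<close>

text \<open>Linear subspaces of a function type, phrased with pointwise operations so that
  scalar-valued spaces, fields and functions on an edge parameter share one treatment.\<close>

definition function_space :: "('z \<Rightarrow> 'b::real_vector) set \<Rightarrow> bool" where
  "function_space V \<longleftrightarrow> (\<lambda>z. 0) \<in> V \<and> (\<forall>f\<in>V. \<forall>g\<in>V. (\<lambda>z. f z + g z) \<in> V) \<and>
     (\<forall>k. \<forall>f\<in>V. (\<lambda>z. k *\<^sub>R f z) \<in> V)"

lemma function_space_0: "function_space V \<Longrightarrow> (\<lambda>z. 0) \<in> V"
  and function_space_add: "function_space V \<Longrightarrow> f \<in> V \<Longrightarrow> g \<in> V \<Longrightarrow> (\<lambda>z. f z + g z) \<in> V"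
  and function_space_scale: "function_space V \<Longrightarrow> f \<in> V \<Longrightarrow> (\<lambda>z. k *\<^sub>R f z) \<in> V"
  by (auto simp: function_space_def)

lemma function_space_cmult: "function_space V \<Longrightarrow> f \<in> V \<Longrightarrow> (\<lambda>z. k * f z :: real) \<in> V"
  using function_space_scale[of V f k] by simp

lemma function_space_diff:
  assumes "function_space V" "f \<in> V" "g \<in> V"
  shows "(\<lambda>z. f z - g z) \<in> V"
  using function_space_add[OF assms(1,2) function_space_scale[OF assms(1,3), of "-1"]] by simp

lemma function_space_sum:
  assumes "function_space V" "\<And>i. i \<in> I \<Longrightarrow> f i \<in> V"
  shows "(\<lambda>z. \<Sum>i\<in>I. f i z) \<in> V"
  using assms(2)
proof (induction I rule: infinite_finite_induct)
  case (insert i I)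
  then show ?case using function_space_add[OF assms(1), of "f i" "\<lambda>z. \<Sum>i\<in>I. f i z"] by simp
qed (simp_all add: function_space_0 assms(1))

text \<open>The linear span, built one generator at a time to support a Gram-Schmidt induction; the
  generators may be linearly dependent.\<close>

fun fspan :: "('z \<Rightarrow> 'b::real_vector) list \<Rightarrow> ('z \<Rightarrow> 'b) set" where
  "fspan [] = {\<lambda>z. 0}"
| "fspan (f # fs) = {(\<lambda>z. t *\<^sub>R f z + g z) | t g. g \<in> fspan fs}"

lemma function_space_fspan: "function_space (fspan fs)"
proof (induction fs)
  case (Cons f fs)
  have "\<exists>t g. (\<lambda>z. 0) = (\<lambda>z. t *\<^sub>R f z + g z) \<and> g \<in> fspan fs"
    using function_space_0[OF Cons] by (intro exI[of _ 0] exI[of _ "\<lambda>z. 0"]) simp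
  moreover have "\<exists>t'' g''. (\<lambda>z. (t *\<^sub>R f z + g z) + (t' *\<^sub>R f z + g' z)) = (\<lambda>z. t'' *\<^sub>R f z + g'' z) \<and> g'' \<in> fspan fs"
    if "g \<in> fspan fs" "g' \<in> fspan fs" for t t' g g'
    using function_space_add[OF Cons that]
    by (intro exI[of _ "t + t'"] exI[of _ "\<lambda>z. g z + g' z"]) (simp add: algebra_simps)
  moreover have "\<exists>t'' g''. (\<lambda>z. k *\<^sub>R (t *\<^sub>R f z + g z)) = (\<lambda>z. t'' *\<^sub>R f z + g'' z) \<and> g'' \<in> fspan fs"
    if "g \<in> fspan fs" for t k g
    using function_space_scale[OF Cons that, of k]
    by (intro exI[of _ "k * t"] exI[of _ "\<lambda>z. k *\<^sub>R g z"]) (simp add: algebra_simps)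
  ultimately show ?case unfolding function_space_def fspan.simps by blast
qed (simp add: function_space_def)

lemma fspan_base: "f \<in> set fs \<Longrightarrow> f \<in> fspan fs"
proof (induction fs)
  case (Cons g fs)
  show ?case
  proof (cases "f = g")
    case True
    then show ?thesis using function_space_0[OF function_space_fspan[of fs]]
      by (auto intro!: exI[of _ 1] exI[of _ "\<lambda>z. 0"])
  next
    case False
    then have "f \<in> fspan fs" using Cons by simp
    then show ?thesis by (auto intro!: exI[of _ 0] exI[of _ f])
  qed
qed simp

lemma fspan_least: "function_space V \<Longrightarrow> set fs \<subseteq> V \<Longrightarrow> fspan fs \<subseteq> V"
proof (induction fs)
  case (Cons f fs)
  then have "f \<in> V" "fspan fs \<subseteq> V" by auto
  then show ?case
    using function_space_add[OF Cons.prems(1) function_space_scale[OF Cons.prems(1), of f]] by auto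
qed (simp add: function_space_0)

lemma fspan_mono: "set fs \<subseteq> set gs \<Longrightarrow> fspan fs \<subseteq> fspan gs"
  by (intro fspan_least function_space_fspan) (use fspan_base in blast)

definition finite_dim :: "('z \<Rightarrow> 'b::real_vector) set \<Rightarrow> bool" where
  "finite_dim V \<longleftrightarrow> (\<exists>fs. V = fspan fs)"

lemma finite_dim_function_space: "finite_dim V \<Longrightarrow> function_space V"
  using function_space_fspan by (auto simp: finite_dim_def)

lemma finite_dimI:
  assumes "function_space V" "set fs \<subseteq> V" "V \<subseteq> fspan fs"
  shows "finite_dim V"
  using fspan_least[OF assms(1,2)] assms(3) by (auto simp: finite_dim_def)

lemma fspan_linear_image:
  assumes "linear A" "f \<in> fspan fs"
  shows "(\<lambda>z. A (f z)) \<in> fspan (map (\<lambda>f z. A (f z)) fs)"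
  using assms(2)
proof (induction fs arbitrary: f)
  case (Cons g fs)
  then obtain t h where h: "f = (\<lambda>z. t *\<^sub>R g z + h z)" "h \<in> fspan fs" by auto
  then show ?case using Cons.IH[OF h(2)] assms(1)
    by (auto simp: linear_add linear_scale intro!: exI[of _ t] exI[of _ "\<lambda>z. A (h z)"])
qed (simp add: linear_0[OF assms(1)])

text \<open>Gram-Schmidt on the generators: the part \<open>f'\<close> of the new generator that is
  orthogonal to the old span is split off, and the old representative is corrected by a multiple of
  \<open>f'\<close>. The functional is generalised in the induction because the hypothesis is used
  for \<open>l\<close> and for the functional \<open>B f\<close>.\<close>

lemma riesz_fspan:
  fixes B :: "('z \<Rightarrow> 'b::real_vector) \<Rightarrow> ('z \<Rightarrow> 'b) \<Rightarrow> real"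
  assumes V: "function_space V" "set fs \<subseteq> V"
    and B_sym: "\<And>f g. f \<in> V \<Longrightarrow> g \<in> V \<Longrightarrow> B f g = B g f"
    and B_lin: "\<And>f g h t. f \<in> V \<Longrightarrow> g \<in> V \<Longrightarrow> h \<in> V \<Longrightarrow> B (\<lambda>z. t *\<^sub>R f z + g z) h = t * B f h + B g h"
    and B_pos: "\<And>f. f \<in> V \<Longrightarrow> B f f = 0 \<Longrightarrow> f = (\<lambda>z. 0)"
    and l: "\<And>f g t. f \<in> V \<Longrightarrow> g \<in> V \<Longrightarrow> l (\<lambda>z. t *\<^sub>R f z + g z) = t * l f + l g"
  shows "\<exists>G\<in>fspan fs. \<forall>q\<in>fspan fs. B G q = l q"
  using V(2) l
proof (induction fs arbitrary: l)
  case Nil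
  \<comment> \<open>The linearity equation with \<open>t = 1\<close> at the zero function says that
    the value there equals twice itself.\<close>
  have "l (\<lambda>z. 0) = 1 * l (\<lambda>z. 0) + l (\<lambda>z. 0)"
    using Nil(2)[OF function_space_0 function_space_0, OF V(1) V(1), of 1] by simp
  moreover have "B (\<lambda>z. 0) (\<lambda>z. 0) = 1 * B (\<lambda>z. 0) (\<lambda>z. 0) + B (\<lambda>z. 0) (\<lambda>z. 0)"
    using B_lin[OF function_space_0 function_space_0 function_space_0, OF V(1) V(1) V(1), of 1] by simp
  ultimately show ?case by simp
next
  case (Cons f fs)
  let ?W = "fspan fs"
  have WV: "?W \<subseteq> V" using fspan_least[OF V(1)] Cons.prems(1) by auto
  have fV: "f \<in> V" using Cons.prems(1) by auto
  obtain G where G: "G \<in> ?W" "\<And>q. q \<in> ?W \<Longrightarrow> B G q = l q"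
    using Cons.IH[of l] Cons.prems by auto
  \<comment> \<open>The representative \<open>P\<close> of the functional \<open>B f\<close> is the
    orthogonal projection of \<open>f\<close> onto the old span.\<close>
  have "\<exists>P\<in>?W. \<forall>q\<in>?W. B P q = B f q"
  proof (rule Cons.IH)
    show "B f (\<lambda>z. t *\<^sub>R g z + h z) = t * B f g + B f h" if "g \<in> V" "h \<in> V" for g h t
      using B_lin[OF that fV] B_sym[OF fV] that function_space_add[OF V(1) function_space_scale[OF V(1)]] by simp
  qed (use Cons.prems in auto)
  then obtain P where P: "P \<in> ?W" "\<And>q. q \<in> ?W \<Longrightarrow> B P q = B f q" by blast
  define f' where "f' = (\<lambda>z. (-1) *\<^sub>R P z + f z)"
  have f'V: "f' \<in> V"
    unfolding f'_def using P WV fV by (intro function_space_add[OF V(1)] function_space_scale[OF V(1)]) auto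
  have orth: "B f' q = 0" if "q \<in> ?W" for q
    using B_lin[of P f q "-1"] P that WV fV by (auto simp: f'_def)
  have f_eq: "f = (\<lambda>z. f' z + P z)" by (simp add: f'_def)
  have span: "fspan (f # fs) = {(\<lambda>z. t *\<^sub>R f' z + g z) | t g. g \<in> ?W}"
  proof safe
    fix h assume "h \<in> fspan (f # fs)"
    then obtain t g where h: "h = (\<lambda>z. t *\<^sub>R f z + g z)" "g \<in> ?W" by auto
    then have "h = (\<lambda>z. t *\<^sub>R f' z + (t *\<^sub>R P z + g z))" by (simp add: f_eq algebra_simps)
    moreover have "(\<lambda>z. t *\<^sub>R P z + g z) \<in> ?W"
      by (intro function_space_add function_space_scale function_space_fspan P h)
    ultimately show "\<exists>t g. h = (\<lambda>z. t *\<^sub>R f' z + g z) \<and> g \<in> ?W"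
      by (intro exI[of _ t] exI[of _ "\<lambda>z. t *\<^sub>R P z + g z"] conjI)
  next
    fix t g assume g: "g \<in> ?W"
    have "(\<lambda>z. t *\<^sub>R f' z + g z) = (\<lambda>z. t *\<^sub>R f z + ((- t) *\<^sub>R P z + g z))" by (simp add: f'_def algebra_simps)
    moreover have "(\<lambda>z. (- t) *\<^sub>R P z + g z) \<in> ?W"
      by (intro function_space_add function_space_scale function_space_fspan P g)
    ultimately show "(\<lambda>z. t *\<^sub>R f' z + g z) \<in> fspan (f # fs)" by auto
  qed
  \<comment> \<open>If \<open>B f' f'\<close> is 0, then \<open>f'\<close> is the zero function and
    \<open>l f'\<close> is 0 too, so any value would do; this is the case of a dependent
    generator.\<close>
  define k where "k = (if B f' f' = 0 then 0 else l f' / B f' f')"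
  have k: "k * B f' f' = l f'"
  proof (cases "B f' f' = 0")
    case True
    then have "f' = (\<lambda>z. 0)" using B_pos f'V by blast
    then have "l f' = 1 * l f' + l f'"
      using Cons.prems(2)[OF f'V f'V, of 1] by simp
    then show ?thesis using True by simp
  qed (simp add: k_def)
  have GV: "G \<in> V" using G WV by auto
  have "B (\<lambda>z. k *\<^sub>R f' z + G z) (\<lambda>z. t *\<^sub>R f' z + g z) = l (\<lambda>z. t *\<^sub>R f' z + g z)" if g: "g \<in> ?W" for t g
  proof -
    have gV: "g \<in> V" using g WV by auto
    let ?q = "\<lambda>z. t *\<^sub>R f' z + g z"
    have qV: "?q \<in> V" by (intro function_space_add function_space_scale V f'V gV)
    have "B (\<lambda>z. k *\<^sub>R f' z + G z) ?q = k * B f' ?q + B G ?q"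
      by (rule B_lin[OF f'V GV qV])
    also have "B f' ?q = t * B f' f' + B f' g"
      using B_lin[OF f'V gV f'V, of t] B_sym[OF f'V qV] B_sym[OF f'V gV] by simp
    also have "B G ?q = t * B f' G + B G g"
      using B_lin[OF f'V gV GV, of t] B_sym[OF GV qV] B_sym[OF GV gV] by simp
    also have "k * (t * B f' f' + B f' g) + (t * B f' G + B G g) = t * (k * B f' f') + l g"
      using orth[OF g] orth[OF G(1)] G(2)[OF g] by simp
    also have "\<dots> = l ?q" using Cons.prems(2)[OF f'V gV, of t] by (simp add: k)
    finally show ?thesis .
  qed
  moreover have "(\<lambda>z. k *\<^sub>R f' z + G z) \<in> fspan (f # fs)"
    unfolding span using G(1) by blast
  ultimately show ?case unfolding span by blast
qed

text \<open>Elements of \<open>V\<close> are functions on the whole space, but the integral sees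
  only the box. The hypothesis that an element vanishing on the box is the zero function makes the
  form definite on \<open>V\<close> and the solution unique as a function, as the definite
  descriptions require. Existence is \<open>riesz_fspan\<close>.\<close>

lemma L2_projection_exists_unique:
  fixes V :: "('a::euclidean_space \<Rightarrow> 'b::euclidean_space) set"
  assumes V: "finite_dim V" and cont: "\<And>f. f \<in> V \<Longrightarrow> continuous_on (cbox a b) f"
    and zero: "\<And>f. f \<in> V \<Longrightarrow> (\<And>z. z \<in> cbox a b \<Longrightarrow> f z = 0) \<Longrightarrow> f = (\<lambda>z. 0)"
    and ab: "box a b \<noteq> {}"
    and l: "\<And>f g t. f \<in> V \<Longrightarrow> g \<in> V \<Longrightarrow> l (\<lambda>z. t *\<^sub>R f z + g z) = t * l f + l g"
  shows "\<exists>!G. G \<in> V \<and> (\<forall>q\<in>V. lint (cbox a b) (\<lambda>z. G z \<bullet> q z) = l q)"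
proof -
  define B where "B f g = lint (cbox a b) (\<lambda>z. f z \<bullet> g z)" for f g :: "'a \<Rightarrow> 'b"
  have fsV: "function_space V" using V by (rule finite_dim_function_space)
  obtain fs where fs: "V = fspan fs" using V by (auto simp: finite_dim_def)
  have int: "integrable (lebesgue_on (cbox a b)) (\<lambda>z. f z \<bullet> g z)" if "f \<in> V" "g \<in> V" for f g
    using cont that by (intro continuous_imp_integrable continuous_intros)
  have B_sym: "B f g = B g f" for f g by (simp add: B_def inner_commute)
  have B_lin: "B (\<lambda>z. t *\<^sub>R f z + g z) h = t * B f h + B g h" if "f \<in> V" "g \<in> V" "h \<in> V" for f g h t
    using int that by (simp add: B_def inner_left_distrib)
  have B_pos: "f = (\<lambda>z. 0)" if f: "f \<in> V" "B f f = 0" for f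
  proof (rule zero[OF f(1)])
    fix z assume z: "z \<in> cbox a b"
    have c: "continuous_on (cbox a b) (\<lambda>z. f z \<bullet> f z)"
      using cont f by (intro continuous_intros)
    have "((\<lambda>z. f z \<bullet> f z) has_integral 0) (cbox a b)"
      using f(2) integral_continuous_lebesgue_on[OF c] integrable_integral[OF integrable_continuous[OF c]]
      by (simp add: B_def)
    then have "f z \<bullet> f z = 0"
      using c z ab by (intro has_integral_0_cbox_imp_0[OF c]) auto
    then show "f z = 0" by simp
  qed
  have "\<exists>G\<in>fspan fs. \<forall>q\<in>fspan fs. B G q = l q"
    using fspan_base fs by (intro riesz_fspan[OF fsV _ B_sym B_lin B_pos l]) auto
  then obtain G where G: "G \<in> V" "\<And>q. q \<in> V \<Longrightarrow> B G q = l q" using fs by auto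
  show ?thesis
  proof (rule ex1I[of _ G])
    show "G \<in> V \<and> (\<forall>q\<in>V. lint (cbox a b) (\<lambda>z. G z \<bullet> q z) = l q)"
      using G by (simp add: B_def)
    fix H assume H: "H \<in> V \<and> (\<forall>q\<in>V. lint (cbox a b) (\<lambda>z. H z \<bullet> q z) = l q)"
    let ?D = "\<lambda>z. (-1) *\<^sub>R G z + H z"
    have D: "?D \<in> V" using H G by (intro function_space_add function_space_scale fsV) auto
    have "B ?D ?D = 0"
      using B_lin[of G H ?D "-1"] G(1) G(2)[OF D] H D by (simp add: B_def)
    then have "?D = (\<lambda>z. 0)" by (rule B_pos[OF D])
    show "H = G"
    proof
      fix z
      show "H z = G z" using fun_cong[OF \<open>?D = (\<lambda>z. 0)\<close>, of z] by simp
    qed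
  qed
qed

section \<open>Polynomial spaces\<close>

definition monomial :: "nat \<Rightarrow> nat \<Rightarrow> plane \<Rightarrow> real" where
  "monomial a b z = fst z ^ a * snd z ^ b"

lemma poly_P_iff: "p \<in> poly_P k \<longleftrightarrow> (\<exists>c. p = (\<lambda>z. \<Sum>a\<le>k. \<Sum>b\<le>k - a. c a b * monomial a b z))"
  by (simp add: poly_P_def monomial_def split_def mult.assoc)

lemma poly_Q_iff: "p \<in> poly_Q i k \<longleftrightarrow> (\<exists>c. p = (\<lambda>z. \<Sum>a\<le>i. \<Sum>b\<le>k. c a b * monomial a b z))"
  by (simp add: poly_Q_def monomial_def split_def mult.assoc)

lemma function_space_double_sum:
  "function_space {p. \<exists>c. p = (\<lambda>z. \<Sum>a\<le>i. \<Sum>b\<le>k a. c a b * monomial a b z)}"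
  unfolding function_space_def
proof (intro conjI ballI allI)
  show "(\<lambda>z. 0) \<in> {p. \<exists>c. p = (\<lambda>z. \<Sum>a\<le>i. \<Sum>b\<le>k a. c a b * monomial a b z)}"
    by (auto intro!: exI[of _ "\<lambda>a b. 0"])
  fix f g :: "plane \<Rightarrow> real" and t :: real
  assume "f \<in> {p. \<exists>c. p = (\<lambda>z. \<Sum>a\<le>i. \<Sum>b\<le>k a. c a b * monomial a b z)}"
  then obtain c where f: "f = (\<lambda>z. \<Sum>a\<le>i. \<Sum>b\<le>k a. c a b * monomial a b z)" by blast
  show "(\<lambda>z. t *\<^sub>R f z) \<in> {p. \<exists>c. p = (\<lambda>z. \<Sum>a\<le>i. \<Sum>b\<le>k a. c a b * monomial a b z)}"
    unfolding f by (auto intro!: exI[of _ "\<lambda>a b. t * c a b"] simp: sum_distrib_left mult.assoc)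
  assume "g \<in> {p. \<exists>c. p = (\<lambda>z. \<Sum>a\<le>i. \<Sum>b\<le>k a. c a b * monomial a b z)}"
  then obtain c' where g: "g = (\<lambda>z. \<Sum>a\<le>i. \<Sum>b\<le>k a. c' a b * monomial a b z)" by blast
  show "(\<lambda>z. f z + g z) \<in> {p. \<exists>c. p = (\<lambda>z. \<Sum>a\<le>i. \<Sum>b\<le>k a. c a b * monomial a b z)}"
    unfolding f g by (auto intro!: exI[of _ "\<lambda>a b. c a b + c' a b"] simp: sum.distrib distrib_right)
qed

lemma function_space_poly_P: "function_space (poly_P k)"
proof -
  have "poly_P k = {p. \<exists>c. p = (\<lambda>z. \<Sum>a\<le>k. \<Sum>b\<le>k - a. c a b * monomial a b z)}"
    using poly_P_iff by blast
  then show ?thesis using function_space_double_sum[where i=k and k="\<lambda>a. k - a"] by simp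
qed

lemma function_space_poly_Q: "function_space (poly_Q i k)"
proof -
  have "poly_Q i k = {p. \<exists>c. p = (\<lambda>z. \<Sum>a\<le>i. \<Sum>b\<le>k. c a b * monomial a b z)}"
    using poly_Q_iff by blast
  then show ?thesis using function_space_double_sum[where i=i and k="\<lambda>a. k"] by simp
qed

lemma monomial_double_sum:
  assumes "a \<le> i" "b \<le> k a"
  shows "monomial a b = (\<lambda>z. \<Sum>a'\<le>i. \<Sum>b'\<le>k a'. (if a' = a \<and> b' = b then 1 else 0) * monomial a' b' z)"
proof
  fix z
  have "(\<Sum>a'\<le>i. \<Sum>b'\<le>k a'. (if a' = a \<and> b' = b then 1 else 0) * monomial a' b' z)
      = (\<Sum>a'\<le>i. if a' = a then monomial a b z else 0)"
  proof (rule sum.cong[OF refl])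
    fix a' assume "a' \<in> {..i}"
    show "(\<Sum>b'\<le>k a'. (if a' = a \<and> b' = b then 1 else 0) * monomial a' b' z)
        = (if a' = a then monomial a b z else 0)"
    proof (cases "a' = a")
      case True
      have "(\<Sum>b'\<le>k a. (if b' = b then 1 else 0) * monomial a b' z) = (\<Sum>b'\<le>k a. if b' = b then monomial a b z else 0)"
        by (intro sum.cong) auto
      then show ?thesis using True assms by simp
    qed simp
  qed
  then show "monomial a b z = (\<Sum>a'\<le>i. \<Sum>b'\<le>k a'. (if a' = a \<and> b' = b then 1 else 0) * monomial a' b' z)"
    using assms by simp
qed

lemma monomial_poly_P: "a + b \<le> k \<Longrightarrow> monomial a b \<in> poly_P k"
  unfolding poly_P_iff using monomial_double_sum[of a k b "\<lambda>a. k - a"]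
  by (intro exI[of _ "\<lambda>a' b'. if a' = a \<and> b' = b then 1 else 0"]) auto

lemma monomial_poly_Q: "a \<le> i \<Longrightarrow> b \<le> k \<Longrightarrow> monomial a b \<in> poly_Q i k"
  unfolding poly_Q_iff using monomial_double_sum[of a i b "\<lambda>a. k"]
  by (intro exI[of _ "\<lambda>a' b'. if a' = a \<and> b' = b then 1 else 0"]) auto

text \<open>Membership of a whole polynomial space in another function space reduces to its
  monomials; the inclusions, the degree bounds and the bounds for derivatives are all obtained in
  this way.\<close>

lemma poly_P_induct [consumes 2]:
  assumes "function_space V" "p \<in> poly_P k" "\<And>a b. a + b \<le> k \<Longrightarrow> monomial a b \<in> V"
  shows "p \<in> V"
proof -
  obtain c where p: "p = (\<lambda>z. \<Sum>a\<le>k. \<Sum>b\<le>k - a. c a b * monomial a b z)"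
    using assms(2) poly_P_iff by blast
  show ?thesis unfolding p
    by (intro function_space_sum[OF assms(1)] function_space_cmult[OF assms(1)]) (use assms(3) in auto)
qed

lemma poly_Q_induct [consumes 2]:
  assumes "function_space V" "p \<in> poly_Q i k" "\<And>a b. a \<le> i \<Longrightarrow> b \<le> k \<Longrightarrow> monomial a b \<in> V"
  shows "p \<in> V"
proof -
  obtain c where p: "p = (\<lambda>z. \<Sum>a\<le>i. \<Sum>b\<le>k. c a b * monomial a b z)"
    using assms(2) poly_Q_iff by blast
  show ?thesis unfolding p
    by (intro function_space_sum[OF assms(1)] function_space_cmult[OF assms(1)]) (use assms(3) in auto)
qed

lemma poly_P_subset_poly_Q: "poly_P k \<subseteq> poly_Q k k"
  using poly_P_induct[OF function_space_poly_Q] monomial_poly_Q by (metis add_leE subsetI)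

lemma poly_P_mono: "k \<le> k' \<Longrightarrow> poly_P k \<subseteq> poly_P k'"
  using poly_P_induct[OF function_space_poly_P] monomial_poly_P by (meson order_trans subsetI)

lemma poly_Q_mono: "i \<le> i' \<Longrightarrow> k \<le> k' \<Longrightarrow> poly_Q i k \<subseteq> poly_Q i' k'"
  using poly_Q_induct[OF function_space_poly_Q] monomial_poly_Q by (meson order_trans subsetI)

lemma finite_dim_monomial_span:
  assumes V: "function_space V" and S: "S \<subseteq> {(a, b). a \<le> k \<and> b \<le> k}"
    and sub: "\<And>a b. (a, b) \<in> S \<Longrightarrow> monomial a b \<in> V"
    and ind: "\<And>W. function_space W \<Longrightarrow> (\<And>a b. (a, b) \<in> S \<Longrightarrow> monomial a b \<in> W) \<Longrightarrow> V \<subseteq> W"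
  shows "finite_dim V"
proof -
  have "finite ((\<lambda>(a, b). monomial a b) ` S)"
    using S by (intro finite_imageI) (rule finite_subset[of _ "{..k} \<times> {..k}"], auto)
  then obtain fs where fs: "set fs = (\<lambda>(a, b). monomial a b) ` S"
    using finite_list by blast
  have "monomial a b \<in> fspan fs" if "(a, b) \<in> S" for a b
    using that fs by (intro fspan_base) force
  then show ?thesis
    using sub fs by (intro finite_dimI[OF V _ ind[OF function_space_fspan]]) auto
qed

lemma finite_dim_poly_P: "finite_dim (poly_P k)"
  by (rule finite_dim_monomial_span[OF function_space_poly_P, where S="{(a, b). a + b \<le> k}" and k=k])
    (auto intro: monomial_poly_P poly_P_induct)

lemma finite_dim_poly_Q: "finite_dim (poly_Q i k)"
  by (rule finite_dim_monomial_span[OF function_space_poly_Q, where S="{..i} \<times> {..k}" and k="max i k"])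
    (auto intro: monomial_poly_Q poly_Q_induct)

lemma function_space_range_poly2: "function_space (range poly2)"
  unfolding function_space_def
proof (intro conjI ballI allI)
  have "poly2 [] = (\<lambda>z. 0)" by (rule ext) simp
  then show "(\<lambda>z. 0) \<in> range poly2" by (metis rangeI)
  fix f g :: "plane \<Rightarrow> real" and t :: real
  assume "f \<in> range poly2"
  then obtain L where L: "f = poly2 L" by blast
  have "poly2 (map (\<lambda>(r, s). (smult t r, s)) L) = (\<lambda>z. t *\<^sub>R f z)"
    unfolding L by (induction L) (auto simp: fun_eq_iff tensor_def algebra_simps)
  then show "(\<lambda>z. t *\<^sub>R f z) \<in> range poly2" by (metis rangeI)
  assume "g \<in> range poly2"
  then obtain L' where L': "g = poly2 L'" by blast
  have "poly2 (L @ L') = (\<lambda>z. f z + g z)" by (auto simp: L L')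
  then show "(\<lambda>z. f z + g z) \<in> range poly2" by (metis rangeI)
qed

lemma tensor_range_poly2: "tensor (poly r) (poly s) \<in> range poly2"
proof -
  have "poly2 [(r, s)] = tensor (poly r) (poly s)" by auto
  then show ?thesis by (metis rangeI)
qed

lemma monomial_tensor: "monomial a b = tensor (poly (monom 1 a)) (poly (monom 1 b))"
  by (auto simp: monomial_def tensor_def poly_monom)

lemma monomial_range_poly2: "monomial a b \<in> range poly2"
  unfolding monomial_tensor by (rule tensor_range_poly2)

lemma poly_P_range_poly2: "poly_P k \<subseteq> range poly2"
  using poly_P_induct[OF function_space_range_poly2] monomial_range_poly2 by blast

lemma poly_Q_range_poly2: "poly_Q i k \<subseteq> range poly2"
  using poly_Q_induct[OF function_space_range_poly2] monomial_range_poly2 by blast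

lemma poly2_section_x: "poly2 L (x, y) = poly (\<Sum>(r, s)\<leftarrow>L. smult (poly s y) r) x"
  by (induction L) (auto simp: tensor_def)

lemma poly2_section_y: "poly2 L (x, y) = poly (\<Sum>(r, s)\<leftarrow>L. smult (poly r x) s) y"
  by (induction L) (auto simp: tensor_def)

lemma poly_zero_on_interval:
  fixes r :: "real poly"
  assumes "a < b" "\<And>x. x \<in> {a..b} \<Longrightarrow> poly r x = 0"
  shows "r = 0"
proof (rule ccontr)
  assume "r \<noteq> 0"
  then have "finite {x. poly r x = 0}" by (rule poly_roots_finite)
  moreover have "{a..b} \<subseteq> {x. poly r x = 0}" using assms(2) by auto
  ultimately show False using assms(1) infinite_Icc finite_subset by blast
qed

text \<open>The one-variable identity theorem is applied twice: along horizontal lines that meet the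
  rectangle, then along every vertical line, where the first step has provided an interval of
  zeros.\<close>

lemma poly2_zero_on_rectangle:
  assumes "a < b" "c < d" "\<And>z. z \<in> cbox (a, c) (b, d) \<Longrightarrow> poly2 L z = 0"
  shows "poly2 L = (\<lambda>z. 0)"
proof
  fix z :: plane
  obtain x y where z: "z = (x, y)" by force
  have "poly2 L (x, y') = 0" if "y' \<in> {c..d}" for x y'
    unfolding poly2_section_x
    using that assms by (subst poly_zero_on_interval[OF assms(1)]) (auto simp: poly2_section_x[symmetric])
  then show "poly2 L z = 0"
    unfolding z poly2_section_y
    by (subst poly_zero_on_interval[OF assms(2)]) (auto simp: poly2_section_y[symmetric])
qed

section \<open>Partial derivatives of two-variable polynomials\<close>

definition dx_list :: "(real poly \<times> real poly) list \<Rightarrow> (real poly \<times> real poly) list" where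
  "dx_list = map (\<lambda>(r, s). (pderiv r, s))"

definition dy_list :: "(real poly \<times> real poly) list \<Rightarrow> (real poly \<times> real poly) list" where
  "dy_list = map (\<lambda>(r, s). (r, pderiv s))"

lemma poly2_DERIV_x: "((\<lambda>x. poly2 L (x, y)) has_real_derivative poly2 (dx_list L) (x, y)) (at x)"
  unfolding dx_list_def
  by (induction L) (auto simp: tensor_def intro!: derivative_eq_intros)

lemma poly2_DERIV_y: "((\<lambda>y. poly2 L (x, y)) has_real_derivative poly2 (dy_list L) (x, y)) (at y)"
  unfolding dy_list_def
  by (induction L) (auto simp: tensor_def intro!: derivative_eq_intros)

lemma pdx_poly2: "pdx (poly2 L) = poly2 (dx_list L)"
  unfolding pdx_def by (rule ext, rule DERIV_imp_deriv) (use poly2_DERIV_x in auto)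

lemma pdy_poly2: "pdy (poly2 L) = poly2 (dy_list L)"
  unfolding pdy_def by (rule ext, rule DERIV_imp_deriv) (use poly2_DERIV_y in auto)

text \<open>\<open>pdx\<close> is additive only where derivatives exist, hence the restriction to
  \<open>range poly2\<close>. Being a function space, the preimage can be fed to the monomial
  inductions, so degree bounds for derivatives need checking on monomials only.\<close>

lemma function_space_vimage_pdx:
  assumes "function_space V"
  shows "function_space {f \<in> range poly2. pdx f \<in> V}"
proof -
  have add: "pdx (\<lambda>z. poly2 L z + poly2 L' z) = (\<lambda>z. pdx (poly2 L) z + pdx (poly2 L') z)" for L L'
    unfolding pdx_poly2 unfolding pdx_def
    by (rule ext, rule DERIV_imp_deriv) (use poly2_DERIV_x in \<open>auto intro!: DERIV_add\<close>)
  have scale: "pdx (\<lambda>z. t *\<^sub>R poly2 L z) = (\<lambda>z. t *\<^sub>R pdx (poly2 L) z)" for L t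
    unfolding pdx_poly2 unfolding pdx_def real_scaleR_def
    by (rule ext, rule DERIV_imp_deriv) (use poly2_DERIV_x in \<open>auto intro!: DERIV_cmult\<close>)
  have z: "pdx (\<lambda>z. 0) = (\<lambda>z. 0)" by (simp add: pdx_def fun_eq_iff)
  note R = function_space_range_poly2
  show ?thesis
    unfolding function_space_def
    using function_space_0[OF R] function_space_0[OF assms] z
      function_space_add[OF R] function_space_scale[OF R]
      function_space_add[OF assms] function_space_scale[OF assms]
    by (auto simp: add scale[simplified])
qed

lemma function_space_vimage_pdy:
  assumes "function_space V"
  shows "function_space {f \<in> range poly2. pdy f \<in> V}"
proof -
  have add: "pdy (\<lambda>z. poly2 L z + poly2 L' z) = (\<lambda>z. pdy (poly2 L) z + pdy (poly2 L') z)" for L L'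
    unfolding pdy_poly2 unfolding pdy_def
    by (rule ext, rule DERIV_imp_deriv) (use poly2_DERIV_y in \<open>auto intro!: DERIV_add\<close>)
  have scale: "pdy (\<lambda>z. t *\<^sub>R poly2 L z) = (\<lambda>z. t *\<^sub>R pdy (poly2 L) z)" for L t
    unfolding pdy_poly2 unfolding pdy_def real_scaleR_def
    by (rule ext, rule DERIV_imp_deriv) (use poly2_DERIV_y in \<open>auto intro!: DERIV_cmult\<close>)
  have z: "pdy (\<lambda>z. 0) = (\<lambda>z. 0)" by (simp add: pdy_def fun_eq_iff)
  note R = function_space_range_poly2
  show ?thesis
    unfolding function_space_def
    using function_space_0[OF R] function_space_0[OF assms] z
      function_space_add[OF R] function_space_scale[OF R]
      function_space_add[OF assms] function_space_scale[OF assms]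
    by (auto simp: add scale[simplified])
qed

text \<open>For \<open>a = 0\<close> the truncated subtraction is harmless because the coefficient
  vanishes.\<close>

lemma pdx_monomial: "pdx (monomial a b) = (\<lambda>z. real a * monomial (a - 1) b z)"
  unfolding pdx_def monomial_def
  by (rule ext, rule DERIV_imp_deriv) (auto intro!: derivative_eq_intros)

lemma pdy_monomial: "pdy (monomial a b) = (\<lambda>z. real b * monomial a (b - 1) z)"
  unfolding pdy_def monomial_def
  by (rule ext, rule DERIV_imp_deriv) (auto intro!: derivative_eq_intros)

lemma pdx_poly_P: "p \<in> poly_P (Suc k) \<Longrightarrow> pdx p \<in> poly_P k"
proof -
  have "pdx (monomial a b) \<in> poly_P k" if "a + b \<le> Suc k" for a b
    using function_space_cmult[OF function_space_poly_P monomial_poly_P, of "a - 1" b k "real a"]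
      function_space_0[OF function_space_poly_P] that
    by (cases a) (auto simp: pdx_monomial)
  then show "p \<in> poly_P (Suc k) \<Longrightarrow> pdx p \<in> poly_P k"
    using poly_P_induct[OF function_space_vimage_pdx[OF function_space_poly_P]] monomial_range_poly2 by blast
qed

lemma pdy_poly_P: "p \<in> poly_P (Suc k) \<Longrightarrow> pdy p \<in> poly_P k"
proof -
  have "pdy (monomial a b) \<in> poly_P k" if "a + b \<le> Suc k" for a b
    using function_space_cmult[OF function_space_poly_P monomial_poly_P, of a "b - 1" k "real b"]
      function_space_0[OF function_space_poly_P] that
    by (cases b) (auto simp: pdy_monomial)
  then show "p \<in> poly_P (Suc k) \<Longrightarrow> pdy p \<in> poly_P k"
    using poly_P_induct[OF function_space_vimage_pdy[OF function_space_poly_P]] monomial_range_poly2 by blast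
qed

lemma pdx_poly_Q: "p \<in> poly_Q (Suc i) k \<Longrightarrow> pdx p \<in> poly_Q i k"
proof -
  have "pdx (monomial a b) \<in> poly_Q i k" if "a \<le> Suc i" "b \<le> k" for a b
    using function_space_cmult[OF function_space_poly_Q monomial_poly_Q, of "a - 1" i b k "real a"] that
    by (auto simp: pdx_monomial)
  then show "p \<in> poly_Q (Suc i) k \<Longrightarrow> pdx p \<in> poly_Q i k"
    using poly_Q_induct[OF function_space_vimage_pdx[OF function_space_poly_Q]] monomial_range_poly2 by blast
qed

lemma pdy_poly_Q: "p \<in> poly_Q i (Suc k) \<Longrightarrow> pdy p \<in> poly_Q i k"
proof -
  have "pdy (monomial a b) \<in> poly_Q i k" if "a \<le> i" "b \<le> Suc k" for a b
    using function_space_cmult[OF function_space_poly_Q monomial_poly_Q, of a i "b - 1" k "real b"] that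
    by (auto simp: pdy_monomial)
  then show "p \<in> poly_Q i (Suc k) \<Longrightarrow> pdy p \<in> poly_Q i k"
    using poly_Q_induct[OF function_space_vimage_pdy[OF function_space_poly_Q]] monomial_range_poly2 by blast
qed

section \<open>Gradient spaces and edge polynomials\<close>

definition pair_space :: "(plane \<Rightarrow> real) set \<Rightarrow> (plane \<Rightarrow> real) set \<Rightarrow> (plane \<Rightarrow> plane) set" where
  "pair_space P Q = {(\<lambda>z. (p z, q z)) | p q. p \<in> P \<and> q \<in> Q}"

lemma pair_spaceI: "p \<in> P \<Longrightarrow> q \<in> Q \<Longrightarrow> (\<lambda>z. (p z, q z)) \<in> pair_space P Q"
  unfolding pair_space_def by blast

lemma finite_dim_pair_space:
  assumes "finite_dim P" "finite_dim Q"
  shows "finite_dim (pair_space P Q)"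
proof -
  obtain fs gs where fs: "P = fspan fs" and gs: "Q = fspan gs"
    using assms by (auto simp: finite_dim_def)
  let ?hs = "map (\<lambda>f z. (f z, 0)) fs @ map (\<lambda>g z. (0, g z)) gs :: (plane \<Rightarrow> plane) list"
  note P = finite_dim_function_space[OF assms(1)] and Q = finite_dim_function_space[OF assms(2)]
  have "function_space (pair_space P Q)"
    unfolding function_space_def pair_space_def
  proof (intro conjI ballI allI)
    show "(\<lambda>z. 0) \<in> {(\<lambda>z. (p z, q z)) | p q. p \<in> P \<and> q \<in> Q}"
      using function_space_0[OF P] function_space_0[OF Q] by (force simp: zero_prod_def)
    fix f g and k :: real assume "f \<in> {(\<lambda>z. (p z, q z)) | p q. p \<in> P \<and> q \<in> Q}"
    then obtain p q where f: "f = (\<lambda>z. (p z, q z))" "p \<in> P" "q \<in> Q" by blast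
    then show "(\<lambda>z. k *\<^sub>R f z) \<in> {(\<lambda>z. (p z, q z)) | p q. p \<in> P \<and> q \<in> Q}"
      using function_space_scale[OF P f(2), of k] function_space_scale[OF Q f(3), of k] by auto
    assume "g \<in> {(\<lambda>z. (p z, q z)) | p q. p \<in> P \<and> q \<in> Q}"
    then obtain p' q' where g: "g = (\<lambda>z. (p' z, q' z))" "p' \<in> P" "q' \<in> Q" by blast
    then show "(\<lambda>z. f z + g z) \<in> {(\<lambda>z. (p z, q z)) | p q. p \<in> P \<and> q \<in> Q}"
      using function_space_add[OF P f(2) g(2)] function_space_add[OF Q f(3) g(3)] f(1) by auto
  qed
  moreover have "set ?hs \<subseteq> pair_space P Q"
    using pair_spaceI[OF _ function_space_0[OF Q]] pair_spaceI[OF function_space_0[OF P]]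
    by (auto simp: fs gs fspan_base)
  moreover have "pair_space P Q \<subseteq> fspan ?hs"
  proof
    fix h assume "h \<in> pair_space P Q"
    then obtain p q where h: "h = (\<lambda>z. (p z, q z))" "p \<in> fspan fs" "q \<in> fspan gs"
      by (auto simp: pair_space_def fs gs)
    have "linear (\<lambda>t::real. (t, 0::real))" "linear (\<lambda>t::real. (0::real, t))"
      by (auto intro!: linearI)
    then have "(\<lambda>z. (p z, 0)) \<in> fspan ?hs" "(\<lambda>z. (0, q z)) \<in> fspan ?hs"
      using fspan_linear_image[OF _ h(2)] fspan_linear_image[OF _ h(3)]
        fspan_mono[of "map (\<lambda>f z. (f z, 0)) fs" ?hs] fspan_mono[of "map (\<lambda>g z. (0, g z)) gs" ?hs] by auto
    then have "(\<lambda>z. (p z, 0) + (0, q z)) \<in> fspan ?hs"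
      by (rule function_space_add[OF function_space_fspan])
    then show "h \<in> fspan ?hs" by (simp add: h)
  qed
  ultimately show ?thesis by (rule finite_dimI)
qed

lemma monomial_DERIV_x:
  "((\<lambda>x. monomial a b (x, y)) has_real_derivative real a * monomial (a - 1) b (x, y)) (at x)"
  unfolding monomial_def by (auto intro!: derivative_eq_intros)

lemma monomial_DERIV_y:
  "((\<lambda>y. monomial a b (x, y)) has_real_derivative real b * monomial a (b - 1) (x, y)) (at y)"
  unfolding monomial_def by (auto intro!: derivative_eq_intros)

lemma finite_dim_extend:
  assumes "finite_dim V"
  shows "finite_dim {(\<lambda>z. v z + s *\<^sub>R f z) | v s. v \<in> V}"
proof -
  obtain fs where "V = fspan fs" using assms by (auto simp: finite_dim_def)
  then have "{(\<lambda>z. v z + s *\<^sub>R f z) | v s. v \<in> V} = fspan (f # fs)"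
    by (auto simp: add.commute)
  then show ?thesis unfolding finite_dim_def by blast
qed

lemma curl_monomials:
  "curl2 (\<lambda>(x, y). x ^ (k + 1) * y) = (\<lambda>z. (- monomial (k + 1) 0 z, real (k + 1) * monomial k 1 z))"
  "curl2 (\<lambda>(x, y). x * y ^ (k + 1)) = (\<lambda>z. (- (real (k + 1) * monomial 1 k z), monomial 0 (k + 1) z))"
proof -
  have "(\<lambda>(x, y). x ^ (k + 1) * y) = monomial (k + 1) 1" "(\<lambda>(x, y). x * y ^ (k + 1)) = monomial 1 (k + 1)"
    by (auto simp: monomial_def)
  then show "curl2 (\<lambda>(x, y). x ^ (k + 1) * y) = (\<lambda>z. (- monomial (k + 1) 0 z, real (k + 1) * monomial k 1 z))"
    "curl2 (\<lambda>(x, y). x * y ^ (k + 1)) = (\<lambda>z. (- (real (k + 1) * monomial 1 k z), monomial 0 (k + 1) z))"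
    by (simp_all add: curl2_def[abs_def] pdx_monomial pdy_monomial)
qed

lemma RT_eq: "RT j = pair_space (poly_Q (j + 1) j) (poly_Q j (j + 1))"
  by (simp add: RT_def pair_space_def)

text \<open>Two successive extensions of \<open>pair_space\<close> by a single generator, the shape
  to which \<open>finite_dim_extend\<close> applies.\<close>

lemma BDM_eq:
  "BDM k = {(\<lambda>z. v z + t *\<^sub>R curl2 (\<lambda>(x, y). x * y ^ (k + 1)) z) | v t.
     v \<in> {(\<lambda>z. v z + s *\<^sub>R curl2 (\<lambda>(x, y). x ^ (k + 1) * y) z) | v s. v \<in> pair_space (poly_P k) (poly_P k)}}"
proof (intro set_eqI iffI)
  fix g assume "g \<in> BDM k"
  then obtain p q s t where "p \<in> poly_P k" "q \<in> poly_P k" and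
    g: "g = (\<lambda>z. ((p z, q z) + s *\<^sub>R curl2 (\<lambda>(x, y). x ^ (k + 1) * y) z) + t *\<^sub>R curl2 (\<lambda>(x, y). x * y ^ (k + 1)) z)"
    unfolding BDM_def by blast
  then have "(\<lambda>z. (p z, q z)) \<in> pair_space (poly_P k) (poly_P k)" by (intro pair_spaceI)
  then have "(\<lambda>z. (p z, q z) + s *\<^sub>R curl2 (\<lambda>(x, y). x ^ (k + 1) * y) z)
    \<in> {(\<lambda>z. v z + s *\<^sub>R curl2 (\<lambda>(x, y). x ^ (k + 1) * y) z) | v s. v \<in> pair_space (poly_P k) (poly_P k)}"
    by (intro CollectI exI[of _ "\<lambda>z. (p z, q z)"] exI[of _ s] conjI refl)
  then show "g \<in> {(\<lambda>z. v z + t *\<^sub>R curl2 (\<lambda>(x, y). x * y ^ (k + 1)) z) | v t.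
     v \<in> {(\<lambda>z. v z + s *\<^sub>R curl2 (\<lambda>(x, y). x ^ (k + 1) * y) z) | v s. v \<in> pair_space (poly_P k) (poly_P k)}}"
    unfolding g
    by - (rule CollectI, rule exI[of _ "\<lambda>z. (p z, q z) + s *\<^sub>R curl2 (\<lambda>(x, y). x ^ (k + 1) * y) z"],
        rule exI[of _ t], rule conjI[OF refl])
next
  fix g assume "g \<in> {(\<lambda>z. v z + t *\<^sub>R curl2 (\<lambda>(x, y). x * y ^ (k + 1)) z) | v t.
     v \<in> {(\<lambda>z. v z + s *\<^sub>R curl2 (\<lambda>(x, y). x ^ (k + 1) * y) z) | v s. v \<in> pair_space (poly_P k) (poly_P k)}}"
  then obtain v s t where g: "g = (\<lambda>z. (v z + s *\<^sub>R curl2 (\<lambda>(x, y). x ^ (k + 1) * y) z) + t *\<^sub>R curl2 (\<lambda>(x, y). x * y ^ (k + 1)) z)"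
    and "v \<in> pair_space (poly_P k) (poly_P k)" by blast
  then obtain p q where v: "v = (\<lambda>z. (p z, q z))" "p \<in> poly_P k" "q \<in> poly_P k"
    unfolding pair_space_def by blast
  show "g \<in> BDM k" unfolding BDM_def g v(1) using v(2,3) by blast
qed

lemma finite_dim_grad_space: "finite_dim (grad_space el j)"
  by (cases el) (simp_all only: grad_space.simps RT_eq BDM_eq finite_dim_extend finite_dim_pair_space
      finite_dim_poly_P finite_dim_poly_Q)

lemma finite_dim_interior_space: "finite_dim (interior_space el j)"
  by (cases el) (simp_all add: finite_dim_poly_P finite_dim_poly_Q)

lemma interior_space_range_poly2: "interior_space el j \<subseteq> range poly2"
  using poly_P_range_poly2 poly_Q_range_poly2 by (cases el) auto

text \<open>One polynomial for each horizontal line, with no control of its dependence on y: only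
  the behaviour along an edge is of interest, and the normal component on a horizontal edge is a
  function of x.\<close>

definition degree_x :: "nat \<Rightarrow> (plane \<Rightarrow> real) \<Rightarrow> bool" where
  "degree_x n f \<longleftrightarrow> (\<forall>y. \<exists>r. degree r \<le> n \<and> (\<forall>x. f (x, y) = poly r x))"

definition degree_y :: "nat \<Rightarrow> (plane \<Rightarrow> real) \<Rightarrow> bool" where
  "degree_y n f \<longleftrightarrow> (\<forall>x. \<exists>r. degree r \<le> n \<and> (\<forall>y. f (x, y) = poly r y))"

lemma function_space_degree_x: "function_space {f. degree_x n f}"
  unfolding function_space_def degree_x_def mem_Collect_eq
proof (intro conjI ballI allI)
  show "\<exists>r. degree r \<le> n \<and> (\<forall>x. 0 = poly r x)" by (rule exI[of _ 0]) simp
next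
  fix f g :: "plane \<Rightarrow> real" and y
  assume "f \<in> {f. \<forall>y. \<exists>r. degree r \<le> n \<and> (\<forall>x. f (x, y) = poly r x)}"
    "g \<in> {f. \<forall>y. \<exists>r. degree r \<le> n \<and> (\<forall>x. f (x, y) = poly r x)}"
  then obtain r s where "degree r \<le> n" "\<forall>x. f (x, y) = poly r x" "degree s \<le> n" "\<forall>x. g (x, y) = poly s x"
    by blast
  then show "\<exists>r. degree r \<le> n \<and> (\<forall>x. f (x, y) + g (x, y) = poly r x)"
    by (intro exI[of _ "r + s"]) (auto intro: degree_add_le)
next
  fix f :: "plane \<Rightarrow> real" and y k
  assume "f \<in> {f. \<forall>y. \<exists>r. degree r \<le> n \<and> (\<forall>x. f (x, y) = poly r x)}"
  then obtain r where "degree r \<le> n" "\<forall>x. f (x, y) = poly r x"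
    by blast
  then show "\<exists>r. degree r \<le> n \<and> (\<forall>x. k *\<^sub>R f (x, y) = poly r x)"
    by (intro exI[of _ "smult k r"]) (auto intro: order_trans[OF degree_smult_le])
qed

lemma function_space_degree_y: "function_space {f. degree_y n f}"
  unfolding function_space_def degree_y_def mem_Collect_eq
proof (intro conjI ballI allI)
  show "\<exists>r. degree r \<le> n \<and> (\<forall>y. 0 = poly r y)" by (rule exI[of _ 0]) simp
next
  fix f g :: "plane \<Rightarrow> real" and x
  assume "f \<in> {f. \<forall>x. \<exists>r. degree r \<le> n \<and> (\<forall>y. f (x, y) = poly r y)}"
    "g \<in> {f. \<forall>x. \<exists>r. degree r \<le> n \<and> (\<forall>y. f (x, y) = poly r y)}"
  then obtain r s where "degree r \<le> n" "\<forall>y. f (x, y) = poly r y" "degree s \<le> n" "\<forall>y. g (x, y) = poly s y"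
    by blast
  then show "\<exists>r. degree r \<le> n \<and> (\<forall>y. f (x, y) + g (x, y) = poly r y)"
    by (intro exI[of _ "r + s"]) (auto intro: degree_add_le)
next
  fix f :: "plane \<Rightarrow> real" and x k
  assume "f \<in> {f. \<forall>x. \<exists>r. degree r \<le> n \<and> (\<forall>y. f (x, y) = poly r y)}"
  then obtain r where "degree r \<le> n" "\<forall>y. f (x, y) = poly r y"
    by blast
  then show "\<exists>r. degree r \<le> n \<and> (\<forall>y. k *\<^sub>R f (x, y) = poly r y)"
    by (intro exI[of _ "smult k r"]) (auto intro: order_trans[OF degree_smult_le])
qed

lemma degree_x_monomial: "a \<le> n \<Longrightarrow> degree_x n (monomial a b)"
  unfolding degree_x_def
proof
  fix y :: real assume "a \<le> n"
  then show "\<exists>r. degree r \<le> n \<and> (\<forall>x. monomial a b (x, y) = poly r x)"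
    by (intro exI[of _ "monom (y ^ b) a"]) (auto simp: monomial_def poly_monom intro: order_trans[OF degree_monom_le])
qed

lemma degree_y_monomial: "b \<le> n \<Longrightarrow> degree_y n (monomial a b)"
  unfolding degree_y_def
proof
  fix x :: real assume "b \<le> n"
  then show "\<exists>r. degree r \<le> n \<and> (\<forall>y. monomial a b (x, y) = poly r y)"
    by (intro exI[of _ "monom (x ^ a) b"]) (auto simp: monomial_def poly_monom intro: order_trans[OF degree_monom_le])
qed

fun edge_degree :: "element_type \<Rightarrow> nat \<Rightarrow> nat" where
  "edge_degree QRT j = j"
| "edge_degree PBDM j = j + 1"

lemma edge_space_eq: "edge_space el j F = edge_poly (edge_degree el j) F"
  by (cases el) auto

lemma degree_x_poly_Q: "p \<in> poly_Q i k \<Longrightarrow> degree_x i p"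
  using poly_Q_induct[OF function_space_degree_x] degree_x_monomial by blast

lemma degree_y_poly_Q: "p \<in> poly_Q i k \<Longrightarrow> degree_y k p"
  using poly_Q_induct[OF function_space_degree_y] degree_y_monomial by blast

text \<open>Expanding the two curls into monomials exposes their degrees in each variable
  separately, which their total degree \<open>j + 2\<close> hides.\<close>

lemma grad_space_cases:
  assumes "q \<in> grad_space el j"
  obtains (RT) p1 p2 where "el = QRT" "q = (\<lambda>z. (p1 z, p2 z))" "p1 \<in> poly_Q (Suc j) j" "p2 \<in> poly_Q j (Suc j)"
  | (BDM) p1 p2 s t where "el = PBDM" "p1 \<in> poly_P (Suc j)" "p2 \<in> poly_P (Suc j)"
      "q = (\<lambda>z. (p1 z + (- s) * monomial (j + 2) 0 z + (- (t * real (j + 2))) * monomial 1 (j + 1) z,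
          p2 z + (s * real (j + 2)) * monomial (j + 1) 1 z + t * monomial 0 (j + 2) z))"
proof (cases el)
  case QRT
  then show ?thesis using assms RT by (auto simp: RT_def)
next
  case PBDM
  then have "q \<in> BDM (j + 1)" using assms by simp
  then show ?thesis
    unfolding BDM_def curl_monomials using BDM[OF PBDM] by (fastforce simp: algebra_simps fun_eq_iff)
qed

text \<open>The compatibility of the three local spaces. For BDM the added fields are curls, so they
  do not contribute to the divergence. Their first components contain only x^(j+2) and x y^(j+1), of
  degree at most \<open>j + 1\<close> in y, and symmetrically for the second components; so the
  normal components on vertical and horizontal edges stay in the edge space.\<close>

lemma grad_space_props:
  assumes q: "q \<in> grad_space el j"
  shows "(\<lambda>z. fst (q z)) \<in> range poly2" "(\<lambda>z. snd (q z)) \<in> range poly2"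
    "div2 q \<in> interior_space el j"
    "degree_y (edge_degree el j) (\<lambda>z. fst (q z))" "degree_x (edge_degree el j) (\<lambda>z. snd (q z))"
proof -
  have "(\<lambda>z. fst (q z)) \<in> range poly2 \<and> (\<lambda>z. snd (q z)) \<in> range poly2 \<and> div2 q \<in> interior_space el j
    \<and> degree_y (edge_degree el j) (\<lambda>z. fst (q z)) \<and> degree_x (edge_degree el j) (\<lambda>z. snd (q z))"
    using q
  proof (cases rule: grad_space_cases)
    case (RT p1 p2)
    have "(\<lambda>z. pdx p1 z + pdy p2 z) \<in> poly_Q j j"
      by (intro function_space_add function_space_poly_Q pdx_poly_Q pdy_poly_Q RT)
    then have "div2 q \<in> poly_Q j j" by (simp add: RT div2_def[abs_def])
    then show ?thesis
      using RT poly_Q_range_poly2 degree_x_poly_Q degree_y_poly_Q by auto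
  next
    case (BDM p1 p2 s t)
    note R = function_space_range_poly2 and M = monomial_range_poly2
    have p: "p1 \<in> range poly2" "p2 \<in> range poly2" using BDM poly_P_range_poly2 by auto
    obtain L1 L2 where L: "p1 = poly2 L1" "p2 = poly2 L2" using p by auto
    have "pdx (\<lambda>z. fst (q z)) = (\<lambda>z. pdx p1 z + (- s) * (real (j + 2) * monomial (j + 1) 0 z)
        + (- (t * real (j + 2))) * monomial 0 (j + 1) z)"
    proof
      fix z
      have "((\<lambda>x. p1 (x, snd z) + (- s) * monomial (j + 2) 0 (x, snd z) + (- (t * real (j + 2))) * monomial 1 (j + 1) (x, snd z))
          has_real_derivative (pdx p1 (fst z, snd z) + (- s) * (real (j + 2) * monomial (j + 2 - 1) 0 (fst z, snd z))
            + (- (t * real (j + 2))) * (real 1 * monomial (1 - 1) (j + 1) (fst z, snd z)))) (at (fst z))"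
        unfolding L pdx_poly2 by (intro DERIV_add DERIV_cmult monomial_DERIV_x poly2_DERIV_x)
      then show "pdx (\<lambda>z. fst (q z)) z = pdx p1 z + (- s) * (real (j + 2) * monomial (j + 1) 0 z)
        + (- (t * real (j + 2))) * monomial 0 (j + 1) z"
        by (simp only: pdx_def[of "\<lambda>z. fst (q z)"]) (simp add: BDM DERIV_imp_deriv)
    qed
    moreover have "pdy (\<lambda>z. snd (q z)) = (\<lambda>z. pdy p2 z + (s * real (j + 2)) * monomial (j + 1) 0 z
        + t * (real (j + 2) * monomial 0 (j + 1) z))"
    proof
      fix z
      have "((\<lambda>y. p2 (fst z, y) + (s * real (j + 2)) * monomial (j + 1) 1 (fst z, y) + t * monomial 0 (j + 2) (fst z, y))
          has_real_derivative (pdy p2 (fst z, snd z) + (s * real (j + 2)) * (real 1 * monomial (j + 1) (1 - 1) (fst z, snd z))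
            + t * (real (j + 2) * monomial 0 (j + 2 - 1) (fst z, snd z)))) (at (snd z))"
        unfolding L pdy_poly2 by (intro DERIV_add DERIV_cmult monomial_DERIV_y poly2_DERIV_y)
      then show "pdy (\<lambda>z. snd (q z)) z = pdy p2 z + (s * real (j + 2)) * monomial (j + 1) 0 z
        + t * (real (j + 2) * monomial 0 (j + 1) z)"
        by (simp only: pdy_def[of "\<lambda>z. snd (q z)"]) (simp add: BDM DERIV_imp_deriv)
    qed
    \<comment> \<open>The contributions of each curl to the two partial derivatives cancel.\<close>
    ultimately have "div2 q = (\<lambda>z. pdx p1 z + pdy p2 z)"
      unfolding div2_def[abs_def] by (auto simp: algebra_simps)
    moreover have "(\<lambda>z. pdx p1 z + pdy p2 z) \<in> poly_P j"
      by (intro function_space_add function_space_poly_P pdx_poly_P pdy_poly_P BDM)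
    moreover have "degree_y (Suc j) p1" "degree_x (Suc j) p2"
      using BDM poly_P_subset_poly_Q degree_x_poly_Q degree_y_poly_Q by blast+
    then have "(\<lambda>z. fst (q z)) \<in> {f. degree_y (Suc j) f}" "(\<lambda>z. snd (q z)) \<in> {f. degree_x (Suc j) f}"
      unfolding BDM fst_conv snd_conv
      by (intro function_space_add function_space_cmult function_space_degree_y function_space_degree_x;
          simp add: degree_y_monomial degree_x_monomial)+
    moreover have "(\<lambda>z. fst (q z)) \<in> range poly2" "(\<lambda>z. snd (q z)) \<in> range poly2"
      unfolding BDM fst_conv snd_conv
      by (intro function_space_add function_space_cmult R p M)+
    ultimately show ?thesis using BDM(1) by simp
  qed
  then show "(\<lambda>z. fst (q z)) \<in> range poly2" "(\<lambda>z. snd (q z)) \<in> range poly2"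
    "div2 q \<in> interior_space el j"
    "degree_y (edge_degree el j) (\<lambda>z. fst (q z))" "degree_x (edge_degree el j) (\<lambda>z. snd (q z))" by auto
qed

text \<open>These are the competitors in the best approximation: for \<open>m \<le> j + 1\<close>
  and \<open>m > 0\<close> they include all pairs of polynomials of degree
  \<open>m - 1\<close>.\<close>

lemma pair_poly_P_grad_space:
  assumes "p \<in> poly_P j" "q \<in> poly_P j"
  shows "(\<lambda>z. (p z, q z)) \<in> grad_space el j"
proof (cases el)
  case QRT
  then show ?thesis
    using assms poly_P_subset_poly_Q[of j] poly_Q_mono[of j "j + 1" j j] poly_Q_mono[of j j j "j + 1"]
    unfolding QRT grad_space.simps RT_eq by (intro pair_spaceI) auto
next
  case PBDM
  have "p \<in> poly_P (j + 1)" "q \<in> poly_P (j + 1)" using assms poly_P_mono[of j "j + 1"] by auto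
  then have "(\<lambda>z. (p z, q z) + 0 *\<^sub>R curl2 (\<lambda>(x, y). x ^ ((j + 1) + 1) * y) z
      + 0 *\<^sub>R curl2 (\<lambda>(x, y). x * y ^ ((j + 1) + 1)) z) \<in> BDM (j + 1)"
    unfolding BDM_def by blast
  then show ?thesis by (simp add: PBDM)
qed

section \<open>Edges and polynomials in arc length\<close>

definition is_edge :: "plane set \<Rightarrow> plane \<Rightarrow> plane \<Rightarrow> bool" where
  "is_edge F p p' \<longleftrightarrow> F = cbox p p' \<and> p \<noteq> p' \<and> fst p \<le> fst p' \<and> snd p \<le> snd p'"

text \<open>Ordered corners make \<open>p\<close> the lower corner, from which arc length is
  measured; distinct corners make the length positive, so that one can divide by it.\<close>

lemma is_edge_props:
  assumes "is_edge F p p'"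
  shows "interval_lowerbound F = p" "edge_path F = linepath p p'" "diameter F = dist p p'"
    "0 < dist p p'" "t \<in> {0..1} \<Longrightarrow> linepath p p' t \<in> F" "t \<in> {0..1} \<Longrightarrow> dist p (linepath p p' t) = dist p p' * t"
proof -
  have F: "F = cbox p p'" and ne: "p \<noteq> p'" and le: "\<And>i. i \<in> Basis \<Longrightarrow> p \<bullet> i \<le> p' \<bullet> i"
    using assms by (auto simp: is_edge_def Basis_prod_def inner_prod_def)
  show "interval_lowerbound F = p" "edge_path F = linepath p p'" "diameter F = dist p p'"
    using le by (simp_all add: F edge_path_def diameter_cbox)
  show "0 < dist p p'" using ne by simp
  have "p \<in> F" "p' \<in> F" using le by (auto simp: F mem_box)
  then have "closed_segment p p' \<subseteq> F" unfolding F by (intro closed_segment_subset) auto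
  moreover have "linepath p p' t \<in> closed_segment p p'" if "t \<in> {0..1}"
    using that linepath_in_path by blast
  ultimately show "t \<in> {0..1} \<Longrightarrow> linepath p p' t \<in> F" by blast
  show "dist p (linepath p p' t) = dist p p' * t" if "t \<in> {0..1}"
  proof -
    have "p - linepath p p' t = t *\<^sub>R (p - p')" by (simp add: linepath_def algebra_simps)
    then show ?thesis using that by (simp add: dist_norm)
  qed
qed

lemma edge_integral_cong:
  assumes "is_edge F p p'" "\<And>t. t \<in> {0..1} \<Longrightarrow> f (linepath p p' t) = g t"
  shows "edge_integral F f = dist p p' * lint {0..1} g"
  using is_edge_props[OF assms(1)] assms(2)
  by (simp add: edge_integral_def) (intro disjI2 Bochner_Integration.integral_cong; simp)

text \<open>Edge polynomials pulled back to the unit parameter: \<open>l\<close> is the length of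
  the edge and \<open>l * t\<close> the arc length in which \<open>edge_poly\<close> is
  written.\<close>

definition arc_polys :: "real \<Rightarrow> nat \<Rightarrow> (real \<Rightarrow> real) set" where
  "arc_polys l k = {(\<lambda>t. poly r (l * t)) | r. degree r \<le> k}"

lemma finite_dim_arc_polys: "finite_dim (arc_polys l k)"
proof (rule finite_dimI)
  let ?fs = "map (\<lambda>i t. (l * t) ^ i) [0..<Suc k] :: (real \<Rightarrow> real) list"
  show "function_space (arc_polys l k)"
    unfolding function_space_def
  proof (intro conjI ballI allI)
    show "(\<lambda>z. 0) \<in> arc_polys l k" by (auto simp: arc_polys_def intro!: exI[of _ 0])
    fix f g t assume "f \<in> arc_polys l k"
    then obtain r where r: "f = (\<lambda>t. poly r (l * t))" "degree r \<le> k" by (auto simp: arc_polys_def)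
    then show "(\<lambda>z. t *\<^sub>R f z) \<in> arc_polys l k"
      unfolding arc_polys_def by (auto intro!: exI[of _ "smult t r"] order_trans[OF degree_smult_le])
    assume "g \<in> arc_polys l k"
    then obtain s where s: "g = (\<lambda>t. poly s (l * t))" "degree s \<le> k" by (auto simp: arc_polys_def)
    then show "(\<lambda>z. f z + g z) \<in> arc_polys l k"
      using r unfolding arc_polys_def by (auto intro!: exI[of _ "r + s"] degree_add_le)
  qed
  show "set ?fs \<subseteq> arc_polys l k"
    unfolding arc_polys_def
    by (auto simp del: upt_Suc intro!: exI[of _ "monom 1 _"] simp: poly_monom degree_monom_eq)
  show "arc_polys l k \<subseteq> fspan ?fs"
  proof
    fix f assume "f \<in> arc_polys l k"
    then obtain r where r: "f = (\<lambda>t. poly r (l * t))" "degree r \<le> k" by (auto simp: arc_polys_def)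
    have "(\<lambda>t. \<Sum>i\<le>degree r. coeff r i * (l * t) ^ i) \<in> fspan ?fs"
    proof (intro function_space_sum function_space_cmult function_space_fspan fspan_base)
      fix i assume "i \<in> {..degree r}"
      then show "(\<lambda>t. (l * t) ^ i) \<in> set ?fs" using r(2) by (auto simp del: upt_Suc)
    qed
    then show "f \<in> fspan ?fs" by (simp add: r(1) poly_altdef)
  qed
qed

lemma arc_polys_zero:
  assumes "l > 0" "f \<in> arc_polys l k" "\<And>t. t \<in> {0..1} \<Longrightarrow> f t = 0"
  shows "f = (\<lambda>t. 0)"
proof -
  obtain r where r: "f = (\<lambda>t. poly r (l * t))" using assms(2) by (auto simp: arc_polys_def)
  have "r = 0"
  proof (rule poly_zero_on_interval[of 0 l])
    fix x assume "x \<in> {0..l}"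
    then show "poly r x = 0" using assms(1) assms(3)[of "x / l"] by (simp add: r)
  qed (use assms in auto)
  then show ?thesis by (simp add: r)
qed

lemma continuous_on_arc_polys: "f \<in> arc_polys l k \<Longrightarrow> continuous_on S f"
  by (auto simp: arc_polys_def intro!: continuous_intros)

text \<open>Parametrising the edge by the unit interval turns the problem into an L2 projection onto
  \<open>arc_polys\<close>. The way back is unambiguous because a polynomial function of
  \<open>l * t\<close> determines the polynomial, and with it the restricted function on the
  edge.\<close>

lemma edge_projection_unique:
  assumes F: "is_edge F p p'" and \<gamma>: "\<gamma> \<in> edge_L2_space F"
  shows "\<exists>!v. v \<in> edge_poly k F \<and> (\<forall>q\<in>edge_poly k F. edge_integral F (\<lambda>z. (\<gamma> z - v z) * q z) = 0)"
proof -
  let ?l = "dist p p'"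
  note P = is_edge_props[OF F]
  define g where "g t = \<gamma> (linepath p p' t)" for t
  have g: "g \<in> L2_space {0..1}" using \<gamma> by (simp add: edge_L2_space_def P g_def[abs_def])
  have cL2: "q \<in> L2_space {0..1}" if "continuous_on {0..1} q" for q :: "real \<Rightarrow> real"
    using L2_space_continuous[of 0 1 q] that by simp
  define E where "E r = restrict (\<lambda>z. poly r (dist p z)) F" for r :: "real poly"
  have E: "edge_poly k F = {E r | r. degree r \<le> k}"
    by (simp add: edge_poly_def E_def P)
  have E_path: "E r (linepath p p' t) = poly r (?l * t)" if "t \<in> {0..1}" for r t
    using P(5,6)[OF that] by (simp add: E_def)
  have ex: "\<exists>!G. G \<in> arc_polys ?l k \<and> (\<forall>q\<in>arc_polys ?l k.
      lint (cbox 0 1) (\<lambda>t. G t \<bullet> q t) = lint {0..1} (\<lambda>t. g t * q t))"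
  proof (rule L2_projection_exists_unique[OF finite_dim_arc_polys])
    fix f h t assume "f \<in> arc_polys ?l k" "h \<in> arc_polys ?l k"
    then have "integrable (lebesgue_on {0..1}) (\<lambda>x. g x * f x)" "integrable (lebesgue_on {0..1}) (\<lambda>x. g x * h x)"
      by (auto intro!: integrable_mult_L2 g cL2 continuous_on_arc_polys)
    then show "lint {0..1} (\<lambda>x. g x * (t *\<^sub>R f x + h x))
      = t * lint {0..1} (\<lambda>x. g x * f x) + lint {0..1} (\<lambda>x. g x * h x)"
      by (simp add: distrib_left mult.left_commute[of _ t])
  next
    fix f assume "f \<in> arc_polys ?l k" "\<And>t. t \<in> cbox 0 1 \<Longrightarrow> f t = 0"
    then show "f = (\<lambda>t. 0)" using arc_polys_zero[OF P(4)] by simp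
  qed (auto intro: continuous_on_arc_polys)
  have char: "edge_integral F (\<lambda>z. (\<gamma> z - E r z) * E s z) = 0 \<longleftrightarrow>
      lint (cbox 0 1) (\<lambda>t. poly r (?l * t) \<bullet> poly s (?l * t))
      = lint {0..1} (\<lambda>t. g t * poly s (?l * t))" for r s
  proof -
    have "edge_integral F (\<lambda>z. (\<gamma> z - E r z) * E s z)
        = ?l * lint {0..1} (\<lambda>t. (g t - poly r (?l * t)) * poly s (?l * t))"
      by (rule edge_integral_cong[OF F]) (simp add: E_path g_def)
    also have "lint {0..1} (\<lambda>t. (g t - poly r (?l * t)) * poly s (?l * t))
        = lint {0..1} (\<lambda>t. g t * poly s (?l * t))
          - lint {0..1} (\<lambda>t. poly r (?l * t) * poly s (?l * t))"
    proof -
      have "integrable (lebesgue_on {0..1}) (\<lambda>t. g t * poly s (?l * t))"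
        "integrable (lebesgue_on {0..1}) (\<lambda>t. poly r (?l * t) * poly s (?l * t))"
        by (auto intro!: integrable_mult_L2 g cL2 continuous_intros)
      then show ?thesis by (simp add: left_diff_distrib)
    qed
    finally show ?thesis using P(4) by auto
  qed
  obtain G where G: "G \<in> arc_polys ?l k" "\<forall>q\<in>arc_polys ?l k.
      lint (cbox 0 1) (\<lambda>t. G t \<bullet> q t) = lint {0..1} (\<lambda>t. g t * q t)"
    using ex by blast
  obtain r where r: "G = (\<lambda>t. poly r (?l * t))" "degree r \<le> k" using G(1) by (auto simp: arc_polys_def)
  show ?thesis
  proof (rule ex1I[of _ "E r"])
    show "E r \<in> edge_poly k F \<and> (\<forall>q\<in>edge_poly k F. edge_integral F (\<lambda>z. (\<gamma> z - E r z) * q z) = 0)"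
      using r G(2) unfolding E by (auto simp: char arc_polys_def)
    fix v assume v: "v \<in> edge_poly k F \<and> (\<forall>q\<in>edge_poly k F. edge_integral F (\<lambda>z. (\<gamma> z - v z) * q z) = 0)"
    then obtain s where s: "v = E s" "degree s \<le> k" unfolding E by blast
    have "(\<lambda>t. poly s (?l * t)) \<in> arc_polys ?l k" using s(2) by (auto simp: arc_polys_def)
    moreover have "\<forall>q\<in>arc_polys ?l k. lint (cbox 0 1) (\<lambda>t. poly s (?l * t) \<bullet> q t)
        = lint {0..1} (\<lambda>t. g t * q t)"
    proof
      fix q assume "q \<in> arc_polys ?l k"
      then obtain r' where r': "q = (\<lambda>t. poly r' (?l * t))" "degree r' \<le> k" by (auto simp: arc_polys_def)
      then have "E r' \<in> edge_poly k F" unfolding E by blast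
      then have "edge_integral F (\<lambda>z. (\<gamma> z - E s z) * E r' z) = 0"
        using bspec[OF conjunct2[OF v]] by (simp add: s(1))
      then show "lint (cbox 0 1) (\<lambda>t. poly s (?l * t) \<bullet> q t)
        = lint {0..1} (\<lambda>t. g t * q t)" unfolding r'(1) by (simp only: char)
    qed
    ultimately have "(\<lambda>t. poly s (?l * t)) = G" using ex G by blast
    then have "poly s (?l * t) = poly r (?l * t)" for t by (simp add: r(1) fun_eq_iff)
    \<comment> \<open>The edge has positive length, so every real number is of the form
      \<open>?l * t\<close>.\<close>
    from this[of "x / ?l" for x] have "poly s x = poly r x" for x using P(4) by simp
    then show "v = E r" by (simp add: s E_def)
  qed
qed

section \<open>The Bramble--Hilbert estimate\<close>

text \<open>Dividing by the factorial turns differentiation into a pure index shift, so that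
  derivatives of full order take the values 0 and 1 only.\<close>

definition taylor_monom :: "nat \<Rightarrow> real poly" where
  "taylor_monom n = monom (1 / fact n) n"

lemma pderiv_taylor_monom: "pderiv (taylor_monom (Suc n)) = taylor_monom n" "pderiv (taylor_monom 0) = 0"
  by (simp_all add: taylor_monom_def pderiv_monom fact_Suc divide_simps del: of_nat_Suc)

lemma higher_pderiv_taylor_monom:
  "(pderiv ^^ k) (taylor_monom n) = (if k \<le> n then taylor_monom (n - k) else 0)"
proof (induction k)
  case (Suc k)
  show ?case
  proof (cases "Suc k \<le> n")
    case True
    then have "n - k = Suc (n - Suc k)" by simp
    then show ?thesis using Suc True by (simp add: pderiv_taylor_monom)
  next
    case False
    then show ?thesis using Suc by (cases "k = n") (auto simp: pderiv_taylor_monom)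
  qed
qed simp

lemma taylor_monom_0: "poly (taylor_monom 0) x = 1"
  by (simp add: taylor_monom_def)

context subrectangle
begin

text \<open>Classical integration by parts, with boundary terms that contain \<open>poly r a\<close>
  and \<open>poly r b\<close>. It allows polynomials to be subtracted from families of weak
  derivatives.\<close>

lemma weak_dx_tensor: "weak_dx (tensor (poly p) (poly q)) (tensor (poly (pderiv p)) (poly q))"
  unfolding weak_dx_def
proof (intro allI impI)
  fix r s :: "real poly" assume r: "poly r a = 0" "poly r b = 0"
  let ?f = "\<lambda>z. tensor (poly p) (poly q) z * tensor (poly (pderiv r)) (poly s) z"
  let ?g = "\<lambda>z. tensor (poly (pderiv p)) (poly q) z * tensor (poly r) (poly s) z"
  have "lint K (\<lambda>z. ?f z + ?g z) = lint {c..d}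
     (\<lambda>y. tensor (poly (p * r)) (poly (q * s)) (b, y) - tensor (poly (p * r)) (poly (q * s)) (a, y))"
  proof (rule integral_dx_rectangle)
    fix x y
    show "((\<lambda>x. tensor (poly (p * r)) (poly (q * s)) (x, y)) has_real_derivative
      tensor (poly p) (poly q) (x, y) * tensor (poly (pderiv r)) (poly s) (x, y) +
      tensor (poly (pderiv p)) (poly q) (x, y) * tensor (poly r) (poly s) (x, y)) (at x)"
      by (auto simp: tensor_def algebra_simps intro!: derivative_eq_intros)
  qed (use ab in \<open>(intro continuous_intros continuous_on_poly_tensor | simp)+\<close>)
  also have "\<dots> = 0" using r by (simp add: tensor_def)
  finally show "lint K ?f = - lint K ?g"
    using integrable_mult_L2[OF L2_space_tensor[of p q] L2_space_tensor[of "pderiv r" s]]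
      integrable_mult_L2[OF L2_space_tensor[of "pderiv p" q] L2_space_tensor[of r s]] by simp
qed

lemma weak_dy_tensor: "weak_dy (tensor (poly p) (poly q)) (tensor (poly p) (poly (pderiv q)))"
  unfolding weak_dy_def
proof (intro allI impI)
  fix r s :: "real poly" assume s: "poly s c = 0" "poly s d = 0"
  let ?f = "\<lambda>z. tensor (poly p) (poly q) z * tensor (poly r) (poly (pderiv s)) z"
  let ?g = "\<lambda>z. tensor (poly p) (poly (pderiv q)) z * tensor (poly r) (poly s) z"
  have "lint K (\<lambda>z. ?f z + ?g z) = lint {a..b}
     (\<lambda>x. tensor (poly (p * r)) (poly (q * s)) (x, d) - tensor (poly (p * r)) (poly (q * s)) (x, c))"
  proof (rule integral_dy_rectangle)
    fix x y
    show "((\<lambda>y. tensor (poly (p * r)) (poly (q * s)) (x, y)) has_real_derivative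
      tensor (poly p) (poly q) (x, y) * tensor (poly r) (poly (pderiv s)) (x, y) +
      tensor (poly p) (poly (pderiv q)) (x, y) * tensor (poly r) (poly s) (x, y)) (at y)"
      by (auto simp: tensor_def algebra_simps intro!: derivative_eq_intros)
  qed (use cd in \<open>(intro continuous_intros continuous_on_poly_tensor | simp)+\<close>)
  also have "\<dots> = 0" using s by (simp add: tensor_def)
  finally show "lint K ?f = - lint K ?g"
    using integrable_mult_L2[OF L2_space_tensor[of p q] L2_space_tensor[of r "pderiv s"]]
      integrable_mult_L2[OF L2_space_tensor[of p "pderiv q"] L2_space_tensor[of r s]] by simp
qed

lemma weak_dx_lincomb:
  assumes "weak_dx u v" "weak_dx u' v'" "u \<in> L2_space K" "v \<in> L2_space K" "u' \<in> L2_space K" "v' \<in> L2_space K"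
  shows "weak_dx (\<lambda>z. u z + t * u' z) (\<lambda>z. v z + t * v' z)"
  using assms(1,2) integrable_mult_L2[OF assms(3) L2_space_tensor] integrable_mult_L2[OF assms(4) L2_space_tensor]
    integrable_mult_L2[OF assms(5) L2_space_tensor] integrable_mult_L2[OF assms(6) L2_space_tensor]
  by (simp add: weak_dx_def distrib_right mult.assoc)

lemma weak_dy_lincomb:
  assumes "weak_dy u v" "weak_dy u' v'" "u \<in> L2_space K" "v \<in> L2_space K" "u' \<in> L2_space K" "v' \<in> L2_space K"
  shows "weak_dy (\<lambda>z. u z + t * u' z) (\<lambda>z. v z + t * v' z)"
  using assms(1,2) integrable_mult_L2[OF assms(3) L2_space_tensor] integrable_mult_L2[OF assms(4) L2_space_tensor]
    integrable_mult_L2[OF assms(5) L2_space_tensor] integrable_mult_L2[OF assms(6) L2_space_tensor]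
  by (simp add: weak_dy_def distrib_right mult.assoc)

text \<open>The \<open>(k, l)\<close>-th derivative of \<open>x^i y^(m - i) / (i! (m - i)!)\<close>; for \<open>k + l = m\<close> it is a
  Kronecker delta.\<close>

definition taylor_deriv :: "nat \<Rightarrow> nat \<Rightarrow> nat \<Rightarrow> nat \<Rightarrow> plane \<Rightarrow> real" where
  "taylor_deriv m i k l = tensor (poly ((pderiv ^^ k) (taylor_monom i))) (poly ((pderiv ^^ l) (taylor_monom (m - i))))"

lemma taylor_deriv_diag: "k + l = m \<Longrightarrow> i \<le> m \<Longrightarrow> taylor_deriv m i k l z = (if i = k then 1 else 0)"
  by (auto simp: taylor_deriv_def tensor_def higher_pderiv_taylor_monom taylor_monom_0)

lemma taylor_deriv_above: "k + l = Suc m \<Longrightarrow> i \<le> m \<Longrightarrow> taylor_deriv m i k l z = 0"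
  by (auto simp: taylor_deriv_def tensor_def higher_pderiv_taylor_monom)

lemma taylor_deriv_poly_P:
  assumes "i \<le> m" "m \<le> j"
  shows "taylor_deriv m i 0 0 \<in> poly_P j"
proof -
  have "taylor_deriv m i 0 0 = (\<lambda>z. (1 / fact i * (1 / fact (m - i))) * monomial i (m - i) z)"
    by (auto simp: taylor_deriv_def tensor_def taylor_monom_def poly_monom monomial_def)
  also have "\<dots> \<in> poly_P j"
    using assms by (intro function_space_cmult function_space_poly_P monomial_poly_P) simp
  finally show ?thesis .
qed

lemma weak_dx_lincomb_sum:
  assumes "finite I"
    and V: "u \<in> L2_space K" "v \<in> L2_space K" "weak_dx u v"
    and W: "\<And>i. i \<in> I \<Longrightarrow> f i \<in> L2_space K \<and> g i \<in> L2_space K \<and> weak_dx (f i) (g i)"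
  shows "weak_dx (\<lambda>z. u z + (\<Sum>i\<in>I. t i * f i z)) (\<lambda>z. v z + (\<Sum>i\<in>I. t i * g i z))"
  using assms(1) W
proof (induction I)
  case (insert i I)
  have "weak_dx (\<lambda>z. (u z + (\<Sum>i\<in>I. t i * f i z)) + t i * f i z) (\<lambda>z. (v z + (\<Sum>i\<in>I. t i * g i z)) + t i * g i z)"
    using insert by (intro weak_dx_lincomb L2_space_add V L2_space_sum L2_space_cmult) auto
  then show ?case using insert.hyps by (simp add: algebra_simps)
qed (use V in simp)

lemma weak_dy_lincomb_sum:
  assumes "finite I"
    and V: "u \<in> L2_space K" "v \<in> L2_space K" "weak_dy u v"
    and W: "\<And>i. i \<in> I \<Longrightarrow> f i \<in> L2_space K \<and> g i \<in> L2_space K \<and> weak_dy (f i) (g i)"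
  shows "weak_dy (\<lambda>z. u z + (\<Sum>i\<in>I. t i * f i z)) (\<lambda>z. v z + (\<Sum>i\<in>I. t i * g i z))"
  using assms(1) W
proof (induction I)
  case (insert i I)
  have "weak_dy (\<lambda>z. (u z + (\<Sum>i\<in>I. t i * f i z)) + t i * f i z) (\<lambda>z. (v z + (\<Sum>i\<in>I. t i * g i z)) + t i * g i z)"
    using insert by (intro weak_dy_lincomb L2_space_add V L2_space_sum L2_space_cmult) auto
  then show ?case using insert.hyps by (simp add: algebra_simps)
qed (use V in simp)

text \<open>\<open>V k l\<close> stands for the derivative of order \<open>(k, l)\<close> of
  \<open>V 0 0\<close>. An abstract family lets the induction hypothesis be applied after a
  polynomial has been subtracted, and later covers both components of the gradient by an index
  shift. The condition on \<open>p\<close> says that its degree is at most \<open>m - 1\<close>; for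
  \<open>m = 0\<close> it asks for a constant, and the zero polynomial is taken.\<close>

lemma bramble_hilbert:
  assumes H: "b - a \<le> H" "d - c \<le> H"
    and "\<And>k l. k + l \<le> m \<Longrightarrow> V k l \<in> L2_space K"
    and "\<And>k l. k + l < m \<Longrightarrow> weak_dx (V k l) (V (Suc k) l)"
    and "\<And>k l. k + l < m \<Longrightarrow> weak_dy (V k l) (V k (Suc l))"
  shows "\<exists>p. (\<forall>j. m \<le> Suc j \<longrightarrow> p \<in> poly_P j) \<and>
    L2_norm K (\<lambda>z. V 0 0 z - p z) \<le> (2 * H) ^ m * (\<Sum>k\<le>m. L2_norm K (V k (m - k)))"
  using assms(3-5)
proof (induction m arbitrary: V)
  case 0
  show ?case by (rule exI[of _ "\<lambda>z. 0"]) (auto intro: function_space_0 function_space_poly_P)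
next
  case (Suc m)
  have H0: "H \<ge> 0" using H ab by linarith
  \<comment> \<open>The mean of the derivative of order \<open>(k, m - k)\<close>. Because of the
    Kronecker property these numbers are the coefficients of the polynomial to subtract, and
    \<open>W\<close> is the family of derivatives of the difference.\<close>
  define \<mu> where "\<mu> k = lint K (V k (m - k)) / measure lebesgue K" for k
  define W where "W k l z = V k l z + (\<Sum>i\<le>m. (- \<mu> i) * taylor_deriv m i k l z)" for k l z
  have TL2: "taylor_deriv m i k l \<in> L2_space K" for i k l
    unfolding taylor_deriv_def by (rule L2_space_tensor)
  have W_abs: "W k l = (\<lambda>z. V k l z + (\<Sum>i\<le>m. (- \<mu> i) * taylor_deriv m i k l z))" for k l
    by (simp add: W_def[abs_def])
  have WL2: "W k l \<in> L2_space K" if "k + l \<le> Suc m" for k l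
    unfolding W_abs by (intro L2_space_add Suc.prems(1)[OF that] L2_space_sum L2_space_cmult TL2)
  have Wdx: "weak_dx (W k l) (W (Suc k) l)" if "k + l < Suc m" for k l
    unfolding W_abs
    using that TL2 weak_dx_tensor[of "(pderiv ^^ k) (taylor_monom _)"]
    by (intro weak_dx_lincomb_sum Suc.prems) (auto simp: taylor_deriv_def intro!: L2_space_tensor)
  have Wdy: "weak_dy (W k l) (W k (Suc l))" if "k + l < Suc m" for k l
    unfolding W_abs
    using that TL2 weak_dy_tensor[of _ "(pderiv ^^ l) (taylor_monom _)"]
    by (intro weak_dy_lincomb_sum Suc.prems) (auto simp: taylor_deriv_def intro!: L2_space_tensor)
  have Wtop: "W k l = V k l" if "k + l = Suc m" for k l
  proof -
    have "(\<Sum>i\<le>m. (- \<mu> i) * taylor_deriv m i k l z) = 0" for z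
      using that by (intro sum.neutral) (simp add: taylor_deriv_above)
    then show ?thesis by (simp add: W_abs)
  qed
  have Wdiag: "W k (m - k) = (\<lambda>z. V k (m - k) z - \<mu> k)" if "k \<le> m" for k
  proof -
    have "(\<Sum>i\<le>m. (- \<mu> i) * taylor_deriv m i k (m - k) z) = (\<Sum>i\<le>m. if i = k then - \<mu> i else 0)" for z
      using that by (intro sum.cong) (auto simp: taylor_deriv_diag)
    then show ?thesis using that by (simp add: W_abs)
  qed
  have meas: "measure lebesgue K > 0"
    using ab cd by (simp add: content_Pair)
  have mean: "lint K (W k (m - k)) = 0" if "k \<le> m" for k
  proof -
    have "integrable (lebesgue_on K) (\<lambda>z. V k (m - k) z * 1)"
      using that by (intro integrable_mult_L2 Suc.prems L2_space_continuous continuous_intros) auto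
    moreover have "integrable (lebesgue_on K) (\<lambda>z. \<mu> k)"
      by (intro continuous_imp_integrable continuous_intros)
    ultimately have "lint K (W k (m - k))
        = lint K (V k (m - k)) - lint K (\<lambda>z. \<mu> k)"
      by (simp add: Wdiag[OF that])
    also have "lint K (\<lambda>z. \<mu> k) = measure lebesgue K * \<mu> k"
      by (simp add: measure_restrict_space)
    finally show ?thesis using meas by (simp add: \<mu>_def)
  qed
  \<comment> \<open>The induction hypothesis is used only up to order \<open>m\<close> of the
    corrected family; its derivatives of order \<open>m + 1\<close> are kept for the Poincare
    inequality below, where they agree with those of \<open>V\<close>.\<close>
  obtain p where p: "\<And>j. m \<le> Suc j \<Longrightarrow> p \<in> poly_P j"
    "L2_norm K (\<lambda>z. W 0 0 z - p z) \<le> (2 * H) ^ m * (\<Sum>k\<le>m. L2_norm K (W k (m - k)))"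
    using Suc.IH[of W] WL2 Wdx Wdy by fastforce
  \<comment> \<open>The subtracted polynomial of degree at most \<open>m\<close> is added back,
    which raises the admissible degree by one.\<close>
  define q where "q z = p z + (\<Sum>i\<le>m. \<mu> i * taylor_deriv m i 0 0 z)" for z
  have "q \<in> poly_P j" if "Suc m \<le> Suc j" for j
    unfolding q_def[abs_def] using that
    by (intro function_space_add function_space_sum function_space_cmult function_space_poly_P p taylor_deriv_poly_P) auto
  moreover have "L2_norm K (\<lambda>z. V 0 0 z - q z) \<le> (2 * H) ^ Suc m * (\<Sum>k\<le>Suc m. L2_norm K (V k (Suc m - k)))"
  proof -
    have step: "L2_norm K (W k (m - k)) \<le> H * L2_norm K (V (Suc k) (m - k)) + H * L2_norm K (V k (Suc m - k))"
      if "k \<le> m" for k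
    proof -
      have "L2_norm K (W k (m - k)) \<le> (b - a) * L2_norm K (W (Suc k) (m - k)) + (d - c) * L2_norm K (W k (Suc (m - k)))"
        using that by (intro poincare mean WL2 Wdx Wdy) auto
      also have "\<dots> \<le> H * L2_norm K (W (Suc k) (m - k)) + H * L2_norm K (W k (Suc (m - k)))"
        using H by (intro add_mono mult_right_mono) auto
      finally show ?thesis using that by (simp add: Wtop Suc_diff_le)
    qed
    let ?N = "\<lambda>k. L2_norm K (V k (Suc m - k))"
    have "(\<Sum>k\<le>m. L2_norm K (W k (m - k))) \<le> (\<Sum>k\<le>m. H * ?N (Suc k) + H * ?N k)"
      using step by (intro sum_mono) simp
    also have "\<dots> = H * (\<Sum>k\<le>m. ?N (Suc k)) + H * (\<Sum>k\<le>m. ?N k)"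
      by (simp add: sum.distrib sum_distrib_left)
    \<comment> \<open>A derivative of order \<open>m + 1\<close> can occur both as an x-derivative
      and as a y-derivative of derivatives of order \<open>m\<close>. Extending each of the two sums
      to all of them is the source of the factor 2.\<close>
    also have "\<dots> \<le> H * (\<Sum>k\<le>Suc m. ?N k) + H * (\<Sum>k\<le>Suc m. ?N k)"
    proof (intro add_mono mult_left_mono H0)
      show "(\<Sum>k\<le>m. ?N (Suc k)) \<le> (\<Sum>k\<le>Suc m. ?N k)"
        by (subst sum.atMost_Suc_shift) simp
      show "(\<Sum>k\<le>m. ?N k) \<le> (\<Sum>k\<le>Suc m. ?N k)" by simp
    qed
    finally have "(\<Sum>k\<le>m. L2_norm K (W k (m - k))) \<le> (2 * H) * (\<Sum>k\<le>Suc m. ?N k)" by simp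
    then have "(2 * H) ^ m * (\<Sum>k\<le>m. L2_norm K (W k (m - k))) \<le> (2 * H) ^ m * ((2 * H) * (\<Sum>k\<le>Suc m. ?N k))"
      using H0 by (intro mult_left_mono) auto
    moreover have "(\<lambda>z. V 0 0 z - q z) = (\<lambda>z. W 0 0 z - p z)"
      by (auto simp: W_def q_def sum_negf)
    ultimately have "L2_norm K (\<lambda>z. V 0 0 z - q z) \<le> (2 * H) ^ m * ((2 * H) * (\<Sum>k\<le>Suc m. ?N k))"
      using p(2) order_trans by (simp only:)
    then show ?thesis by (simp only: power_Suc2 mult.assoc)
  qed
  ultimately show ?case by blast
qed

end

section \<open>Smooth functions and traces\<close>

lemma smooth_pd_differentiable:
  assumes "smooth f"
  shows "f differentiable (at z)" "pdx f differentiable (at z)" "pdy f differentiable (at z)"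
proof -
  have "pd 0 0 f differentiable (at z)" "pd 1 0 f differentiable (at z)" "pd 0 1 f differentiable (at z)"
    using assms unfolding smooth_def by blast+
  then show "f differentiable (at z)" "pdx f differentiable (at z)" "pdy f differentiable (at z)"
    by (simp_all add: pd_def)
qed

lemma smooth_continuous:
  assumes "smooth f"
  shows "continuous_on S f" "continuous_on S (pdx f)" "continuous_on S (pdy f)"
  using smooth_pd_differentiable[OF assms]
  by (auto intro!: continuous_at_imp_continuous_on differentiable_imp_continuous_within simp del: split_paired_All)

lemma differentiable_DERIV_x:
  assumes "f differentiable (at (x, y))"
  shows "((\<lambda>x. f (x, y)) has_real_derivative pdx f (x, y)) (at x)"
proof -
  have "(\<lambda>x. (x, y)) differentiable (at x)"
    by (auto intro!: derivative_eq_intros simp: differentiable_def)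
  then have "(\<lambda>x. f (x, y)) differentiable (at x)"
    using differentiable_chain_at[of "\<lambda>x. (x, y)" x f] assms by (simp add: o_def)
  then show ?thesis by (simp add: pdx_def DERIV_deriv_iff_real_differentiable)
qed

lemma differentiable_DERIV_y:
  assumes "f differentiable (at (x, y))"
  shows "((\<lambda>y. f (x, y)) has_real_derivative pdy f (x, y)) (at y)"
proof -
  have "(\<lambda>y. (x, y)) differentiable (at y)"
    by (auto intro!: derivative_eq_intros simp: differentiable_def)
  then have "(\<lambda>y. f (x, y)) differentiable (at y)"
    using differentiable_chain_at[of "\<lambda>y. (x, y)" y f] assms by (simp add: o_def)
  then show ?thesis by (simp add: pdy_def DERIV_deriv_iff_real_differentiable)
qed

lemma L2_space_continuous_bounded:
  fixes f :: "'a::euclidean_space \<Rightarrow> real"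
  assumes "continuous_on UNIV f" "bounded \<Omega>" "\<Omega> \<in> sets lebesgue"
  shows "f \<in> L2_space \<Omega>"
proof -
  obtain a b where "\<Omega> \<subseteq> cbox a b" using bounded_subset_cbox_symmetric[OF assms(2)] by blast
  then have "\<Omega> - cbox a b = {}" by blast
  then have "negligible (\<Omega> - cbox a b)" by simp
  moreover have "f \<in> L2_space (cbox a b)"
    by (intro L2_space_continuous continuous_on_subset[OF assms(1)]) simp
  ultimately show ?thesis
    using assms(3) L2_space_subset[of f "cbox a b" \<Omega>] by simp
qed

lemma pdx_zero_open:
  assumes "open U" "z \<in> U" "\<And>x. x \<in> U \<Longrightarrow> f x = 0" "f differentiable (at z)"
  shows "pdx f z = 0"
proof -
  obtain x y where z: "z = (x, y)" by force
  have "open ((\<lambda>x. (x, y)) -` U)" by (intro open_vimage assms continuous_intros)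
  moreover have "((\<lambda>x. 0) has_real_derivative 0) (at x)" by simp
  ultimately have "((\<lambda>x. f (x, y)) has_real_derivative 0) (at x)"
    using assms z by (auto intro: has_field_derivative_transform_within_open[where f="\<lambda>x. 0"])
  then show ?thesis using DERIV_imp_deriv by (simp add: pdx_def z)
qed

lemma pdy_zero_open:
  assumes "open U" "z \<in> U" "\<And>x. x \<in> U \<Longrightarrow> f x = 0" "f differentiable (at z)"
  shows "pdy f z = 0"
proof -
  obtain x y where z: "z = (x, y)" by force
  have "open ((\<lambda>y. (x, y)) -` U)" by (intro open_vimage assms continuous_intros)
  moreover have "((\<lambda>y. 0) has_real_derivative 0) (at y)" by simp
  ultimately have "((\<lambda>y. f (x, y)) has_real_derivative 0) (at y)"
    using assms z by (auto intro: has_field_derivative_transform_within_open[where f="\<lambda>x. 0"])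
  then show ?thesis using DERIV_imp_deriv by (simp add: pdy_def z)
qed

lemma integral_lebesgue_on_support:
  fixes F :: "'a::euclidean_space \<Rightarrow> real"
  assumes "S \<in> sets lebesgue" "\<And>z. z \<notin> S \<Longrightarrow> F z = 0"
  shows "lint S F = integral\<^sup>L lebesgue F"
proof -
  have "(\<lambda>x. if x \<in> S then F x else 0) = F" using assms(2) by auto
  then show ?thesis using Lebesgue_Measure.integral_restrict_UNIV[OF assms(1), of F] by simp
qed

text \<open>\<open>f\<close> is smooth on the whole plane and the support of the test function lies
  in a ball, so classical integration by parts on a square around that ball has no boundary
  terms.\<close>

lemma is_weak_pd_smooth:
  assumes f: "smooth f" and \<Omega>: "\<Omega> \<in> sets lebesgue"
  shows "is_weak_pd \<Omega> 1 0 f (pdx f)" "is_weak_pd \<Omega> 0 1 f (pdy f)"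
proof -
  have main: "lint \<Omega> (\<lambda>z. f z * pdx \<psi> z) = - lint \<Omega> (\<lambda>z. pdx f z * \<psi> z) \<and>
    lint \<Omega> (\<lambda>z. f z * pdy \<psi> z) = - lint \<Omega> (\<lambda>z. pdy f z * \<psi> z)"
    if \<psi>: "\<psi> \<in> test_functions \<Omega>" for \<psi>
  proof -
    let ?S = "closure {z. \<psi> z \<noteq> 0}"
    have s: "smooth \<psi>" "compact ?S" "?S \<subseteq> \<Omega>" using \<psi> by (auto simp: test_functions_def)
    obtain R where R: "0 < R" "?S \<subseteq> ball 0 R"
      using bounded_subset_ballD[OF compact_imp_bounded[OF s(2)], of 0] by blast
    let ?B = "cbox (- R, - R) (R, R) :: plane set"
    have coord: "\<bar>x\<bar> < R \<and> \<bar>y\<bar> < R" if "(x, y) \<in> ?S" for x y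
    proof -
      have "norm (x, y) < R" using that R(2) by auto
      then show ?thesis using norm_fst_le[of x y] norm_snd_le[of y x] by auto
    qed
    have off: "\<psi> z = 0" "pdx \<psi> z = 0" "pdy \<psi> z = 0" if "z \<notin> ?S" for z
    proof -
      have o: "open (- ?S)" "z \<in> - ?S" "\<And>x. x \<in> - ?S \<Longrightarrow> \<psi> x = 0"
        using that closure_subset[of "{z. \<psi> z \<noteq> 0}"] by (blast intro: open_Compl)+
      show "\<psi> z = 0" using o by blast
      show "pdx \<psi> z = 0" "pdy \<psi> z = 0"
        using pdx_zero_open[OF o] pdy_zero_open[OF o] smooth_pd_differentiable[OF s(1)] by auto
    qed
    have offO: "z \<notin> ?S" if "z \<notin> \<Omega>" for z using that s(3) by auto
    have offB: "z \<notin> ?S" if "z \<notin> ?B" for z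
      using that coord[of "fst z" "snd z"] by (cases z) (auto simp: cbox_Pair_eq)
    \<comment> \<open>Neither of \<Omega> and the square need contain the other; integrands that
      vanish off the support do not see the difference.\<close>
    have trans: "lint \<Omega> F = lint ?B F"
      if "\<And>z. z \<notin> ?S \<Longrightarrow> F z = 0" for F :: "plane \<Rightarrow> real"
      using integral_lebesgue_on_support[of \<Omega> F] integral_lebesgue_on_support[of ?B F] that offO offB \<Omega> by simp
    note cont = smooth_continuous[OF f] smooth_continuous[OF s(1)]
    have int: "integrable (lebesgue_on ?B) (\<lambda>z. f z * pdx \<psi> z)" "integrable (lebesgue_on ?B) (\<lambda>z. pdx f z * \<psi> z)"
      "integrable (lebesgue_on ?B) (\<lambda>z. f z * pdy \<psi> z)" "integrable (lebesgue_on ?B) (\<lambda>z. pdy f z * \<psi> z)"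
      by (intro continuous_imp_integrable continuous_intros cont)+
    have bdry: "\<psi> (R, y) = 0" "\<psi> (- R, y) = 0" "\<psi> (y, R) = 0" "\<psi> (y, - R) = 0" for y
      using coord[of R y] coord[of "- R" y] coord[of y R] coord[of y "- R"] R(1)
      by (intro off(1) notI; force)+
    have "lint ?B (\<lambda>z. f z * pdx \<psi> z + pdx f z * \<psi> z)
        = lint {- R..R} (\<lambda>y. f (R, y) * \<psi> (R, y) - f (- R, y) * \<psi> (- R, y))"
    proof (rule integral_dx_rectangle)
      show "((\<lambda>x. f (x, y) * \<psi> (x, y)) has_real_derivative f (x, y) * pdx \<psi> (x, y) + pdx f (x, y) * \<psi> (x, y)) (at x)" for x y
        using DERIV_mult[OF differentiable_DERIV_x[of f x y, OF smooth_pd_differentiable(1)[OF f]]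
            differentiable_DERIV_x[of \<psi> x y, OF smooth_pd_differentiable(1)[OF s(1)]]]
        by (simp add: mult.commute add.commute)
    qed (use R(1) in \<open>(intro continuous_intros cont | simp)+\<close>)
    then have x: "lint ?B (\<lambda>z. f z * pdx \<psi> z) = - lint ?B (\<lambda>z. pdx f z * \<psi> z)"
      using int by (simp add: bdry)
    have "lint ?B (\<lambda>z. f z * pdy \<psi> z + pdy f z * \<psi> z)
        = lint {- R..R} (\<lambda>x. f (x, R) * \<psi> (x, R) - f (x, - R) * \<psi> (x, - R))"
    proof (rule integral_dy_rectangle)
      show "((\<lambda>y. f (x, y) * \<psi> (x, y)) has_real_derivative f (x, y) * pdy \<psi> (x, y) + pdy f (x, y) * \<psi> (x, y)) (at y)" for x y
        using DERIV_mult[OF differentiable_DERIV_y[of f x y, OF smooth_pd_differentiable(1)[OF f]]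
            differentiable_DERIV_y[of \<psi> x y, OF smooth_pd_differentiable(1)[OF s(1)]]]
        by (simp add: mult.commute add.commute)
    qed (use R(1) in \<open>(intro continuous_intros cont | simp)+\<close>)
    then have y: "lint ?B (\<lambda>z. f z * pdy \<psi> z) = - lint ?B (\<lambda>z. pdy f z * \<psi> z)"
      using int by (simp add: bdry)
    have "lint \<Omega> (\<lambda>z. f z * pdx \<psi> z) = lint ?B (\<lambda>z. f z * pdx \<psi> z)"
      "lint \<Omega> (\<lambda>z. pdx f z * \<psi> z) = lint ?B (\<lambda>z. pdx f z * \<psi> z)"
      "lint \<Omega> (\<lambda>z. f z * pdy \<psi> z) = lint ?B (\<lambda>z. f z * pdy \<psi> z)"
      "lint \<Omega> (\<lambda>z. pdy f z * \<psi> z) = lint ?B (\<lambda>z. pdy f z * \<psi> z)"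
      by (rule trans, rule mult_eq_0_iff[THEN iffD2], blast intro: off)+
    then show ?thesis using x y by (simp only:)
  qed
  show "is_weak_pd \<Omega> 1 0 f (pdx f)" "is_weak_pd \<Omega> 0 1 f (pdy f)"
    unfolding is_weak_pd_def using main by (auto simp: pd_def)
qed

section \<open>Linearity of weak derivatives and convergence on edges\<close>

lemma continuous_pd_test: "\<psi> \<in> test_functions \<Omega> \<Longrightarrow> continuous_on S (pd k l \<psi>)"
  unfolding test_functions_def smooth_def
  by (auto intro!: continuous_at_imp_continuous_on differentiable_imp_continuous_within)

lemma is_weak_pd_diff:
  assumes L2: "w1 \<in> L2_space \<Omega>" "w2 \<in> L2_space \<Omega>" "v1 \<in> L2_space \<Omega>" "v2 \<in> L2_space \<Omega>"
    and "is_weak_pd \<Omega> k l w1 v1" "is_weak_pd \<Omega> k l w2 v2" and \<Omega>: "bounded \<Omega>" "\<Omega> \<in> sets lebesgue"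
  shows "is_weak_pd \<Omega> k l (\<lambda>z. w1 z - w2 z) (\<lambda>z. v1 z - v2 z)"
  unfolding is_weak_pd_def
proof
  fix \<psi> assume \<psi>: "\<psi> \<in> test_functions \<Omega>"
  \<comment> \<open>The expression \<open>pd 0 0 \<psi>\<close> is \<open>\<psi>\<close> itself,
    written so that one continuity lemma serves both functions.\<close>
  have "pd k l \<psi> \<in> L2_space \<Omega>" "pd 0 0 \<psi> \<in> L2_space \<Omega>"
    by (intro L2_space_continuous_bounded \<Omega> continuous_pd_test[OF \<psi>])+
  then have "integrable (lebesgue_on \<Omega>) (\<lambda>z. w1 z * pd k l \<psi> z)" "integrable (lebesgue_on \<Omega>) (\<lambda>z. w2 z * pd k l \<psi> z)"
    "integrable (lebesgue_on \<Omega>) (\<lambda>z. v1 z * \<psi> z)" "integrable (lebesgue_on \<Omega>) (\<lambda>z. v2 z * \<psi> z)"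
    using L2 by (auto intro!: integrable_mult_L2 simp: pd_def)
  then show "lint \<Omega> (\<lambda>z. (w1 z - w2 z) * pd k l \<psi> z)
      = (- 1) ^ (k + l) * lint \<Omega> (\<lambda>z. (v1 z - v2 z) * \<psi> z)"
    using assms(5,6) \<psi> unfolding is_weak_pd_def by (simp add: left_diff_distrib right_diff_distrib)
qed

lemma weak_pd_spec:
  assumes "v \<in> L2_space \<Omega>" "is_weak_pd \<Omega> k l w v"
  shows "weak_pd \<Omega> k l w \<in> L2_space \<Omega>" "is_weak_pd \<Omega> k l w (weak_pd \<Omega> k l w)"
  using someI[of "\<lambda>v. v \<in> L2_space \<Omega> \<and> is_weak_pd \<Omega> k l w v" v] assms
  by (simp_all add: weak_pd_def)

lemma sobolev_weak_pd:
  assumes "w \<in> sobolev \<Omega> n" "k + l \<le> n"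
  shows "weak_pd \<Omega> k l w \<in> L2_space \<Omega>" "is_weak_pd \<Omega> k l w (weak_pd \<Omega> k l w)"
  using assms weak_pd_spec unfolding sobolev_def by blast+

lemma L2_norm_weak_pd_le_sobolev_norm:
  assumes "k + l \<le> n"
  shows "L2_norm \<Omega> (weak_pd \<Omega> k l w) \<le> sobolev_norm \<Omega> n w"
proof -
  have "(L2_norm \<Omega> (weak_pd \<Omega> k l w))\<^sup>2 \<le> (\<Sum>b\<le>n - k. (L2_norm \<Omega> (weak_pd \<Omega> k b w))\<^sup>2)"
    using assms by (intro member_le_sum[of l]) auto
  also have "\<dots> \<le> (\<Sum>a\<le>n. \<Sum>b\<le>n - a. (L2_norm \<Omega> (weak_pd \<Omega> a b w))\<^sup>2)"
    using assms by (intro member_le_sum[of k]) (auto intro: sum_nonneg)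
  finally show ?thesis unfolding sobolev_norm_def by (simp add: real_le_rsqrt)
qed

text \<open>Convergence in the L2 norm of the edge implies convergence of the pairing with a
  continuous function, by Cauchy-Schwarz on the unit parameter interval. This passes the boundary
  terms of Green's formula to the limit.\<close>

lemma edge_integral_tendsto:
  assumes F: "is_edge F p p'" and \<gamma>: "\<gamma> \<in> edge_L2_space F"
    and \<phi>: "\<And>n. continuous_on UNIV (\<phi> n)" "(\<lambda>n. edge_L2_norm F (\<lambda>z. \<phi> n z - \<gamma> z)) \<longlonglongrightarrow> 0"
    and q: "continuous_on UNIV q"
  shows "(\<lambda>n. edge_integral F (\<lambda>z. \<phi> n z * q z)) \<longlonglongrightarrow> edge_integral F (\<lambda>z. \<gamma> z * q z)"
proof -
  let ?l = "dist p p'" and ?I = "lint {0..1::real}"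
  note P = is_edge_props[OF F]
  define g where "g t = \<gamma> (linepath p p' t)" for t
  define f where "f n t = \<phi> n (linepath p p' t)" for n t
  define r where "r t = q (linepath p p' t)" for t
  have cL2: "h \<in> L2_space {0..1}" if "continuous_on {0..1} h" for h :: "real \<Rightarrow> real"
    using L2_space_continuous[of 0 1 h] that by simp
  have g: "g \<in> L2_space {0..1}" using \<gamma> by (simp add: edge_L2_space_def P g_def[abs_def])
  have f: "f n \<in> L2_space {0..1}" for n
    unfolding f_def[abs_def]
    by (intro cL2 continuous_on_compose2[OF \<phi>(1)] continuous_intros) auto
  have r: "r \<in> L2_space {0..1}"
    unfolding r_def[abs_def]
    by (intro cL2 continuous_on_compose2[OF q] continuous_intros) auto
  have norm: "edge_L2_norm F (\<lambda>z. \<phi> n z - \<gamma> z) = sqrt ?l * L2_norm {0..1} (\<lambda>t. f n t - g t)" for n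
    by (simp add: edge_L2_norm_def edge_integral_def P f_def g_def L2_norm_def real_sqrt_mult)
  have eq: "edge_integral F (\<lambda>z. \<phi> n z * q z) - edge_integral F (\<lambda>z. \<gamma> z * q z) = ?l * ?I (\<lambda>t. (f n t - g t) * r t)" for n
    using integrable_mult_L2[OF f r, of n] integrable_mult_L2[OF g r]
    by (simp add: edge_integral_def P f_def g_def r_def left_diff_distrib right_diff_distrib)
  have bd: "norm (edge_integral F (\<lambda>z. \<phi> n z * q z) - edge_integral F (\<lambda>z. \<gamma> z * q z))
      \<le> edge_L2_norm F (\<lambda>z. \<phi> n z - \<gamma> z) * (sqrt ?l * L2_norm {0..1} r)" for n
  proof -
    have "\<bar>?l * ?I (\<lambda>t. (f n t - g t) * r t)\<bar> \<le> ?l * (L2_norm {0..1} (\<lambda>t. f n t - g t) * L2_norm {0..1} r)"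
      using L2_Cauchy_Schwarz[OF L2_space_diff[OF f g] r, of n] by (simp add: abs_mult mult_left_mono)
    \<comment> \<open>The Jacobian is the edge length; half of it, as a square root, completes the
      edge norm and the other half goes with \<open>r\<close>.\<close>
    also have "\<dots> = (sqrt ?l * sqrt ?l) * (L2_norm {0..1} (\<lambda>t. f n t - g t) * L2_norm {0..1} r)"
      by simp
    also have "\<dots> = edge_L2_norm F (\<lambda>z. \<phi> n z - \<gamma> z) * (sqrt ?l * L2_norm {0..1} r)"
      unfolding norm by (simp only: mult_ac)
    finally show ?thesis unfolding eq by simp
  qed
  have "(\<lambda>n. edge_integral F (\<lambda>z. \<phi> n z * q z) - edge_integral F (\<lambda>z. \<gamma> z * q z)) \<longlonglongrightarrow> 0"
    by (rule Lim_null_comparison[OF always_eventually[OF allI[OF bd]] tendsto_mult_left_zero[OF \<phi>(2)]])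
  then show ?thesis by (simp add: LIM_zero_iff)
qed

lemma integral_affine_unit:
  fixes f :: "real \<Rightarrow> real"
  assumes "c < d" "continuous_on {c..d} f"
  shows "(d - c) * lint {0..1} (\<lambda>t. f (c + t * (d - c))) = lint {c..d} f"
proof -
  have "(f has_integral integral {c..d} f) (cbox c d)"
    using assms by (simp add: integrable_integral integrable_continuous_interval)
  from has_integral_affinity'[OF this, of "d - c" c] assms(1)
  have "((\<lambda>x. f ((d - c) * x + c)) has_integral integral {c..d} f / (d - c)) {0..1}"
    by (simp add: divide_inverse mult.commute)
  then have "integral {0..1} (\<lambda>t. f (c + t * (d - c))) = integral {c..d} f / (d - c)"
    by (intro integral_unique) (simp add: mult.commute add.commute)
  moreover have "continuous_on {0..1} (\<lambda>t. f (c + t * (d - c)))"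
  proof (rule continuous_on_compose2[OF assms(2)])
    show "(\<lambda>t. c + t * (d - c)) ` {0..1} \<subseteq> {c..d}"
    proof safe
      fix t :: real assume "t \<in> {0..1}"
      then have "0 \<le> t * (d - c)" "t * (d - c) \<le> 1 * (d - c)"
        using assms(1) by (auto intro: mult_right_mono)
      then show "c + t * (d - c) \<in> {c..d}" by simp
    qed
  qed (intro continuous_intros)
  ultimately show ?thesis
    using assms integral_continuous_lebesgue_on[of 0 1 "\<lambda>t. f (c + t * (d - c))"]
      integral_continuous_lebesgue_on[of c d f] by simp
qed

section \<open>The discrete gradient as a projection\<close>

text \<open>Functions in \<open>edge_poly\<close> are restricted to the edge, whereas a normal
  component is defined on the plane; hence \<open>g\<close> is only required to agree on
  \<open>F\<close> with a polynomial in arc length.\<close>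

lemma edge_integral_projection:
  assumes F: "is_edge F p p'" and \<gamma>: "\<gamma> \<in> edge_L2_space F" and v: "v \<in> edge_poly k F"
    and orth: "\<And>q. q \<in> edge_poly k F \<Longrightarrow> edge_integral F (\<lambda>z. (\<gamma> z - v z) * q z) = 0"
    and g: "degree r \<le> k" "\<And>z. z \<in> F \<Longrightarrow> g z = poly r (dist p z)"
  shows "edge_integral F (\<lambda>z. v z * g z) = edge_integral F (\<lambda>z. \<gamma> z * g z)"
proof -
  let ?l = "dist p p'"
  note P = is_edge_props[OF F]
  obtain s where s: "v = restrict (\<lambda>z. poly s (dist p z)) F" using v by (auto simp: edge_poly_def P)
  have v_path: "v (linepath p p' t) = poly s (?l * t)" and g_path: "g (linepath p p' t) = poly r (?l * t)"
    if "t \<in> {0..1}" for t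
    using P(5,6)[OF that] g(2) by (simp_all add: s)
  have cL2: "h \<in> L2_space {0..1}" if "continuous_on {0..1} h" for h :: "real \<Rightarrow> real"
    using L2_space_continuous[of 0 1 h] that by simp
  let ?\<gamma> = "\<lambda>t. \<gamma> (linepath p p' t)"
  have int: "integrable (lebesgue_on {0..1}) (\<lambda>t. ?\<gamma> t * poly r (?l * t))"
    "integrable (lebesgue_on {0..1}) (\<lambda>t. poly s (?l * t) * poly r (?l * t))"
    using \<gamma> by (auto intro!: integrable_mult_L2 cL2 continuous_intros simp: edge_L2_space_def P)
  have "restrict (\<lambda>z. poly r (dist p z)) F \<in> edge_poly k F"
    using g(1) by (auto simp: edge_poly_def P)
  from orth[OF this] have "?l * lint {0..1} (\<lambda>t. (?\<gamma> t - poly s (?l * t)) * poly r (?l * t)) = 0"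
    by (subst (asm) edge_integral_cong[OF F, where g="\<lambda>t. (?\<gamma> t - poly s (?l * t)) * poly r (?l * t)"])
      (use P(5,6) in \<open>simp_all add: s\<close>)
  then have "lint {0..1} (\<lambda>t. ?\<gamma> t * poly r (?l * t))
      = lint {0..1} (\<lambda>t. poly s (?l * t) * poly r (?l * t))"
    using int P(4) by (simp add: left_diff_distrib)
  moreover have "edge_integral F (\<lambda>z. v z * g z) = ?l * lint {0..1} (\<lambda>t. poly s (?l * t) * poly r (?l * t))"
    by (rule edge_integral_cong[OF F]) (simp add: v_path g_path)
  moreover have "edge_integral F (\<lambda>z. \<gamma> z * g z) = ?l * lint {0..1} (\<lambda>t. ?\<gamma> t * poly r (?l * t))"
    by (rule edge_integral_cong[OF F]) (simp add: g_path)
  ultimately show ?thesis by simp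
qed

context subrectangle
begin

lemma box_nonempty: "box (a, c) (b, d) \<noteq> {}"
  using ab cd by (auto simp: box_Pair_real)

lemma measurable_K: "K \<in> sets lebesgue" by simp

lemma L2_norm_K_le:
  fixes f :: "plane \<Rightarrow> real"
  assumes "f \<in> L2_space \<Omega>"
  shows "L2_norm K f \<le> L2_norm \<Omega> f"
proof -
  have "lint K (\<lambda>z. (f z)\<^sup>2) = lint (box (a, c) (b, d)) (\<lambda>z. (f z)\<^sup>2)"
    by (intro lebesgue_on_null_eq) (use interior_cbox_Pair_null in auto)
  also have "\<dots> \<le> lint \<Omega> (\<lambda>z. (f z)\<^sup>2)"
    using assms box_subset domain_measurable interior_cbox_Pair_null(1)
    by (intro integral_mono_lebesgue_on_AE) (auto simp: L2_space_real)
  finally show ?thesis by (simp add: L2_norm_def)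
qed

text \<open>The hypothesis \<open>lim\<close> concerns the derivative picked for the difference,
  while the conclusion concerns the difference of given derivatives. Against polynomials on
  \<open>K\<close> the two agree by \<open>weak_pd_unique_poly\<close>, and Cauchy-Schwarz finishes
  the argument.\<close>

lemma weak_pd_tendsto_poly2:
  assumes bdd: "bounded \<Omega>"
    and \<phi>: "\<And>n. \<phi> n \<in> L2_space \<Omega>" "\<And>n. \<delta> n \<in> L2_space \<Omega>" "\<And>n. is_weak_pd \<Omega> k l (\<phi> n) (\<delta> n)"
    and w: "w \<in> L2_space \<Omega>" "v \<in> L2_space \<Omega>" "is_weak_pd \<Omega> k l w v"
    and lim: "(\<lambda>n. L2_norm \<Omega> (weak_pd \<Omega> k l (\<lambda>z. \<phi> n z - w z))) \<longlonglongrightarrow> 0"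
  shows "(\<lambda>n. lint K (\<lambda>z. \<delta> n z * poly2 L z)) \<longlonglongrightarrow> lint K (\<lambda>z. v z * poly2 L z)"
proof -
  define A where "A n = weak_pd \<Omega> k l (\<lambda>z. \<phi> n z - w z)" for n
  have dv: "(\<lambda>z. \<delta> n z - v z) \<in> L2_space \<Omega>" "is_weak_pd \<Omega> k l (\<lambda>z. \<phi> n z - w z) (\<lambda>z. \<delta> n z - v z)" for n
    by (rule L2_space_diff[OF \<phi>(2) w(2)],
        rule is_weak_pd_diff[OF \<phi>(1) w(1) \<phi>(2) w(2) \<phi>(3) w(3) bdd domain_measurable])
  note A = weak_pd_spec[OF dv, folded A_def]
  have eq: "lint K (\<lambda>z. \<delta> n z * poly2 L z) - lint K (\<lambda>z. v z * poly2 L z)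
      = lint K (\<lambda>z. A n z * poly2 L z)" for n
  proof -
    have "lint K (\<lambda>z. A n z * poly2 L z) = lint K (\<lambda>z. (\<delta> n z - v z) * poly2 L z)"
      unfolding integral_mult_poly2[OF L2_space_K[OF A(1)]] integral_mult_poly2[OF L2_space_K[OF dv(1)]]
      using weak_pd_unique_poly[OF A(1) dv(1) A(2) dv(2)] by simp
    then show ?thesis
      using integrable_mult_L2[OF L2_space_K[OF \<phi>(2)] L2_space_poly2] integrable_mult_L2[OF L2_space_K[OF w(2)] L2_space_poly2]
      by (simp add: left_diff_distrib)
  qed
  have bd: "norm (lint K (\<lambda>z. \<delta> n z * poly2 L z) - lint K (\<lambda>z. v z * poly2 L z))
      \<le> L2_norm \<Omega> (A n) * L2_norm K (poly2 L)" for n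
  proof -
    have "\<bar>lint K (\<lambda>z. A n z * poly2 L z)\<bar> \<le> L2_norm K (A n) * L2_norm K (poly2 L)"
      by (intro L2_Cauchy_Schwarz L2_space_K A L2_space_poly2)
    also have "\<dots> \<le> L2_norm \<Omega> (A n) * L2_norm K (poly2 L)"
      by (intro mult_right_mono L2_norm_K_le A) simp
    finally show ?thesis unfolding eq by simp
  qed
  have "(\<lambda>n. lint K (\<lambda>z. \<delta> n z * poly2 L z) - lint K (\<lambda>z. v z * poly2 L z)) \<longlonglongrightarrow> 0"
    by (rule Lim_null_comparison[OF always_eventually[OF allI[OF bd]] tendsto_mult_left_zero])
      (use lim in \<open>simp add: A_def\<close>)
  then show ?thesis by (simp add: LIM_zero_iff)
qed

lemma sides_K:
  "sides K = {(cbox (a, c) (a, d), (- 1, 0)), (cbox (b, c) (b, d), (1, 0)),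
        (cbox (a, c) (b, c), (0, - 1)), (cbox (a, d) (b, d), (0, 1))}"
proof -
  have "\<forall>i\<in>Basis. (a, c) \<bullet> i \<le> (b, d) \<bullet> i" using ab cd by (auto simp: Basis_prod_def)
  then have "interval_lowerbound K = (a, c)" "interval_upperbound K = (b, d)" by auto
  then show ?thesis by (simp add: sides_def)
qed

lemma sum_sides_K:
  "(\<Sum>(F, n)\<in>sides K. g F n) = g (cbox (a, c) (a, d)) (- 1, 0) + g (cbox (b, c) (b, d)) (1, 0)
     + g (cbox (a, c) (b, c)) (0, - 1) + g (cbox (a, d) (b, d)) (0, 1 :: real)" for g :: "plane set \<Rightarrow> plane \<Rightarrow> real"
  unfolding sides_K by simp

lemma is_edge_K:
  "is_edge (cbox (a, c) (a, d)) (a, c) (a, d)" "is_edge (cbox (b, c) (b, d)) (b, c) (b, d)"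
  "is_edge (cbox (a, c) (b, c)) (a, c) (b, c)" "is_edge (cbox (a, d) (b, d)) (a, d) (b, d)"
  using ab cd by (auto simp: is_edge_def)

lemma edge_integral_vertical:
  assumes "is_edge (cbox (x, c) (x, d)) (x, c) (x, d)" "continuous_on UNIV f"
  shows "edge_integral (cbox (x, c) (x, d)) f = lint {c..d} (\<lambda>y. f (x, y))"
proof -
  have "edge_integral (cbox (x, c) (x, d)) f
      = dist (x, c) (x, d) * lint {0..1} (\<lambda>t. f (x, c + t * (d - c)))"
    by (rule edge_integral_cong[OF assms(1)]) (simp add: linepath_def algebra_simps)
  also have "dist (x, c) (x, d) = d - c" using cd by (simp add: dist_Pair_Pair dist_real_def)
  also have "(d - c) * lint {0..1} (\<lambda>t. f (x, c + t * (d - c)))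
      = lint {c..d} (\<lambda>y. f (x, y))"
    by (intro integral_affine_unit cd continuous_on_compose2[OF assms(2)] continuous_intros) auto
  finally show ?thesis .
qed

lemma edge_integral_horizontal:
  assumes "is_edge (cbox (a, y) (b, y)) (a, y) (b, y)" "continuous_on UNIV f"
  shows "edge_integral (cbox (a, y) (b, y)) f = lint {a..b} (\<lambda>x. f (x, y))"
proof -
  have "edge_integral (cbox (a, y) (b, y)) f
      = dist (a, y) (b, y) * lint {0..1} (\<lambda>t. f (a + t * (b - a), y))"
    by (rule edge_integral_cong[OF assms(1)]) (simp add: linepath_def algebra_simps)
  also have "dist (a, y) (b, y) = b - a" using ab by (simp add: dist_Pair_Pair dist_real_def)
  also have "(b - a) * lint {0..1} (\<lambda>t. f (a + t * (b - a), y))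
      = lint {a..b} (\<lambda>x. f (x, y))"
    by (intro integral_affine_unit[where f="\<lambda>x. f (x, y)"] ab continuous_on_compose2[OF assms(2)] continuous_intros) auto
  finally show ?thesis .
qed

text \<open>The divergence theorem for the field \<open>(poly2 L1, poly2 L2)\<close> multiplied by
  \<open>f\<close>. The left side is kept as four separate integrals because each of them passes to
  the limit on its own.\<close>

lemma green_smooth:
  assumes f: "smooth f"
  shows "lint K (\<lambda>z. f z * poly2 (dx_list L1) z) + lint K (\<lambda>z. f z * poly2 (dy_list L2) z)
    + lint K (\<lambda>z. pdx f z * poly2 L1 z) + lint K (\<lambda>z. pdy f z * poly2 L2 z)
    = (\<Sum>(F, n)\<in>sides K. edge_integral F (\<lambda>z. f z * ((poly2 L1 z, poly2 L2 z) \<bullet> n)))"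
proof -
  note cont = smooth_continuous[OF f] continuous_on_poly2
  have "lint K (\<lambda>z. f z * poly2 (dx_list L1) z + pdx f z * poly2 L1 z)
      = lint {c..d} (\<lambda>y. f (b, y) * poly2 L1 (b, y) - f (a, y) * poly2 L1 (a, y))"
  proof (rule integral_dx_rectangle)
    show "((\<lambda>x. f (x, y) * poly2 L1 (x, y)) has_real_derivative
        f (x, y) * poly2 (dx_list L1) (x, y) + pdx f (x, y) * poly2 L1 (x, y)) (at x)" for x y
      using DERIV_mult[OF differentiable_DERIV_x[of f x y, OF smooth_pd_differentiable(1)[OF f]] poly2_DERIV_x[of L1 y x]]
      by (simp add: mult.commute add.commute)
  qed (use ab in \<open>(intro continuous_intros cont | simp)+\<close>)
  moreover have "lint K (\<lambda>z. f z * poly2 (dy_list L2) z + pdy f z * poly2 L2 z)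
      = lint {a..b} (\<lambda>x. f (x, d) * poly2 L2 (x, d) - f (x, c) * poly2 L2 (x, c))"
  proof (rule integral_dy_rectangle)
    show "((\<lambda>y. f (x, y) * poly2 L2 (x, y)) has_real_derivative
        f (x, y) * poly2 (dy_list L2) (x, y) + pdy f (x, y) * poly2 L2 (x, y)) (at y)" for x y
      using DERIV_mult[OF differentiable_DERIV_y[of f x y, OF smooth_pd_differentiable(1)[OF f]] poly2_DERIV_y[of L2 x y]]
      by (simp add: mult.commute add.commute)
  qed (use cd in \<open>(intro continuous_intros cont | simp)+\<close>)
  moreover have "integrable (lebesgue_on K) (\<lambda>z. f z * poly2 (dx_list L1) z)" "integrable (lebesgue_on K) (\<lambda>z. pdx f z * poly2 L1 z)"
    "integrable (lebesgue_on K) (\<lambda>z. f z * poly2 (dy_list L2) z)" "integrable (lebesgue_on K) (\<lambda>z. pdy f z * poly2 L2 z)"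
    by (intro continuous_imp_integrable continuous_intros cont)+
  moreover have "integrable (lebesgue_on (cbox c d)) (\<lambda>y. f (x, y) * poly2 L1 (x, y))"
    "integrable (lebesgue_on (cbox a b)) (\<lambda>x. f (x, y) * poly2 L2 (x, y))" for x y
    by (intro continuous_imp_integrable continuous_intros continuous_on_sections_poly2
        continuous_on_compose2[OF smooth_continuous(1)[OF f, of UNIV]]; simp)+
  moreover have "(\<Sum>(F, n)\<in>sides K. edge_integral F (\<lambda>z. f z * ((poly2 L1 z, poly2 L2 z) \<bullet> n)))
      = lint {c..d} (\<lambda>y. f (a, y) * - poly2 L1 (a, y))
      + lint {c..d} (\<lambda>y. f (b, y) * poly2 L1 (b, y))
      + lint {a..b} (\<lambda>x. f (x, c) * - poly2 L2 (x, c))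
      + lint {a..b} (\<lambda>x. f (x, d) * poly2 L2 (x, d))"
    unfolding sum_sides_K
    by (simp add: edge_integral_vertical edge_integral_horizontal is_edge_K continuous_intros cont)
  ultimately show ?thesis by simp
qed

lemma trace_green:
  assumes bdd: "bounded \<Omega>" and w: "w \<in> sobolev \<Omega> (Suc m)"
    and tr: "is_trace \<Omega> E w \<gamma>" and E: "fst ` sides K \<subseteq> E"
  shows "lint K (\<lambda>z. w z * poly2 (dx_list L1) z) + lint K (\<lambda>z. w z * poly2 (dy_list L2) z)
    + lint K (\<lambda>z. weak_pd \<Omega> 1 0 w z * poly2 L1 z) + lint K (\<lambda>z. weak_pd \<Omega> 0 1 w z * poly2 L2 z)
    = (\<Sum>(F, n)\<in>sides K. edge_integral F (\<lambda>z. \<gamma> z * ((poly2 L1 z, poly2 L2 z) \<bullet> n)))"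
proof -
  obtain \<phi> where \<phi>: "\<And>n. smooth (\<phi> n)" "(\<lambda>n. sobolev_norm \<Omega> 1 (\<lambda>z. \<phi> n z - w z)) \<longlonglongrightarrow> 0"
    "\<And>F. F \<in> E \<Longrightarrow> (\<lambda>n. edge_L2_norm F (\<lambda>z. \<phi> n z - \<gamma> z)) \<longlonglongrightarrow> 0"
    and \<gamma>: "\<And>F. F \<in> E \<Longrightarrow> \<gamma> \<in> edge_L2_space F"
    using tr unfolding is_trace_def by blast
  have wL2: "w \<in> L2_space \<Omega>" using w by (simp add: sobolev_def)
  have \<phi>L2: "\<phi> n \<in> L2_space \<Omega>" "pdx (\<phi> n) \<in> L2_space \<Omega>" "pdy (\<phi> n) \<in> L2_space \<Omega>" for n
    by (intro L2_space_continuous_bounded bdd domain_measurable smooth_continuous \<phi>)+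
  have lim: "(\<lambda>n. L2_norm \<Omega> (weak_pd \<Omega> k l (\<lambda>z. \<phi> n z - w z))) \<longlonglongrightarrow> 0" if "k + l \<le> 1" for k l
    by (rule tendsto_sandwich[OF _ _ tendsto_const \<phi>(2)])
      (use L2_norm_weak_pd_le_sobolev_norm[OF that] in \<open>auto intro: always_eventually\<close>)
  \<comment> \<open>Every function is its own weak derivative of order zero, so convergence of the
    functions themselves is the instance \<open>k = l = 0\<close> of the convergence of
    derivatives.\<close>
  have triv: "is_weak_pd \<Omega> 0 0 u u" for u by (simp add: is_weak_pd_def pd_def)
  note swp = sobolev_weak_pd[OF w]
  have l0: "(\<lambda>n. lint K (\<lambda>z. \<phi> n z * poly2 L z)) \<longlonglongrightarrow> lint K (\<lambda>z. w z * poly2 L z)" for L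
    by (rule weak_pd_tendsto_poly2[OF bdd \<phi>L2(1) \<phi>L2(1) triv wL2 wL2 triv lim]) simp
  have l1: "(\<lambda>n. lint K (\<lambda>z. pdx (\<phi> n) z * poly2 L1 z))
      \<longlonglongrightarrow> lint K (\<lambda>z. weak_pd \<Omega> 1 0 w z * poly2 L1 z)"
    by (rule weak_pd_tendsto_poly2[OF bdd \<phi>L2(1,2) is_weak_pd_smooth(1)[OF \<phi>(1) domain_measurable] wL2 swp lim]) simp_all
  have l2: "(\<lambda>n. lint K (\<lambda>z. pdy (\<phi> n) z * poly2 L2 z))
      \<longlonglongrightarrow> lint K (\<lambda>z. weak_pd \<Omega> 0 1 w z * poly2 L2 z)"
    by (rule weak_pd_tendsto_poly2[OF bdd \<phi>L2(1,3) is_weak_pd_smooth(2)[OF \<phi>(1) domain_measurable] wL2 swp lim]) simp_all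
  have edge: "(\<lambda>k. edge_integral F (\<lambda>z. \<phi> k z * ((poly2 L1 z, poly2 L2 z) \<bullet> n)))
      \<longlonglongrightarrow> edge_integral F (\<lambda>z. \<gamma> z * ((poly2 L1 z, poly2 L2 z) \<bullet> n))" if FS: "(F, n) \<in> sides K" for F n
  proof -
    have FE: "F \<in> E" using E FS by force
    have "\<exists>p p'. is_edge F p p'" using FS is_edge_K unfolding sides_K by blast
    then obtain p p' where F: "is_edge F p p'" by blast
    show ?thesis
      by (intro edge_integral_tendsto[OF F \<gamma>[OF FE] _ \<phi>(3)[OF FE]] smooth_continuous \<phi>
          continuous_intros)
  qed
  have "(\<lambda>k. \<Sum>(F, n)\<in>sides K. edge_integral F (\<lambda>z. \<phi> k z * ((poly2 L1 z, poly2 L2 z) \<bullet> n)))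
      \<longlonglongrightarrow> (\<Sum>(F, n)\<in>sides K. edge_integral F (\<lambda>z. \<gamma> z * ((poly2 L1 z, poly2 L2 z) \<bullet> n)))"
    using edge by (intro tendsto_sum) auto
  moreover have "(\<lambda>k. \<Sum>(F, n)\<in>sides K. edge_integral F (\<lambda>z. \<phi> k z * ((poly2 L1 z, poly2 L2 z) \<bullet> n))) \<longlonglongrightarrow>
    lint K (\<lambda>z. w z * poly2 (dx_list L1) z) + lint K (\<lambda>z. w z * poly2 (dy_list L2) z)
    + lint K (\<lambda>z. weak_pd \<Omega> 1 0 w z * poly2 L1 z) + lint K (\<lambda>z. weak_pd \<Omega> 0 1 w z * poly2 L2 z)"
    unfolding green_smooth[OF \<phi>(1), symmetric] by (intro tendsto_add l0 l1 l2)
  ultimately show ?thesis using LIMSEQ_unique by blast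
qed

lemma interior_projection_unique:
  assumes w: "w \<in> L2_space K"
  shows "\<exists>!p. p \<in> interior_space el j \<and> (\<forall>q\<in>interior_space el j. lint K (\<lambda>z. (w z - p z) * q z) = 0)"
proof -
  let ?V = "interior_space el j"
  have L2: "q \<in> L2_space K" if "q \<in> ?V" for q
    using that interior_space_range_poly2[of el j] L2_space_poly2 by auto
  have "\<exists>!p. p \<in> ?V \<and> (\<forall>q\<in>?V. lint K (\<lambda>z. p z \<bullet> q z) = lint K (\<lambda>z. w z * q z))"
  proof (rule L2_projection_exists_unique[OF finite_dim_interior_space])
    show "continuous_on K f" if "f \<in> ?V" for f
      using that interior_space_range_poly2[of el j] continuous_on_poly2 by auto
    show "f = (\<lambda>z. 0)" if f: "f \<in> ?V" "\<And>z. z \<in> K \<Longrightarrow> f z = 0" for f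
    proof -
      have "f \<in> range poly2" using f(1) interior_space_range_poly2 by blast
      then obtain L where "f = poly2 L" by blast
      then show ?thesis using poly2_zero_on_rectangle[OF ab cd] f(2) by simp
    qed
    show "lint K (\<lambda>z. w z * (t *\<^sub>R f z + g z))
        = t * lint K (\<lambda>z. w z * f z) + lint K (\<lambda>z. w z * g z)"
      if "f \<in> ?V" "g \<in> ?V" for f g t
      using integrable_mult_L2[OF w L2[OF that(1)]] integrable_mult_L2[OF w L2[OF that(2)]]
      by (simp add: distrib_left mult.left_commute[of _ t])
  qed (rule box_nonempty)
  moreover have "(lint K (\<lambda>z. p z \<bullet> q z) = lint K (\<lambda>z. w z * q z))
      \<longleftrightarrow> lint K (\<lambda>z. (w z - p z) * q z) = 0" if "p \<in> ?V" "q \<in> ?V" for p q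
    using integrable_mult_L2[OF w L2[OF that(2)]] integrable_mult_L2[OF L2[OF that(1)] L2[OF that(2)]]
    by (auto simp: left_diff_distrib)
  then have "(p \<in> ?V \<and> (\<forall>q\<in>?V. lint K (\<lambda>z. p z \<bullet> q z) = lint K (\<lambda>z. w z * q z)))
      \<longleftrightarrow> (p \<in> ?V \<and> (\<forall>q\<in>?V. lint K (\<lambda>z. (w z - p z) * q z) = 0))" for p
    by blast
  ultimately show ?thesis by (simp only:)
qed

lemma local_grad_rhs:
  assumes bdd: "bounded \<Omega>" and w: "w \<in> sobolev \<Omega> (Suc m)"
    and tr: "is_trace \<Omega> E w \<gamma>" and E: "fst ` sides K \<subseteq> E"
    and v0: "v0 \<in> interior_space el j" "\<And>q. q \<in> interior_space el j \<Longrightarrow> lint K (\<lambda>z. (w z - v0 z) * q z) = 0"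
    and vb: "\<And>F. F \<in> E \<Longrightarrow> vb F \<in> edge_space el j F"
      "\<And>F q. F \<in> E \<Longrightarrow> q \<in> edge_space el j F \<Longrightarrow> edge_integral F (\<lambda>z. (\<gamma> z - vb F z) * q z) = 0"
    and q: "q \<in> grad_space el j"
  shows "- lint K (\<lambda>z. v0 z * div2 q z) + (\<Sum>(F, n)\<in>sides K. edge_integral F (\<lambda>z. vb F z * (q z \<bullet> n)))
    = lint K (\<lambda>z. weak_grad \<Omega> w z \<bullet> q z)"
proof -
  note qp = grad_space_props[OF q]
  obtain L1 L2 where L: "(\<lambda>z. fst (q z)) = poly2 L1" "(\<lambda>z. snd (q z)) = poly2 L2" using qp(1,2) by auto
  have q_eq: "q z = (poly2 L1 z, poly2 L2 z)" for z
    using fun_cong[OF L(1), of z] fun_cong[OF L(2), of z] by (simp add: prod_eq_iff)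
  have div: "div2 q z = poly2 (dx_list L1) z + poly2 (dy_list L2) z" for z
    unfolding div2_def L pdx_poly2 pdy_poly2 ..
  have \<gamma>: "\<gamma> \<in> edge_L2_space F" if "F \<in> E" for F using tr that by (simp add: is_trace_def)
  have wK: "w \<in> L2_space K" using w by (intro L2_space_K) (simp add: sobolev_def)
  have v0K: "v0 \<in> L2_space K" using v0(1) interior_space_range_poly2[of el j] L2_space_poly2 by auto
  have gK: "weak_pd \<Omega> 1 0 w \<in> L2_space K" "weak_pd \<Omega> 0 1 w \<in> L2_space K"
    using sobolev_weak_pd(1)[OF w] by (auto intro: L2_space_K)
  have divK: "div2 q \<in> L2_space K" using qp(3) interior_space_range_poly2[of el j] L2_space_poly2 by auto
  have int: "lint K (\<lambda>z. v0 z * div2 q z) = lint K (\<lambda>z. w z * div2 q z)"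
    using v0(2)[OF qp(3)] integrable_mult_L2[OF wK divK] integrable_mult_L2[OF v0K divK]
    by (simp add: left_diff_distrib)
  let ?k = "edge_degree el j"
  have edge: "edge_integral F (\<lambda>z. vb F z * (q z \<bullet> n)) = edge_integral F (\<lambda>z. \<gamma> z * (q z \<bullet> n))"
    if F: "is_edge F p p'" "F \<in> E" and "degree r \<le> ?k" "\<And>z. z \<in> F \<Longrightarrow> q z \<bullet> n = poly r (dist p z)" for F n p p' r
    using edge_integral_projection[OF F(1) \<gamma>[OF F(2)], of "vb F" ?k r "\<lambda>z. q z \<bullet> n"] vb[OF F(2)] that(3,4)
    unfolding edge_space_eq by blast
  have vert: "edge_integral (cbox (x, c) (x, d)) (\<lambda>z. vb (cbox (x, c) (x, d)) z * (q z \<bullet> (s, 0)))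
      = edge_integral (cbox (x, c) (x, d)) (\<lambda>z. \<gamma> z * (q z \<bullet> (s, 0)))"
    if F: "is_edge (cbox (x, c) (x, d)) (x, c) (x, d)" "cbox (x, c) (x, d) \<in> E" for x s
  proof -
    obtain r where r: "degree r \<le> ?k" "\<And>y. fst (q (x, y)) = poly r y"
      using qp(4) unfolding degree_y_def by blast
    \<comment> \<open>Arc length on a vertical edge is \<open>y - c\<close>, so the coordinate
      polynomial is composed with the translation by \<open>c\<close>; \<open>s\<close> carries the
      sign of the outward normal.\<close>
    show ?thesis
    proof (rule edge[OF F, of "smult s (pcompose r [:c, 1:])"])
      show "degree (smult s (pcompose r [:c, 1:])) \<le> ?k"
        using r(1) degree_smult_le[of s "pcompose r [:c, 1:]"] by (simp add: degree_pcompose)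
      fix z assume "z \<in> cbox (x, c) (x, d)"
      then obtain y where "z = (x, y)" "c \<le> y" by (cases z) (auto simp: cbox_Pair_eq)
      then show "q z \<bullet> (s, 0) = poly (smult s (pcompose r [:c, 1:])) (dist (x, c) z)"
        using r(2)[of y] by (cases "q (x, y)") (simp add: poly_pcompose dist_Pair_Pair dist_real_def mult.commute)
    qed
  qed
  have horiz: "edge_integral (cbox (a, y) (b, y)) (\<lambda>z. vb (cbox (a, y) (b, y)) z * (q z \<bullet> (0, s)))
      = edge_integral (cbox (a, y) (b, y)) (\<lambda>z. \<gamma> z * (q z \<bullet> (0, s)))"
    if F: "is_edge (cbox (a, y) (b, y)) (a, y) (b, y)" "cbox (a, y) (b, y) \<in> E" for y s
  proof -
    obtain r where r: "degree r \<le> ?k" "\<And>x. snd (q (x, y)) = poly r x"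
      using qp(5) unfolding degree_x_def by blast
    show ?thesis
    proof (rule edge[OF F, of "smult s (pcompose r [:a, 1:])"])
      show "degree (smult s (pcompose r [:a, 1:])) \<le> ?k"
        using r(1) degree_smult_le[of s "pcompose r [:a, 1:]"] by (simp add: degree_pcompose)
      fix z assume "z \<in> cbox (a, y) (b, y)"
      then obtain x where "z = (x, y)" "a \<le> x" by (cases z) (auto simp: cbox_Pair_eq)
      then show "q z \<bullet> (0, s) = poly (smult s (pcompose r [:a, 1:])) (dist (a, y) z)"
        using r(2)[of x] by (cases "q (x, y)") (simp add: poly_pcompose dist_Pair_Pair dist_real_def mult.commute)
    qed
  qed
  have Es: "cbox (a, c) (a, d) \<in> E" "cbox (b, c) (b, d) \<in> E" "cbox (a, c) (b, c) \<in> E" "cbox (a, d) (b, d) \<in> E"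
    using E unfolding sides_K by auto
  have "(\<Sum>(F, n)\<in>sides K. edge_integral F (\<lambda>z. vb F z * (q z \<bullet> n))) = (\<Sum>(F, n)\<in>sides K. edge_integral F (\<lambda>z. \<gamma> z * (q z \<bullet> n)))"
    unfolding sum_sides_K using vert[OF is_edge_K(1) Es(1)] vert[OF is_edge_K(2) Es(2)]
      horiz[OF is_edge_K(3) Es(3)] horiz[OF is_edge_K(4) Es(4)] by simp
  also have "\<dots> = lint K (\<lambda>z. w z * poly2 (dx_list L1) z) + lint K (\<lambda>z. w z * poly2 (dy_list L2) z)
    + lint K (\<lambda>z. weak_pd \<Omega> 1 0 w z * poly2 L1 z) + lint K (\<lambda>z. weak_pd \<Omega> 0 1 w z * poly2 L2 z)"
    unfolding q_eq by (rule trace_green[OF bdd w tr E, symmetric])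
  also have "lint K (\<lambda>z. w z * poly2 (dx_list L1) z) + lint K (\<lambda>z. w z * poly2 (dy_list L2) z)
      = lint K (\<lambda>z. w z * div2 q z)"
    using integrable_mult_L2[OF wK L2_space_poly2] by (simp add: div distrib_left)
  finally show ?thesis
    using integrable_mult_L2[OF gK(1) L2_space_poly2] integrable_mult_L2[OF gK(2) L2_space_poly2]
    by (simp add: int weak_grad_def q_eq)
qed

end

section \<open>Error estimate\<close>

context subrectangle
begin

text \<open>\<open>disc_grad\<close> is 0 on the edges, so on a closed element its agreement with
  the local gradient is guaranteed only in the interior; for integrals this is enough.\<close>

lemma integral_K_interior_cong:
  fixes f g :: "plane \<Rightarrow> real"
  assumes "\<And>z. z \<in> box (a, c) (b, d) \<Longrightarrow> f z = g z"
  shows "lint K f = lint K g"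
    and "integrable (lebesgue_on K) f \<longleftrightarrow> integrable (lebesgue_on K) g"
proof -
  note eq = lebesgue_on_null_eq[OF measurable_K interior_cbox_Pair_null]
  have "lint (box (a, c) (b, d)) f = lint (box (a, c) (b, d)) g"
    using assms by (intro Bochner_Integration.integral_cong) auto
  then show "lint K f = lint K g"
    by (simp add: eq(2))
  have "integrable (lebesgue_on (box (a, c) (b, d))) f \<longleftrightarrow> integrable (lebesgue_on (box (a, c) (b, d))) g"
    using assms by (intro Bochner_Integration.integrable_cong) auto
  then show "integrable (lebesgue_on K) f \<longleftrightarrow> integrable (lebesgue_on K) g"
    by (simp add: eq(1))
qed

text \<open>Pythagoras: \<open>G - g\<close> is orthogonal to \<open>V\<close>, and
  \<open>q - G\<close> belongs to \<open>V\<close>, so replacing \<open>G\<close> by any other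
  \<open>q\<close> in \<open>V\<close> cannot decrease the distance to \<open>g\<close>.\<close>

lemma best_approximation:
  fixes G g q :: "plane \<Rightarrow> plane"
  assumes V: "function_space V" and GV: "G \<in> V" and qV: "q \<in> V"
    and L2: "\<And>f. f \<in> V \<Longrightarrow> (\<lambda>z. fst (f z)) \<in> L2_space K \<and> (\<lambda>z. snd (f z)) \<in> L2_space K"
      "(\<lambda>z. fst (g z)) \<in> L2_space K" "(\<lambda>z. snd (g z)) \<in> L2_space K"
    and proj: "\<And>q. q \<in> V \<Longrightarrow> lint K (\<lambda>z. G z \<bullet> q z) = lint K (\<lambda>z. g z \<bullet> q z)"
  shows "integrable (lebesgue_on K) (\<lambda>z. (norm (G z - g z))\<^sup>2)"
    and "lint K (\<lambda>z. (norm (G z - g z))\<^sup>2) \<le> (L2_norm K (\<lambda>z. fst (g z) - fst (q z)))\<^sup>2 + (L2_norm K (\<lambda>z. snd (g z) - snd (q z)))\<^sup>2"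
proof -
  let ?I = "lint K"
  have int: "integrable (lebesgue_on K) (\<lambda>z. f z \<bullet> h z)"
    if "(\<lambda>z. fst (f z)) \<in> L2_space K" "(\<lambda>z. snd (f z)) \<in> L2_space K"
      "(\<lambda>z. fst (h z)) \<in> L2_space K" "(\<lambda>z. snd (h z)) \<in> L2_space K" for f h :: "plane \<Rightarrow> plane"
    using integrable_mult_L2[OF that(1,3)] integrable_mult_L2[OF that(2,4)]
    by (simp add: inner_prod_def)
  have GL: "(\<lambda>z. fst (G z)) \<in> L2_space K" "(\<lambda>z. snd (G z)) \<in> L2_space K"
    and qL: "(\<lambda>z. fst (q z)) \<in> L2_space K" "(\<lambda>z. snd (q z)) \<in> L2_space K"
    using L2(1)[OF GV] L2(1)[OF qV] by auto
  have Gg: "integrable (lebesgue_on K) (\<lambda>z. (G z - g z) \<bullet> (G z - g z))"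
    and gq: "integrable (lebesgue_on K) (\<lambda>z. (g z - q z) \<bullet> (g z - q z))"
    and Gq: "integrable (lebesgue_on K) (\<lambda>z. (G z - q z) \<bullet> (G z - q z))"
    by (intro int; simp add: L2_space_diff GL qL L2(2,3))+
  then show "integrable (lebesgue_on K) (\<lambda>z. (norm (G z - g z))\<^sup>2)"
    by (simp add: power2_norm_eq_inner)
  have D: "(\<lambda>z. q z - G z) \<in> V" by (rule function_space_diff[OF V qV GV])
  have i1: "integrable (lebesgue_on K) (\<lambda>z. G z \<bullet> (q z - G z))" "integrable (lebesgue_on K) (\<lambda>z. g z \<bullet> (q z - G z))"
    by (intro int; simp add: L2_space_diff GL qL L2(2,3))+
  have orth: "?I (\<lambda>z. G z \<bullet> (q z - G z) - g z \<bullet> (q z - G z)) = 0"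
    using i1 proj[OF D] by simp
  \<comment> \<open>The difference of \<open>g\<close> and \<open>q\<close> is split at
    \<open>G\<close>; the middle term of the expansion has integral 0 by
    \<open>orth\<close>.\<close>
  have "?I (\<lambda>z. (g z - q z) \<bullet> (g z - q z))
      = ?I (\<lambda>z. (G z - g z) \<bullet> (G z - g z) + 2 * (G z \<bullet> (q z - G z) - g z \<bullet> (q z - G z)) + (G z - q z) \<bullet> (G z - q z))"
    by (intro arg_cong[where f="?I"] ext) (simp add: inner_diff_left inner_diff_right inner_commute algebra_simps)
  also have "\<dots> = ?I (\<lambda>z. (G z - g z) \<bullet> (G z - g z)) + ?I (\<lambda>z. (G z - q z) \<bullet> (G z - q z))"
    using Gg Gq i1 orth by simp
  also have "\<dots> \<ge> ?I (\<lambda>z. (G z - g z) \<bullet> (G z - g z))"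
    by (simp add: integral_nonneg_AE)
  finally have "?I (\<lambda>z. (norm (G z - g z))\<^sup>2) \<le> ?I (\<lambda>z. (g z - q z) \<bullet> (g z - q z))"
    by (simp add: power2_norm_eq_inner)
  also have "\<dots> = ?I (\<lambda>z. (fst (g z) - fst (q z))\<^sup>2) + ?I (\<lambda>z. (snd (g z) - snd (q z))\<^sup>2)"
    using L2_space_diff[OF L2(2) qL(1)] L2_space_diff[OF L2(3) qL(2)]
    by (simp add: inner_prod_def power2_eq_square L2_space_real)
  finally show "?I (\<lambda>z. (norm (G z - g z))\<^sup>2) \<le> (L2_norm K (\<lambda>z. fst (g z) - fst (q z)))\<^sup>2 + (L2_norm K (\<lambda>z. snd (g z) - snd (q z)))\<^sup>2"
    by (simp add: L2_norm_power2_real)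
qed

text \<open>The share of \<open>K\<close> in the square of \<open>sobolev_norm\<close>. The
  derivatives are those chosen on \<Omega>, not chosen anew on \<open>K\<close>, so that the shares
  of the elements of a mesh add up exactly.\<close>

definition sobolev_energy :: "nat \<Rightarrow> (plane \<Rightarrow> real) \<Rightarrow> real" where
  "sobolev_energy n w = (\<Sum>k\<le>n. \<Sum>l\<le>n - k. (L2_norm K (weak_pd \<Omega> k l w))\<^sup>2)"

lemma sum_power2_le:
  fixes f :: "nat \<Rightarrow> real"
  shows "(\<Sum>k\<le>m. f k)\<^sup>2 \<le> (real m + 1) * (\<Sum>k\<le>m. (f k)\<^sup>2)"
  using Cauchy_Schwarz_ineq_sum[of "\<lambda>_. 1" f "{..m}"] by (simp add: add.commute)

lemma local_error:
  assumes w: "w \<in> sobolev \<Omega> (m + 1)" and m: "m \<le> j + 1" and H: "b - a \<le> H" "d - c \<le> H"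
    and G: "G \<in> grad_space el j"
      "\<And>q. q \<in> grad_space el j \<Longrightarrow> lint K (\<lambda>z. G z \<bullet> q z) = lint K (\<lambda>z. weak_grad \<Omega> w z \<bullet> q z)"
  shows "integrable (lebesgue_on K) (\<lambda>z. (norm (G z - weak_grad \<Omega> w z))\<^sup>2)"
    and "lint K (\<lambda>z. (norm (G z - weak_grad \<Omega> w z))\<^sup>2)
      \<le> ((2 * H) ^ m)\<^sup>2 * (2 * (real m + 1)) * sobolev_energy (m + 1) w"
proof -
  note swp = sobolev_weak_pd[OF w]
  have UL2: "weak_pd \<Omega> k l w \<in> L2_space K" if "k + l \<le> m + 1" for k l
    using swp(1)[OF that] by (rule L2_space_K)
  have dx: "weak_dx (weak_pd \<Omega> k l w) (weak_pd \<Omega> (Suc k) l w)" if "k + l \<le> m" for k l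
    using that by (intro weak_dx_weak_pd[where w=w and k=k and l=l] swp) auto
  have dy: "weak_dy (weak_pd \<Omega> k l w) (weak_pd \<Omega> k (Suc l) w)" if "k + l \<le> m" for k l
    using that by (intro weak_dy_weak_pd[where w=w and k=k and l=l] swp) auto
  \<comment> \<open>Shifting the first index turns the derivatives of \<open>w\<close> into those of
    its x-derivative, so order \<open>m\<close> in the family means order \<open>m + 1\<close> for
    \<open>w\<close>.\<close>
  obtain p1 where p1: "\<And>j. m \<le> Suc j \<Longrightarrow> p1 \<in> poly_P j"
    "L2_norm K (\<lambda>z. weak_pd \<Omega> 1 0 w z - p1 z) \<le> (2 * H) ^ m * (\<Sum>k\<le>m. L2_norm K (weak_pd \<Omega> (Suc k) (m - k) w))"
    using bramble_hilbert[OF H, of m "\<lambda>k l. weak_pd \<Omega> (Suc k) l w"] UL2 dx dy by auto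
  obtain p2 where p2: "\<And>j. m \<le> Suc j \<Longrightarrow> p2 \<in> poly_P j"
    "L2_norm K (\<lambda>z. weak_pd \<Omega> 0 1 w z - p2 z) \<le> (2 * H) ^ m * (\<Sum>k\<le>m. L2_norm K (weak_pd \<Omega> k (Suc (m - k)) w))"
    using bramble_hilbert[OF H, of m "\<lambda>k l. weak_pd \<Omega> k (Suc l) w"] UL2 dx dy by auto
  have H0: "H \<ge> 0" using H ab by linarith
  define q where "q z = (p1 z, p2 z)" for z
  have q: "q \<in> grad_space el j"
    unfolding q_def[abs_def] using m by (intro pair_poly_P_grad_space p1 p2) auto
  have VL2: "(\<lambda>z. fst (f z)) \<in> L2_space K \<and> (\<lambda>z. snd (f z)) \<in> L2_space K" if "f \<in> grad_space el j" for f
    using grad_space_props(1,2)[OF that] L2_space_poly2 by auto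
  have gL2: "(\<lambda>z. fst (weak_grad \<Omega> w z)) \<in> L2_space K" "(\<lambda>z. snd (weak_grad \<Omega> w z)) \<in> L2_space K"
    using UL2[of 1 0] UL2[of 0 1] by (simp_all add: weak_grad_def)
  note ba = best_approximation[OF finite_dim_function_space[OF finite_dim_grad_space] G(1) q VL2 gL2 G(2)]
  show "integrable (lebesgue_on K) (\<lambda>z. (norm (G z - weak_grad \<Omega> w z))\<^sup>2)"
    by (rule ba(1))
  let ?U = "\<lambda>k l. (L2_norm K (weak_pd \<Omega> k l w))\<^sup>2"
  have U1: "(\<Sum>k\<le>m. ?U (Suc k) (m - k)) \<le> sobolev_energy (m + 1) w"
  proof -
    have "(\<Sum>k\<le>m. ?U (Suc k) (m - k)) \<le> (\<Sum>k\<le>m. \<Sum>l\<le>m - k. ?U (Suc k) l)"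
      by (intro sum_mono member_le_sum) auto
    also have "\<dots> \<le> (\<Sum>k\<le>Suc m. \<Sum>l\<le>Suc m - k. ?U k l)"
      by (subst sum.atMost_Suc_shift) (simp add: sum_nonneg)
    finally show ?thesis by (simp add: sobolev_energy_def)
  qed
  have U2: "(\<Sum>k\<le>m. ?U k (Suc (m - k))) \<le> sobolev_energy (m + 1) w"
  proof -
    have "(\<Sum>k\<le>m. ?U k (Suc (m - k))) \<le> (\<Sum>k\<le>m. \<Sum>l\<le>Suc m - k. ?U k l)"
    proof (intro sum_mono)
      fix k assume "k \<in> {..m}"
      then show "?U k (Suc (m - k)) \<le> (\<Sum>l\<le>Suc m - k. ?U k l)"
        by (intro member_le_sum[of "Suc (m - k)" _ "?U k"]) (auto simp: Suc_diff_le)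
    qed
    also have "\<dots> \<le> (\<Sum>k\<le>Suc m. \<Sum>l\<le>Suc m - k. ?U k l)"
      by (simp add: sum_nonneg)
    finally show ?thesis by (simp add: sobolev_energy_def)
  qed
  \<comment> \<open>The factor \<open>real m + 1\<close> comes from Cauchy-Schwarz over the
    \<open>m + 1\<close> top derivatives of one gradient component; adding the two components
    produces the factor 2 of the claim.\<close>
  have bound: "(L2_norm K f)\<^sup>2 \<le> ((2 * H) ^ m)\<^sup>2 * ((real m + 1) * sobolev_energy (m + 1) w)"
    if "L2_norm K f \<le> (2 * H) ^ m * (\<Sum>k\<le>m. g k)" "(\<Sum>k\<le>m. (g k)\<^sup>2) \<le> sobolev_energy (m + 1) w" for f :: "plane \<Rightarrow> real" and g
  proof -
    have "(L2_norm K f)\<^sup>2 \<le> ((2 * H) ^ m * (\<Sum>k\<le>m. g k))\<^sup>2"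
      using that(1) by (intro power_mono) auto
    also have "\<dots> = ((2 * H) ^ m)\<^sup>2 * (\<Sum>k\<le>m. g k)\<^sup>2" by (simp add: power_mult_distrib)
    also have "\<dots> \<le> ((2 * H) ^ m)\<^sup>2 * ((real m + 1) * (\<Sum>k\<le>m. (g k)\<^sup>2))"
      by (intro mult_left_mono sum_power2_le) auto
    also have "\<dots> \<le> ((2 * H) ^ m)\<^sup>2 * ((real m + 1) * sobolev_energy (m + 1) w)"
      using that(2) by (intro mult_left_mono) auto
    finally show ?thesis .
  qed
  have "lint K (\<lambda>z. (norm (G z - weak_grad \<Omega> w z))\<^sup>2)
      \<le> (L2_norm K (\<lambda>z. weak_pd \<Omega> 1 0 w z - p1 z))\<^sup>2 + (L2_norm K (\<lambda>z. weak_pd \<Omega> 0 1 w z - p2 z))\<^sup>2"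
    using ba(2) by (simp add: weak_grad_def q_def)
  also have "\<dots> \<le> ((2 * H) ^ m)\<^sup>2 * ((real m + 1) * sobolev_energy (m + 1) w)
      + ((2 * H) ^ m)\<^sup>2 * ((real m + 1) * sobolev_energy (m + 1) w)"
    by (intro add_mono bound[OF p1(2) U1] bound[OF p2(2) U2])
  also have "\<dots> = ((2 * H) ^ m)\<^sup>2 * (2 * (real m + 1)) * sobolev_energy (m + 1) w"
    by algebra
  finally show "lint K (\<lambda>z. (norm (G z - weak_grad \<Omega> w z))\<^sup>2)
      \<le> ((2 * H) ^ m)\<^sup>2 * (2 * (real m + 1)) * sobolev_energy (m + 1) w" .
qed

text \<open>\<open>local_grad\<close> is a definite description, so existence and uniqueness have to
  be settled. By \<open>local_grad_rhs\<close> its right-hand side is the pairing with the weak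
  gradient, so the defining condition is that of an L2 projection onto \<open>grad_space\<close>,
  which has exactly one solution.\<close>

lemma local_grad_projection:
  assumes bdd: "bounded \<Omega>" and w: "w \<in> sobolev \<Omega> (Suc m)"
    and tr: "is_trace \<Omega> E w \<gamma>" and E: "fst ` sides K \<subseteq> E"
    and v0: "fst v K \<in> interior_space el j" "\<And>q. q \<in> interior_space el j \<Longrightarrow> lint K (\<lambda>z. (w z - fst v K z) * q z) = 0"
    and vb: "\<And>F. F \<in> E \<Longrightarrow> snd v F \<in> edge_space el j F"
      "\<And>F q. F \<in> E \<Longrightarrow> q \<in> edge_space el j F \<Longrightarrow> edge_integral F (\<lambda>z. (\<gamma> z - snd v F z) * q z) = 0"
  shows "local_grad el j v K \<in> grad_space el j"
    and "q \<in> grad_space el j \<Longrightarrow> lint K (\<lambda>z. local_grad el j v K z \<bullet> q z)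
      = lint K (\<lambda>z. weak_grad \<Omega> w z \<bullet> q z)"
proof -
  let ?V = "grad_space el j"
  have gL2: "weak_pd \<Omega> 1 0 w \<in> L2_space K" "weak_pd \<Omega> 0 1 w \<in> L2_space K"
    using sobolev_weak_pd(1)[OF w] by (auto intro: L2_space_K)
  have comp: "\<exists>L1 L2. f = (\<lambda>z. (poly2 L1 z, poly2 L2 z))" if f: "f \<in> ?V" for f
  proof -
    obtain L1 L2 where L: "(\<lambda>z. fst (f z)) = poly2 L1" "(\<lambda>z. snd (f z)) = poly2 L2"
      using grad_space_props(1,2)[OF f] by auto
    have "f z = (poly2 L1 z, poly2 L2 z)" for z
      using fun_cong[OF L(1), of z] fun_cong[OF L(2), of z] by (simp add: prod_eq_iff)
    then show ?thesis by blast
  qed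
  have ex: "\<exists>!G. G \<in> ?V \<and> (\<forall>q\<in>?V. lint K (\<lambda>z. G z \<bullet> q z) = lint K (\<lambda>z. weak_grad \<Omega> w z \<bullet> q z))"
  proof (rule L2_projection_exists_unique[OF finite_dim_grad_space])
    show "continuous_on K f" if "f \<in> ?V" for f
      using comp[OF that] by (auto intro!: continuous_intros)
    show "f = (\<lambda>z. 0)" if f: "f \<in> ?V" "\<And>z. z \<in> K \<Longrightarrow> f z = 0" for f
    proof -
      obtain L1 L2 where L: "f = (\<lambda>z. (poly2 L1 z, poly2 L2 z))" using comp[OF f(1)] by blast
      then have "poly2 L1 = (\<lambda>z. 0)" "poly2 L2 = (\<lambda>z. 0)"
        using f(2) by (auto intro!: poly2_zero_on_rectangle[OF ab cd] simp: zero_prod_def)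
      then show ?thesis by (simp add: L zero_prod_def)
    qed
    have int: "integrable (lebesgue_on K) (\<lambda>z. weak_grad \<Omega> w z \<bullet> f z)" if "f \<in> ?V" for f
      using comp[OF that] integrable_mult_L2[OF gL2(1) L2_space_poly2] integrable_mult_L2[OF gL2(2) L2_space_poly2]
      by (auto simp: weak_grad_def)
    show "lint K (\<lambda>z. weak_grad \<Omega> w z \<bullet> (t *\<^sub>R f z + g z))
        = t * lint K (\<lambda>z. weak_grad \<Omega> w z \<bullet> f z) + lint K (\<lambda>z. weak_grad \<Omega> w z \<bullet> g z)"
      if "f \<in> ?V" "g \<in> ?V" for f g t
      using int[OF that(1)] int[OF that(2)] by (simp add: inner_right_distrib)
  qed (rule box_nonempty)
  have eq: "local_grad el j v K = (THE G. G \<in> ?V \<and> (\<forall>q\<in>?V.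
      lint K (\<lambda>z. G z \<bullet> q z) = lint K (\<lambda>z. weak_grad \<Omega> w z \<bullet> q z)))"
  proof -
    let ?r = "\<lambda>q. - lint K (\<lambda>z. fst v K z * div2 q z)
      + (\<Sum>(F, n)\<in>sides K. edge_integral F (\<lambda>z. snd v F z * (q z \<bullet> n)))"
    have r: "?r q = lint K (\<lambda>z. weak_grad \<Omega> w z \<bullet> q z)" if "q \<in> ?V" for q
      by (rule local_grad_rhs[OF bdd w tr E v0 vb that])
    have "(\<forall>q\<in>?V. I q = ?r q) = (\<forall>q\<in>?V. I q = lint K (\<lambda>z. weak_grad \<Omega> w z \<bullet> q z))" for I
      by (rule ball_cong[OF refl]) (simp only: r)
    then show ?thesis unfolding local_grad_def by (simp only:)
  qed
  have "local_grad el j v K \<in> ?V \<and> (\<forall>q\<in>?V.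
      lint K (\<lambda>z. local_grad el j v K z \<bullet> q z) = lint K (\<lambda>z. weak_grad \<Omega> w z \<bullet> q z))"
    using theI'[OF ex] unfolding eq[symmetric] .
  then show "local_grad el j v K \<in> ?V"
    "q \<in> ?V \<Longrightarrow> lint K (\<lambda>z. local_grad el j v K z \<bullet> q z)
      = lint K (\<lambda>z. weak_grad \<Omega> w z \<bullet> q z)" by auto
qed

lemma side_lengths_le_diameter: "b - a \<le> diameter K" "d - c \<le> diameter K"
proof -
  have "dist (a, c) (b, c) \<le> diameter K" "dist (a, c) (a, d) \<le> diameter K"
    using ab cd by (intro diameter_bounded_bound bounded_cbox; simp add: cbox_Pair_eq)+
  then show "b - a \<le> diameter K" "d - c \<le> diameter K"
    using ab cd by (simp_all add: dist_Pair_Pair dist_real_def)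
qed

end

text \<open>A point of the boundary has points on the far side of the Lipschitz graph arbitrarily
  near, and these have a neighbourhood disjoint from \<Omega>, so it cannot be interior to the
  closure. A domain with a slit shows that some such regularity is called for.\<close>

lemma interior_closure_lipschitz_domain:
  assumes "lipschitz_domain \<Omega>"
  shows "interior (closure \<Omega>) \<subseteq> \<Omega>"
proof
  fix p assume p: "p \<in> interior (closure \<Omega>)"
  show "p \<in> \<Omega>"
  proof (rule ccontr)
    assume "p \<notin> \<Omega>"
    then have "p \<in> frontier \<Omega>"
      using p interior_subset assms by (auto simp: frontier_def lipschitz_domain_def interior_open)
    then obtain e1 e2 \<delta> L g where *: "norm e1 = 1" "norm e2 = 1" "e1 \<bullet> e2 = 0" "0 < \<delta>"
      "L-lipschitz_on UNIV (g :: real \<Rightarrow> real)"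
      "\<And>z. z \<in> ball p \<delta> \<Longrightarrow> z \<in> \<Omega> \<longleftrightarrow> g ((z - p) \<bullet> e1) < (z - p) \<bullet> e2"
      using assms unfolding lipschitz_domain_def lipschitz_boundary_def by blast
    \<comment> \<open>The point \<open>p\<close> has local coordinates 0 and does not belong to
      \<Omega>, so it is not strictly above the graph.\<close>
    have g0: "g 0 \<ge> 0" using *(4) *(6)[of p] \<open>p \<notin> \<Omega>\<close> by auto
    obtain \<epsilon> where \<epsilon>: "\<epsilon> > 0" "ball p \<epsilon> \<subseteq> interior (closure \<Omega>)"
      using p open_contains_ball open_interior by blast
    define t where "t = min \<delta> \<epsilon> / 2"
    have t: "t > 0" "t < \<delta>" "t < \<epsilon>" using *(4) \<epsilon>(1) by (auto simp: t_def)
    \<comment> \<open>Moving from \<open>p\<close> against \<open>e2\<close> keeps the first local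
      coordinate at 0 and makes the second negative, hence smaller than \<open>g 0\<close>.\<close>
    define y where "y = p - t *\<^sub>R e2"
    have y: "dist p y = t" using t *(2) by (simp add: y_def dist_norm)
    then have "y \<in> closure \<Omega>" using \<epsilon>(2) t interior_subset[of "closure \<Omega>"] by auto
    have gc: "continuous_on UNIV g" using *(5) by (rule lipschitz_on_continuous_on)
    let ?W = "ball p \<delta> \<inter> {z. g ((z - p) \<bullet> e1) > (z - p) \<bullet> e2}"
    have W: "open ?W"
      by (intro open_Int open_ball open_Collect_less continuous_intros continuous_on_compose2[OF gc]) auto
    moreover have "y \<in> ?W"
    proof -
      have "(y - p) \<bullet> e1 = 0" "(y - p) \<bullet> e2 = - t"
        using *(2,3) by (simp_all add: y_def inner_commute[of e2 e1] norm_eq_1)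
      then show ?thesis using y t g0 by simp
    qed
    moreover have "?W \<inter> \<Omega> = {}" using *(6) by fastforce
    ultimately have "y \<notin> closure \<Omega>" using open_Int_closure_eq_empty[OF W] by blast
    then show False using \<open>y \<in> closure \<Omega>\<close> by blast
  qed
qed

section \<open>Assembly over the mesh\<close>

lemma mesh_rectangle:
  assumes "lipschitz_domain \<Omega>" "rect_mesh \<Omega> T" "K \<in> T"
  obtains a b c d where "K = cbox (a, c) (b, d)" "interior K = box (a, c) (b, d)" "subrectangle \<Omega> a b c d"
proof -
  have T: "T division_of closure \<Omega>" and ne: "interior K \<noteq> {}" using assms by (auto simp: rect_mesh_def)
  obtain p p' where K: "K = cbox p p'" using division_ofD(4)[OF T assms(3)] by blast
  obtain a c b d where p: "p = (a, c)" "p' = (b, d)" by (metis surj_pair)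
  have int: "interior K = box (a, c) (b, d)" by (simp add: K p)
  have "a < b" "c < d" using ne unfolding int by (auto simp: box_Pair_real)
  moreover have "box (a, c) (b, d) \<subseteq> \<Omega>"
    using interior_mono[OF division_ofD(2)[OF T assms(3)]] interior_closure_lipschitz_domain[OF assms(1)] int by blast
  moreover have "\<Omega> \<in> sets lebesgue" using assms(1) by (auto simp: lipschitz_domain_def)
  ultimately have "subrectangle \<Omega> a b c d" by unfold_locales auto
  then show ?thesis using that K p int by blast
qed

text \<open>Distinct elements overlap only on their boundaries, and \<Omega> differs from the union
  of the elements only by boundary points of elements; both are null sets, so additivity of the
  integral applies.\<close>

lemma integral_mesh:
  fixes F :: "plane \<Rightarrow> real"
  assumes \<Omega>: "lipschitz_domain \<Omega>" and T: "rect_mesh \<Omega> T"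
    and F: "\<And>K. K \<in> T \<Longrightarrow> integrable (lebesgue_on K) F"
  shows "lint \<Omega> F = (\<Sum>K\<in>T. lint K F)"
proof -
  have div: "T division_of closure \<Omega>" using T by (simp add: rect_mesh_def)
  have meas: "K \<in> sets lebesgue" if "K \<in> T" for K
    by (rule mesh_rectangle[OF \<Omega> T that]) simp
  have bdry: "negligible (K - interior K)" if "K \<in> T" for K
    by (rule mesh_rectangle[OF \<Omega> T that]) (simp add: negligible_frontier_interval)
  have set_int: "(LINT x:A|lebesgue. F x) = lint A F" if "A \<in> sets lebesgue" for A
    using that by (simp add: set_lebesgue_integral_def integral_restrict_space)
  \<comment> \<open>A point of the closure outside \<Omega> lies in some element but not in its
    interior, which is contained in \<Omega>.\<close>
  have "closure \<Omega> - \<Omega> \<subseteq> (\<Union>K\<in>T. K - interior K)"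
  proof
    fix z assume z: "z \<in> closure \<Omega> - \<Omega>"
    then obtain K where K: "K \<in> T" "z \<in> K" using division_ofD(6)[OF div] by blast
    have "interior K \<subseteq> \<Omega>"
      using interior_mono[OF division_ofD(2)[OF div K(1)]] interior_closure_lipschitz_domain[OF \<Omega>] by blast
    then show "z \<in> (\<Union>K\<in>T. K - interior K)" using z K by blast
  qed
  moreover have "negligible (\<Union>K\<in>T. K - interior K)"
    using division_ofD(1)[OF div] bdry by (intro negligible_Union) auto
  ultimately have "negligible (closure \<Omega> - \<Omega>)" by (rule negligible_subset[rotated])
  moreover have "\<Omega> - closure \<Omega> = {}" using closure_subset by blast
  ultimately have "lint \<Omega> F = lint (closure \<Omega>) F"
    using \<Omega> by (intro lebesgue_on_null_eq) (auto simp: lipschitz_domain_def)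
  also have "\<dots> = (LINT x:(\<Union>K\<in>T. K)|lebesgue. F x)"
    using division_ofD(6)[OF div] by (subst set_int) auto
  also have "\<dots> = (\<Sum>K\<in>T. (LINT x:K|lebesgue. F x))"
  proof (rule set_integral_finite_UN_AE)
    show "finite T" by (rule division_ofD(1)[OF div])
    show "set_integrable lebesgue K F" if "K \<in> T" for K
      using F[OF that] meas[OF that] by (simp add: set_integrable_def integrable_restrict_space)
    show "AE x in lebesgue. x \<in> K \<and> x \<in> K' \<longrightarrow> K = K'" if "K \<in> T" "K' \<in> T" for K K'
    proof (cases "K = K'")
      case False
      have "(K - interior K) \<union> (K' - interior K') \<in> null_sets lebesgue"
        using bdry that negligible_iff_null_sets by blast
      then show ?thesis
        by (rule AE_I') (use division_ofD(5)[OF div that False] in blast)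
    qed simp
  qed (rule meas)
  also have "\<dots> = (\<Sum>K\<in>T. lint K F)"
    by (intro sum.cong refl set_int meas)
  finally show ?thesis .
qed

text \<open>The description of the projection splits into independent problems, one for each element
  and one for each edge, all uniquely solvable. Extensionality fixes the components at all other
  sets, without which uniqueness would fail.\<close>

lemma L2_proj_spec:
  assumes \<Omega>: "lipschitz_domain \<Omega>" and T: "rect_mesh \<Omega> T"
    and w: "w \<in> L2_space \<Omega>" and \<gamma>: "\<And>F. F \<in> mesh_edges T \<Longrightarrow> \<gamma> \<in> edge_L2_space F"
  shows "L2_proj el j T w \<gamma> \<in> weak_space el j T \<and>
        (\<forall>K\<in>T. \<forall>q\<in>interior_space el j.
           lint K (\<lambda>z. (w z - fst (L2_proj el j T w \<gamma>) K z) * q z) = 0) \<and>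
        (\<forall>F\<in>mesh_edges T. \<forall>q\<in>edge_space el j F.
           edge_integral F (\<lambda>z. (\<gamma> z - snd (L2_proj el j T w \<gamma>) F z) * q z) = 0)"
proof -
  define P where "P K p \<longleftrightarrow> p \<in> interior_space el j \<and>
    (\<forall>q\<in>interior_space el j. lint K (\<lambda>z. (w z - p z) * q z) = 0)" for K p
  define Q where "Q F p \<longleftrightarrow> p \<in> edge_space el j F \<and>
    (\<forall>q\<in>edge_space el j F. edge_integral F (\<lambda>z. (\<gamma> z - p z) * q z) = 0)" for F p
  have P: "\<exists>!p. P K p" if K: "K \<in> T" for K
  proof -
    obtain a b c d where K: "K = cbox (a, c) (b, d)" "interior K = box (a, c) (b, d)" and sub: "subrectangle \<Omega> a b c d"
      by (rule mesh_rectangle[OF \<Omega> T K])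
    interpret subrectangle \<Omega> a b c d by (rule sub)
    show ?thesis
      unfolding P_def K(1) by (rule interior_projection_unique[OF L2_space_K[OF w]])
  qed
  have Q: "\<exists>!p. Q F p" if F: "F \<in> mesh_edges T" for F
  proof -
    obtain K where KT: "K \<in> T" "F \<in> fst ` sides K" using F by (auto simp: mesh_edges_def)
    obtain a b c d where K: "K = cbox (a, c) (b, d)" "interior K = box (a, c) (b, d)" and sub: "subrectangle \<Omega> a b c d"
      by (rule mesh_rectangle[OF \<Omega> T KT(1)])
    interpret subrectangle \<Omega> a b c d by (rule sub)
    have "\<exists>p p'. is_edge F p p'" using KT(2) is_edge_K unfolding K(1) sides_K by auto
    then show ?thesis
      unfolding Q_def edge_space_eq using edge_projection_unique \<gamma>[OF F] by blast
  qed
  define v where "v = (restrict (\<lambda>K. THE p. P K p) T, restrict (\<lambda>F. THE p. Q F p) (mesh_edges T))"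
  have vP: "P K (fst v K)" if "K \<in> T" for K using theI'[OF P[OF that]] that by (simp add: v_def)
  have vQ: "Q F (snd v F)" if "F \<in> mesh_edges T" for F using theI'[OF Q[OF that]] that by (simp add: v_def)
  let ?A = "\<lambda>u. u \<in> weak_space el j T \<and>
        (\<forall>K\<in>T. \<forall>q\<in>interior_space el j.
           lint K (\<lambda>z. (w z - fst u K z) * q z) = 0) \<and>
        (\<forall>F\<in>mesh_edges T. \<forall>q\<in>edge_space el j F.
           edge_integral F (\<lambda>z. (\<gamma> z - snd u F z) * q z) = 0)"
  have A_iff: "?A u \<longleftrightarrow> fst u \<in> extensional T \<and> snd u \<in> extensional (mesh_edges T) \<and>
      (\<forall>K\<in>T. P K (fst u K)) \<and> (\<forall>F\<in>mesh_edges T. Q F (snd u F))" for u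
    unfolding weak_space_def P_def Q_def PiE_def Pi_def by (cases u) auto
  have "\<exists>!u. ?A u"
  proof (rule ex1I[of _ v])
    show "?A v" unfolding A_iff using vP vQ by (simp add: v_def)
    fix u assume "?A u"
    then have u: "fst u \<in> extensional T" "snd u \<in> extensional (mesh_edges T)"
      "\<And>K. K \<in> T \<Longrightarrow> P K (fst u K)" "\<And>F. F \<in> mesh_edges T \<Longrightarrow> Q F (snd u F)"
      unfolding A_iff by auto
    have "fst u = fst v"
    proof (rule extensionalityI[OF u(1)])
      show "fst v \<in> extensional T" by (simp add: v_def)
      show "fst u K = fst v K" if "K \<in> T" for K using P[OF that] u(3)[OF that] vP[OF that] by blast
    qed
    moreover have "snd u = snd v"
    proof (rule extensionalityI[OF u(2)])
      show "snd v \<in> extensional (mesh_edges T)" by (simp add: v_def)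
      show "snd u F = snd v F" if "F \<in> mesh_edges T" for F using Q[OF that] u(4)[OF that] vQ[OF that] by blast
    qed
    ultimately show "u = v" by (rule prod_eqI)
  qed
  then show ?thesis unfolding L2_proj_def by (rule theI')
qed

theorem lemma2p2:
  fixes \<Omega> :: "(real \<times> real) set"
    and \<M> :: "(real \<times> real) set set set"
    and el :: element_type
    and j m :: nat
  assumes "lipschitz_domain \<Omega>"
    and "\<forall>T\<in>\<M>. rect_mesh \<Omega> T"
    and "shape_regular \<M>"
    and "quasi_uniform \<M>"
    and "m \<le> j + 1"
  shows "\<exists>C. \<forall>T\<in>\<M>. \<forall>w\<in>sobolev \<Omega> (m + 1). \<forall>\<gamma>. is_trace \<Omega> (mesh_edges T) w \<gamma> \<longrightarrow>
           L2_norm \<Omega> (\<lambda>z. disc_grad el j T (L2_proj el j T w \<gamma>) z - weak_grad \<Omega> w z)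
             \<le> C * mesh_size T ^ m * sobolev_norm \<Omega> (m + 1) w"
proof (intro exI ballI allI impI)
  \<comment> \<open>The constant is left open here and is read off from the last inequality, where
    it is \<open>2 ^ m * sqrt (2 * (real m + 1))\<close>; it was introduced before the mesh and the
    functions, so it cannot depend on them.\<close>
  fix T w \<gamma>
  assume TM: "T \<in> \<M>" and w: "w \<in> sobolev \<Omega> (m + 1)" and tr: "is_trace \<Omega> (mesh_edges T) w \<gamma>"
  have T: "rect_mesh \<Omega> T" using assms(2) TM by blast
  have div: "T division_of closure \<Omega>" using T by (simp add: rect_mesh_def)
  have bdd: "bounded \<Omega>" using assms(1) by (simp add: lipschitz_domain_def)
  define v where "v = L2_proj el j T w \<gamma>"
  define H where "H = mesh_size T"
  define E where "E z = (norm (disc_grad el j T v z - weak_grad \<Omega> w z))\<^sup>2" for z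
  define U where "U K k l = (L2_norm K (weak_pd \<Omega> k l w))\<^sup>2" for K k l
  define c where "c = ((2 * H) ^ m)\<^sup>2 * (2 * (real m + 1))"
  have spec: "v \<in> weak_space el j T"
    "\<And>K q. K \<in> T \<Longrightarrow> q \<in> interior_space el j \<Longrightarrow> lint K (\<lambda>z. (w z - fst v K z) * q z) = 0"
    "\<And>F q. F \<in> mesh_edges T \<Longrightarrow> q \<in> edge_space el j F \<Longrightarrow> edge_integral F (\<lambda>z. (\<gamma> z - snd v F z) * q z) = 0"
    using L2_proj_spec[OF assms(1) T, of w \<gamma> el j] w tr
    by (auto simp: v_def sobolev_def is_trace_def)
  have local: "integrable (lebesgue_on K) E \<and> lint K E \<le> c * (\<Sum>k\<le>m + 1. \<Sum>l\<le>m + 1 - k. U K k l)"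
    if KT: "K \<in> T" for K
  proof -
    obtain a b c' d where K: "K = cbox (a, c') (b, d)" and Kint: "interior K = box (a, c') (b, d)"
      and sub: "subrectangle \<Omega> a b c' d"
      by (rule mesh_rectangle[OF assms(1) T KT])
    interpret S: subrectangle \<Omega> a b c' d by (rule sub)
    have sidesE: "fst ` sides K \<subseteq> mesh_edges T" using KT by (auto simp: mesh_edges_def)
    have v0: "fst v K \<in> interior_space el j" and vb: "\<And>F. F \<in> mesh_edges T \<Longrightarrow> snd v F \<in> edge_space el j F"
      using spec(1) KT by (auto simp: weak_space_def)
    have w': "w \<in> sobolev \<Omega> (Suc m)" using w by simp
    define G where "G = local_grad el j v K"
    have G: "G \<in> grad_space el j" "\<And>q. q \<in> grad_space el j \<Longrightarrow> lint K (\<lambda>z. G z \<bullet> q z)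
      = lint K (\<lambda>z. weak_grad \<Omega> w z \<bullet> q z)"
      using S.local_grad_projection[OF bdd w' tr sidesE[unfolded K] v0[unfolded K] spec(2)[OF KT, unfolded K] vb spec(3)]
      unfolding G_def K by blast+
    have "diameter K \<le> H"
      unfolding H_def mesh_size_def using division_ofD(1)[OF div] KT by (intro Max_ge) auto
    then have HK: "b - a \<le> H" "d - c' \<le> H"
      using S.side_lengths_le_diameter unfolding K by linarith+
    have "disc_grad el j T v z = G z" if z: "z \<in> interior K" for z
    proof -
      \<comment> \<open>Interiors of distinct elements are disjoint, so only \<open>K\<close>
        contributes at \<open>z\<close>.\<close>
      have "disc_grad el j T v z = (\<Sum>K'\<in>T. if K' = K then G z else 0)"
        unfolding disc_grad_def
      proof (intro sum.cong refl)
        fix K' assume "K' \<in> T"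
        then have "z \<notin> interior K'" if "K' \<noteq> K"
          using division_ofD(5)[OF div \<open>K' \<in> T\<close> KT that] z by blast
        then show "indicat_real (interior K') z *\<^sub>R local_grad el j v K' z = (if K' = K then G z else 0)"
          using z by (auto simp: G_def)
      qed
      then show ?thesis using division_ofD(1)[OF div] KT by simp
    qed
    then have EG: "E z = (norm (G z - weak_grad \<Omega> w z))\<^sup>2" if "z \<in> box (a, c') (b, d)" for z
      using that by (simp add: E_def Kint)
    show ?thesis
      using S.local_error[OF w assms(5) HK G(1) G(2)[unfolded K]]
        S.integral_K_interior_cong[of E "\<lambda>z. (norm (G z - weak_grad \<Omega> w z))\<^sup>2"] EG
      unfolding S.sobolev_energy_def K U_def c_def by simp
  qed
  have UO: "(\<Sum>K\<in>T. U K k l) = (L2_norm \<Omega> (weak_pd \<Omega> k l w))\<^sup>2" if "k + l \<le> m + 1" for k l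
  proof -
    have "integrable (lebesgue_on K) (\<lambda>z. (weak_pd \<Omega> k l w z)\<^sup>2)" if KT: "K \<in> T" for K
    proof -
      obtain a b c' d where K: "K = cbox (a, c') (b, d)" "interior K = box (a, c') (b, d)"
        and sub: "subrectangle \<Omega> a b c' d"
        by (rule mesh_rectangle[OF assms(1) T KT])
      show ?thesis
        using subrectangle.L2_space_K[OF sub sobolev_weak_pd(1)[OF w \<open>k + l \<le> m + 1\<close>]]
        by (simp add: K L2_space_real)
    qed
    then show ?thesis
      using integral_mesh[OF assms(1) T, of "\<lambda>z. (weak_pd \<Omega> k l w z)\<^sup>2"]
      by (simp add: U_def L2_norm_power2_real)
  qed
  \<comment> \<open>The sign is what allows \<open>H ^ m\<close> to come out of the square root
    without an absolute value.\<close>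
  have H0: "H \<ge> 0"
  proof -
    have "closure \<Omega> \<noteq> {}" using assms(1) by (simp add: lipschitz_domain_def)
    then have "\<Union>T \<noteq> {}" by (simp only: division_ofD(6)[OF div] not_False_eq_True)
    then have "T \<noteq> {}" by blast
    then obtain K where K: "K \<in> T" by blast
    then have "diameter K \<le> H"
      unfolding H_def mesh_size_def using division_ofD(1)[OF div] by (intro Max_ge) auto
    moreover have "0 \<le> diameter K"
      using division_ofD(4)[OF div K] by (auto intro: diameter_ge_0)
    ultimately show ?thesis by linarith
  qed
  have "lint \<Omega> E = (\<Sum>K\<in>T. lint K E)"
    using local by (intro integral_mesh assms(1) T) blast
  also have "\<dots> \<le> (\<Sum>K\<in>T. c * (\<Sum>k\<le>m + 1. \<Sum>l\<le>m + 1 - k. U K k l))"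
    using local by (intro sum_mono) blast
  \<comment> \<open>The sum over elements is moved inside, so that for each derivative the local
    squared norms add up to the squared norm on \<Omega>.\<close>
  also have "\<dots> = c * (\<Sum>k\<le>m + 1. \<Sum>l\<le>m + 1 - k. \<Sum>K\<in>T. U K k l)"
  proof -
    have "(\<Sum>K\<in>T. \<Sum>k\<le>m + 1. \<Sum>l\<le>m + 1 - k. U K k l) = (\<Sum>k\<le>m + 1. \<Sum>K\<in>T. \<Sum>l\<le>m + 1 - k. U K k l)"
      by (rule sum.swap)
    also have "\<dots> = (\<Sum>k\<le>m + 1. \<Sum>l\<le>m + 1 - k. \<Sum>K\<in>T. U K k l)"
      by (intro sum.cong refl sum.swap)
    finally show ?thesis by (simp only: sum_distrib_left[symmetric])
  qed
  also have "\<dots> = c * (sobolev_norm \<Omega> (m + 1) w)\<^sup>2"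
  proof -
    have "(\<Sum>k\<le>m + 1. \<Sum>l\<le>m + 1 - k. \<Sum>K\<in>T. U K k l) = (\<Sum>k\<le>m + 1. \<Sum>l\<le>m + 1 - k. (L2_norm \<Omega> (weak_pd \<Omega> k l w))\<^sup>2)"
      by (intro sum.cong refl UO) auto
    also have "\<dots> = (sobolev_norm \<Omega> (m + 1) w)\<^sup>2"
      unfolding sobolev_norm_def by (intro real_sqrt_pow2[symmetric] sum_nonneg) auto
    finally show ?thesis by (simp only:)
  qed
  finally have "sqrt (lint \<Omega> E) \<le> sqrt (c * (sobolev_norm \<Omega> (m + 1) w)\<^sup>2)"
    by simp
  also have "\<dots> = (2 ^ m * sqrt (2 * (real m + 1))) * H ^ m * sobolev_norm \<Omega> (m + 1) w"
  proof -
    have "0 \<le> sobolev_norm \<Omega> (m + 1) w" by (simp add: sobolev_norm_def sum_nonneg)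
    then show ?thesis
      using H0 by (simp add: c_def real_sqrt_mult power_mult_distrib)
  qed
  finally show "L2_norm \<Omega> (\<lambda>z. disc_grad el j T (L2_proj el j T w \<gamma>) z - weak_grad \<Omega> w z)
             \<le> (2 ^ m * sqrt (2 * (real m + 1))) * mesh_size T ^ m * sobolev_norm \<Omega> (m + 1) w"
    by (simp add: L2_norm_def E_def[abs_def] v_def H_def)
qed

end
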